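(* Let $d>0$ and suppose that $\varepsilon^d:\Omega\to\mathbb{C}$ and $\sigma^d:\Sigma^d\to\mathbb{C}$ are measurable and that there are constants $c,C>0$ such that $$0<c\le \mathrm{Im}\,\varepsilon^d(x)\le C,\qquad |\mathrm{Re}\,\varepsilon^d(x)|\le C\qquad\forall x\in\Omega,$$ $$0<c\le \tfrac1d\,\mathrm{Re}\,\sigma^d(x)\le C,\qquad \Big|\tfrac1d\,\mathrm{Im}\,\sigma^d(x)\Big|\le C\qquad\forall x\in\Sigma^d .$$ Then for every $J_a\in L^2(\Omega;\mathbb{C}^3)$ there exists a unique $E^d\in X^d$ such that $$a^d(E^d,\Psi)=i\omega\int_\Omega J_a\cdot\overline{\Psi}\,dx\qquad\forall\,\Psi\in X^d .$$
   Context: Geometry: $L>0$, $\Sigma\subset\mathbb{R}^2$ is a bounded open set with smooth boundary, $\Gamma=(-L,L)$, $\Omega=\Sigma\times\Gamma\subset\mathbb{R}^3$. For $d>0$ let $\Gamma^d=\{k\in\mathbb{Z}: kd\in(-L,L-d)\}$ and $\Sigma^d=\bigcup_{k\in\Gamma^d}\Sigma\times\{kd\}$. Constants: $\omega>0$ is the frequency; $\mu>0$ and $\lambda>0$ are real scalar constants. Notation: $\nu$ is the unit normal to the surface under consideration ($\partial\Omega$ or $\Sigma^d$), and $u_T=(\nu\times u)\times\nu$ is the tangential component (on $\Sigma^d$, $u_T=(u_1,u_2,0)$). The dot product is bilinear: $u\cdot v=\sum_i u_iv_i$ (conjugation is written explicitly). $H(\mathrm{curl};\Omega)=\{u\in L^2(\Omega;\mathbb{C}^3):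 \nabla\times u\in L^2(\Omega;\mathbb{C}^3)\}$; its elements have tangential traces on $\partial\Omega$ and on $\Sigma^d$ in a weak ($H^{-1/2}$) sense. Function space: $X^d=\{u\in H(\mathrm{curl};\Omega): u_T\in L^2(\partial\Omega;\mathbb{C}^3),\ u_T\in L^2(\Sigma^d;\mathbb{C}^3)\}$ with norm $\|u\|_{X^d}^2=\|u\|_{L^2(\Omega)}^2+\|\nabla\times u\|_{L^2(\Omega)}^2+\|u_T\|_{L^2(\partial\Omega)}^2+\|u_T\|_{L^2(\Sigma^d)}^2$, where by convention $\|u_T\|_{L^2(\Sigma^d)}^2=d\int_{\Sigma^d}|u_T|^2\,do_x$ ($do_x$ is surface measure). Sesquilinear form: for $u,v\in X^d$, $$a^d(u,v)=\int_\Omega\frac1\mu(\nabla\times u)\cdot(\nabla\times\overline v)\,dx-\int_\Omega\omega^2\varepsilon^d u\cdot\overline v\,dx-\int_{\Sigma^d}i\omega\sigma^d u_T\cdot\overline v_T\,do_x-\int_{\partial\Omega}i\omega\lambda u_T\cdot\overline v_T\,do_x .$$ *)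

theory Defs
  imports "HOL-Analysis.Analysis"
begin

section \<open>Vectors in \<open>C\<^sup>3\<close>\<close>

text \<open>The dot product is bilinear; conjugation is always written explicitly.
  The library's cross product is only available on \<open>real^3\<close>.\<close>

definition cdot :: "complex^3 \<Rightarrow> complex^3 \<Rightarrow> complex" where
  "cdot u v = (\<Sum>i\<in>UNIV. u $ i * v $ i)"

definition vcnj :: "complex^3 \<Rightarrow> complex^3" where
  "vcnj u = (\<chi> i. cnj (u $ i))"

definition ccross :: "complex^3 \<Rightarrow> complex^3 \<Rightarrow> complex^3" where
  "ccross u v = vector [u $ 2 * v $ 3 - u $ 3 * v $ 2,
                        u $ 3 * v $ 1 - u $ 1 * v $ 3,
                        u $ 1 * v $ 2 - u $ 2 * v $ 1]"

definition cvec :: "real^3 \<Rightarrow> complex^3" where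
  "cvec n = (\<chi> i. complex_of_real (n $ i))"


section \<open>Smooth functions, smooth boundaries, normals\<close>

text \<open>\<open>k\<close> times continuously differentiable; only meaningful for open \<open>U\<close>.\<close>

primrec Ck_on :: "nat \<Rightarrow> ('a::euclidean_space \<Rightarrow> 'b::real_normed_vector) \<Rightarrow> 'a set \<Rightarrow> bool" where
  "Ck_on 0 f U \<longleftrightarrow> continuous_on U f"
| "Ck_on (Suc k) f U \<longleftrightarrow> (\<forall>x\<in>U. f differentiable (at x)) \<and>
     (\<forall>b\<in>Basis. Ck_on k (\<lambda>x. frechet_derivative f (at x) b) U)"

definition smooth_on :: "('a::euclidean_space \<Rightarrow> 'b::real_normed_vector) \<Rightarrow> 'a set \<Rightarrow> bool" where
  "smooth_on f U \<longleftrightarrow> (\<forall>k. Ck_on k f U)"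

definition grad :: "('a::euclidean_space \<Rightarrow> real) \<Rightarrow> 'a \<Rightarrow> 'a" where
  "grad f x = (\<Sum>b\<in>Basis. frechet_derivative f (at x) b *\<^sub>R b)"

definition local_defining_function ::
    "'a::euclidean_space set \<Rightarrow> 'a \<Rightarrow> 'a set \<Rightarrow> ('a \<Rightarrow> real) \<Rightarrow> bool" where
  "local_defining_function D p U \<rho> \<longleftrightarrow>
     open U \<and> p \<in> U \<and> smooth_on \<rho> U \<and> grad \<rho> p \<noteq> 0 \<and> D \<inter> U = {x \<in> U. \<rho> x < 0}"

definition smooth_boundary :: "'a::euclidean_space set \<Rightarrow> bool" where
  "smooth_boundary D \<longleftrightarrow> (\<forall>p\<in>frontier D. \<exists>U \<rho>. local_defining_function D p U \<rho>)"

text \<open>The outer unit normal of \<open>D\<close> at those boundary points near which the boundary is smooth.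
  The direction of \<open>grad \<rho> p\<close> does not depend on the choice of \<open>\<rho>\<close>. At all other points the
  value is \<open>0\<close>; for the cylinder below these are the points of its two edges, a set of
  surface measure zero.\<close>

definition outer_normal :: "'a::euclidean_space set \<Rightarrow> 'a \<Rightarrow> 'a" where
  "outer_normal D p =
     (if p \<in> frontier D \<and> (\<exists>U \<rho>. local_defining_function D p U \<rho>)
      then (THE n. \<exists>U \<rho>. local_defining_function D p U \<rho> \<and> n = grad \<rho> p /\<^sub>R norm (grad \<rho> p))
      else 0)"


section \<open>Surface measure\<close>

text \<open>Surface measure is two-dimensional Hausdorff measure. The factor \<open>pi / 4\<close> normalises
  it so that it agrees with area on smooth surfaces. The countable covers range over bounded
  sets because \<open>diameter\<close> is only meaningful for those; empty sets have diameter \<open>0\<close>.\<close>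

definition hausdorff2_pre :: "real \<Rightarrow> (real^3) set \<Rightarrow> ennreal" where
  "hausdorff2_pre \<delta> A =
     (INF C\<in>{C :: nat \<Rightarrow> (real^3) set. A \<subseteq> (\<Union>i. C i) \<and> (\<forall>i. bounded (C i) \<and> diameter (C i) \<le> \<delta>)}.
        (\<Sum>i. ennreal (pi / 4 * (diameter (C i))\<^sup>2)))"

definition hausdorff2_outer :: "(real^3) set \<Rightarrow> ennreal" where
  "hausdorff2_outer A = (SUP \<delta>\<in>{0<..}. hausdorff2_pre \<delta> A)"

definition surface_measure :: "(real^3) measure" where
  "surface_measure = completion (measure_of UNIV (sets borel) hausdorff2_outer)"

definition surface_on :: "(real^3) set \<Rightarrow> (real^3) measure" where
  "surface_on A = restrict_space surface_measure A"


section \<open>The space \<open>L\<^sup>2\<close>, weak curl and weak tangential traces\<close>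

text \<open>Elements of \<open>L\<^sup>2\<close> are represented by functions; representatives that agree almost
  everywhere stand for the same element.\<close>

definition L2 :: "(real^3) measure \<Rightarrow> (real^3 \<Rightarrow> complex^3) \<Rightarrow> bool" where
  "L2 M u \<longleftrightarrow> u \<in> borel_measurable M \<and> integrable M (\<lambda>x. (norm (u x))\<^sup>2)"

text \<open>Smooth \<open>C\<^sup>3\<close>-valued functions with compact support contained in \<open>V\<close>.\<close>

definition test_fields :: "(real^3) set \<Rightarrow> (real^3 \<Rightarrow> complex^3) set" where
  "test_fields V = {\<phi>. smooth_on \<phi> UNIV \<and> compact (closure {x. \<phi> x \<noteq> 0}) \<and>
                       closure {x. \<phi> x \<noteq> 0} \<subseteq> V}"

definition classical_curl :: "(real^3 \<Rightarrow> complex^3) \<Rightarrow> real^3 \<Rightarrow> complex^3" where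
  "classical_curl \<phi> x =
     (let D = (\<lambda>j i. frechet_derivative \<phi> (at x) (axis j 1) $ i)
      in vector [D 2 3 - D 3 2, D 3 1 - D 1 3, D 1 2 - D 2 1])"

definition is_weak_curl ::
    "(real^3) set \<Rightarrow> (real^3 \<Rightarrow> complex^3) \<Rightarrow> (real^3 \<Rightarrow> complex^3) \<Rightarrow> bool" where
  "is_weak_curl D u w \<longleftrightarrow> L2 (lebesgue_on D) w \<and>
     (\<forall>\<phi>\<in>test_fields D.
        (LINT x|lebesgue_on D. cdot (w x) (\<phi> x)) =
        (LINT x|lebesgue_on D. cdot (u x) (classical_curl \<phi> x)))"

definition Hcurl :: "(real^3) set \<Rightarrow> (real^3 \<Rightarrow> complex^3) set" where
  "Hcurl D = {u. L2 (lebesgue_on D) u \<and> (\<exists>w. is_weak_curl D u w)}"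

text \<open>A choice of representative; it is unique up to null sets.\<close>

definition wcurl :: "(real^3) set \<Rightarrow> (real^3 \<Rightarrow> complex^3) \<Rightarrow> real^3 \<Rightarrow> complex^3" where
  "wcurl D u = (SOME w. is_weak_curl D u w)"

text \<open>The tangential trace of \<open>u\<close> is defined through Green's formula
  \[ \int_D (\nabla\times u)\cdot\phi - u\cdot(\nabla\times\phi)\,dx
       = \int_{\partial D} (\nu\times u)\cdot\phi\,do_x. \]
  \<open>trace_identity D w A n T u g\<close> says that, for test fields in \<open>T\<close>, the right-hand side is given by
  the density \<open>g\<close> on the part \<open>A\<close> of the boundary of \<open>D\<close>, where \<open>w\<close> is the curl of \<open>u\<close> and \<open>n\<close> is
  the unit normal; test fields in \<open>T\<close> are meant to vanish on the rest of the boundary.\<close>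

definition trace_identity ::
    "(real^3) set \<Rightarrow> (real^3 \<Rightarrow> complex^3) \<Rightarrow> (real^3) set \<Rightarrow> (real^3 \<Rightarrow> real^3) \<Rightarrow>
     (real^3 \<Rightarrow> complex^3) set \<Rightarrow> (real^3 \<Rightarrow> complex^3) \<Rightarrow> (real^3 \<Rightarrow> complex^3) \<Rightarrow> bool" where
  "trace_identity D w A n T u g \<longleftrightarrow>
     (\<forall>\<phi>\<in>T.
        (LINT x|lebesgue_on D. cdot (w x) (\<phi> x) - cdot (u x) (classical_curl \<phi> x)) =
        (LINT x|surface_on A. cdot (ccross (cvec (n x)) (g x)) (\<phi> x)))"

text \<open>\<open>g\<close> is a square integrable field with \<open>(\<nu> \<times> g) \<times> \<nu> = g\<close>, i.e. a tangential one.\<close>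

definition L2_tangential ::
    "(real^3) set \<Rightarrow> (real^3 \<Rightarrow> real^3) \<Rightarrow> (real^3 \<Rightarrow> complex^3) \<Rightarrow> bool" where
  "L2_tangential A n g \<longleftrightarrow> L2 (surface_on A) g \<and>
     (AE x in surface_on A. ccross (ccross (cvec (n x)) (g x)) (cvec (n x)) = g x)"

definition is_bdry_trace ::
    "(real^3) set \<Rightarrow> (real^3 \<Rightarrow> complex^3) \<Rightarrow> (real^3 \<Rightarrow> complex^3) \<Rightarrow> bool" where
  "is_bdry_trace D u g \<longleftrightarrow>
     L2_tangential (frontier D) (outer_normal D) g \<and>
     trace_identity D (wcurl D u) (frontier D) (outer_normal D) (test_fields UNIV) u g"

definition bdry_trace :: "(real^3) set \<Rightarrow> (real^3 \<Rightarrow> complex^3) \<Rightarrow> real^3 \<Rightarrow> complex^3" where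
  "bdry_trace D u = (SOME g. is_bdry_trace D u g)"


section \<open>The cylinder and the layers\<close>

definition proj12 :: "real^3 \<Rightarrow> real^2" where
  "proj12 x = vector [x $ 1, x $ 2]"

definition cylinder :: "(real^2) set \<Rightarrow> real \<Rightarrow> (real^3) set" where
  "cylinder S L = {x. proj12 x \<in> S \<and> x $ 3 \<in> {-L<..<L}}"

definition layer_index :: "real \<Rightarrow> real \<Rightarrow> int set" where
  "layer_index L d = {k. of_int k * d \<in> {-L<..<L - d}}"

definition layer :: "(real^2) set \<Rightarrow> real \<Rightarrow> int \<Rightarrow> (real^3) set" where
  "layer S d k = {x. proj12 x \<in> S \<and> x $ 3 = of_int k * d}"

definition layers :: "(real^2) set \<Rightarrow> real \<Rightarrow> real \<Rightarrow> (real^3) set" where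
  "layers S L d = (\<Union>k\<in>layer_index L d. layer S d k)"

text \<open>The trace on a layer is taken from below, with normal \<open>e\<^sub>3\<close> and test fields that vanish
  near the boundary of the cylinder. Since the curl is square integrable on the whole cylinder, the
  trace from above is the same.\<close>

definition is_layer_trace ::
    "(real^2) set \<Rightarrow> real \<Rightarrow> real \<Rightarrow> (real^3 \<Rightarrow> complex^3) \<Rightarrow> (real^3 \<Rightarrow> complex^3) \<Rightarrow> bool" where
  "is_layer_trace S L d u g \<longleftrightarrow>
     L2_tangential (layers S L d) (\<lambda>_. axis 3 1) g \<and>
     (\<forall>k\<in>layer_index L d.
        trace_identity (cylinder S L \<inter> {x. x $ 3 < of_int k * d}) (wcurl (cylinder S L) u)
          (layer S d k) (\<lambda>_. axis 3 1) (test_fields (cylinder S L)) u g)"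

definition layer_trace ::
    "(real^2) set \<Rightarrow> real \<Rightarrow> real \<Rightarrow> (real^3 \<Rightarrow> complex^3) \<Rightarrow> real^3 \<Rightarrow> complex^3" where
  "layer_trace S L d u = (SOME g. is_layer_trace S L d u g)"


section \<open>The function space and the sesquilinear form\<close>

definition Xd :: "(real^2) set \<Rightarrow> real \<Rightarrow> real \<Rightarrow> (real^3 \<Rightarrow> complex^3) set" where
  "Xd S L d = {u \<in> Hcurl (cylinder S L).
     (\<exists>g. is_bdry_trace (cylinder S L) u g) \<and> (\<exists>g. is_layer_trace S L d u g)}"

definition ad ::
    "(real^2) set \<Rightarrow> real \<Rightarrow> real \<Rightarrow> real \<Rightarrow> real \<Rightarrow> real \<Rightarrow> (real^3 \<Rightarrow> complex) \<Rightarrow> (real^3 \<Rightarrow> complex) \<Rightarrow>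
     (real^3 \<Rightarrow> complex^3) \<Rightarrow> (real^3 \<Rightarrow> complex^3) \<Rightarrow> complex" where
  "ad S L d \<omega> \<mu> \<kappa> \<epsilon> \<sigma> u v =
     (LINT x|lebesgue_on (cylinder S L).
        1 / of_real \<mu> * cdot (wcurl (cylinder S L) u x) (wcurl (cylinder S L) (\<lambda>y. vcnj (v y)) x))
   - (LINT x|lebesgue_on (cylinder S L). (of_real \<omega>)\<^sup>2 * \<epsilon> x * cdot (u x) (vcnj (v x)))
   - (LINT x|surface_on (layers S L d).
        \<i> * of_real \<omega> * \<sigma> x * cdot (layer_trace S L d u x) (vcnj (layer_trace S L d v x)))
   - (LINT x|surface_on (frontier (cylinder S L)).
        \<i> * of_real \<omega> * of_real \<kappa> *
          cdot (bdry_trace (cylinder S L) u x) (vcnj (bdry_trace (cylinder S L) v x)))"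

end

theory Submission
  imports Defs
begin

text \<open>The form is bounded on the space \<open>X\<^sup>d\<close> and becomes coercive after multiplication with a complex
number, so the result is an instance of the lemma of Lax and Milgram. The imaginary part of
\<open>- a(u,u)\<close> controls the field and both of its traces, because the imaginary part of \<open>\<epsilon>\<close> and the
real part of \<open>\<sigma>\<close> are bounded below; the real part of \<open>a(u,u)\<close> controls the curl up to terms that
the imaginary part controls. For a large real number \<open>m\<close> the real part of \<open>(1 + i m) a(u,u)\<close>
therefore dominates the square of the norm of \<open>u\<close> (\<open>form_coercive\<close>, with \<open>m = C / c + 1\<close>).

What takes work is that \<open>X\<^sup>d\<close>, a set of functions whose curl and traces are picked by a choice
operator, is a complete semi-inner product space. An element is described by a quadruple: a field,
its curl, its trace on the layers and its trace on the boundary. The defining conditions of such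
an \<open>admissible\<close> quadruple are pointwise tangentiality and a family of linear equations between
integrals against fixed bounded weights. They survive linear combinations, conjugation and
\<open>L\<^sup>2\<close> limits (\<open>admissible_comb\<close>, \<open>admissible_vcnj\<close>, \<open>admissible_limit\<close>), and the first component
determines the other three almost everywhere (\<open>admissible_unique\<close>). Hence the choice operators
act linearly up to null sets, and completeness of \<open>X\<^sup>d\<close> follows from completeness of \<open>L\<^sup>2\<close>.

Uniqueness of the curl and of the traces is the fundamental lemma of the calculus of variations,
for Lebesgue measure and for surface measure. For surface measure it rests on two facts about the
boundary of the cylinder: its area is finite and its normal is a Borel function. The layers and
the two caps are flat. On the lateral wall a local defining function of the cross-section vanishes,
so that by the mean value theorem one of the two coordinates is a Lipschitz function of the other; a square
grid in the parameter plane then yields covers of bounded total size. The normal is continuous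
where the boundary is smooth and zero elsewhere.\<close>

section \<open>The lemma of Lax and Milgram\<close>

text \<open>A complete space with a semi-inner product. The vectors are functions that matter only up to null
sets, so the space is a set \<open>V\<close> with one operation, \<open>comb u t v\<close> for \<open>u + t v\<close>, and every law is
stated through \<open>G\<close>: two vectors at distance zero need not be equal, and \<open>comb\<close> need not satisfy
the vector space axioms.\<close>

locale semi_hilbert =
  fixes V :: "'v set" and comb :: "'v \<Rightarrow> real \<Rightarrow> 'v \<Rightarrow> 'v" and G :: "'v \<Rightarrow> 'v \<Rightarrow> real"
  assumes nonempty: "V \<noteq> {}"
    and comb_closed: "\<And>u v t. u \<in> V \<Longrightarrow> v \<in> V \<Longrightarrow> comb u t v \<in> V"
    and G_comb: "\<And>u v w t. u \<in> V \<Longrightarrow> v \<in> V \<Longrightarrow> w \<in> V \<Longrightarrow> G (comb u t v) w = G u w + t * G v w"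
    and G_sym: "\<And>u v. u \<in> V \<Longrightarrow> v \<in> V \<Longrightarrow> G u v = G v u"
    and G_nonneg: "\<And>v. v \<in> V \<Longrightarrow> 0 \<le> G v v"
    and complete: "\<And>X. (\<And>n. X n \<in> V) \<Longrightarrow>
       (\<And>e. 0 < e \<Longrightarrow> \<exists>N. \<forall>m\<ge>N. \<forall>n\<ge>N. G (comb (X m) (-1) (X n)) (comb (X m) (-1) (X n)) < e) \<Longrightarrow>
       \<exists>l\<in>V. (\<lambda>n::nat. G (comb (X n) (-1) l) (comb (X n) (-1) l)) \<longlonglongrightarrow> 0"
begin

lemma G_comb_right:
  assumes "u \<in> V" "v \<in> V" "w \<in> V"
  shows "G w (comb u t v) = G w u + t * G w v"
  using assms by (metis G_comb G_sym comb_closed)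

lemma G_comb_comb:
  assumes "u \<in> V" "v \<in> V"
  shows "G (comb u t v) (comb u t v) = G u u + 2 * t * G u v + t\<^sup>2 * G v v"
  using assms
  by (simp add: G_comb G_comb_right comb_closed G_sym[of v u] power2_eq_square algebra_simps)

text \<open>A linear functional bounded by \<open>K\<close> on the unit ball has norm at most \<open>K\<close>. The vector \<open>v\<close> is scaled
by \<open>1 / (\<parallel>v\<parallel> + e)\<close>, because \<open>\<parallel>v\<parallel>\<close> may be zero; scaling by \<open>s\<close> is written \<open>comb v (s - 1) v\<close>.\<close>

lemma functional_bound:
  assumes F: "\<And>u v t. u \<in> V \<Longrightarrow> v \<in> V \<Longrightarrow> F (comb u t v) = F u + t * (F v :: real)"
    and K: "0 \<le> K" "\<And>v. v \<in> V \<Longrightarrow> G v v \<le> 1 \<Longrightarrow> \<bar>F v\<bar> \<le> K"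
    and v: "v \<in> V"
  shows "\<bar>F v\<bar> \<le> K * sqrt (G v v)"
proof -
  have step: "\<bar>F v\<bar> \<le> K * (sqrt (G v v) + e)" if "0 < e" for e
  proof -
    define r where "r = sqrt (G v v) + e"
    have r: "0 < r" using that G_nonneg[OF v] by (simp add: r_def add_nonneg_pos)
    define w where "w = comb v (1/r - 1) v"
    have w: "w \<in> V" using v by (simp add: w_def comb_closed)
    have "G w w = G v v * (1/r)\<^sup>2"
      unfolding w_def G_comb_comb[OF v v] by (simp add: power2_eq_square algebra_simps)
    also have "\<dots> \<le> r\<^sup>2 * (1/r)\<^sup>2"
    proof (rule mult_right_mono)
      have "G v v = (sqrt (G v v))\<^sup>2" using G_nonneg[OF v] by simp
      also have "\<dots> \<le> r\<^sup>2" using that G_nonneg[OF v] by (intro power_mono) (auto simp: r_def)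
      finally show "G v v \<le> r\<^sup>2" .
    qed simp
    also have "\<dots> = 1" using r by (simp add: power2_eq_square)
    finally have "\<bar>F w\<bar> \<le> K" using K w by blast
    moreover have "F w = F v / r" unfolding w_def F[OF v v] by (simp add: algebra_simps)
    ultimately show ?thesis using r by (simp add: abs_div_pos[symmetric] r_def[symmetric] pos_divide_le_eq)
  qed
  show ?thesis
  proof (cases "K = 0")
    case True
    then show ?thesis using step[of 1] by simp
  next
    case False
    then have "0 < K" using K by simp
    show ?thesis
    proof (rule field_le_epsilon)
      fix e :: real assume "0 < e"
      then show "\<bar>F v\<bar> \<le> K * sqrt (G v v) + e"
        using step[of "e / K"] \<open>0 < K\<close> by (simp add: algebra_simps)
    qed
  qed
qed

lemma Cauchy_Schwarz_G:
  assumes "u \<in> V" "v \<in> V"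
  shows "\<bar>G u v\<bar> \<le> sqrt (G u u) * sqrt (G v v)"
proof -
  have one: "\<bar>G x y\<bar> \<le> 1" if "x \<in> V" "y \<in> V" "G x x \<le> 1" "G y y \<le> 1" for x y
  proof -
    have "0 \<le> G x x + 2 * G x y + G y y" "0 \<le> G x x - 2 * G x y + G y y"
      using G_nonneg[OF comb_closed[OF that(1,2), of 1]] G_nonneg[OF comb_closed[OF that(1,2), of "-1"]]
      by (simp_all add: G_comb_comb that)
    then show ?thesis using that by linarith
  qed
  have two: "\<bar>G y x\<bar> \<le> 1 * sqrt (G x x)" if "x \<in> V" "y \<in> V" "G y y \<le> 1" for x y
    using that by (intro functional_bound) (auto simp: G_comb_right intro: one)
  have "\<bar>G u v\<bar> \<le> sqrt (G v v) * sqrt (G u u)"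
    using assms two[OF assms(2)] G_nonneg by (intro functional_bound[of "\<lambda>u. G u v"]) (auto simp: G_comb)
  then show ?thesis by (simp add: mult.commute)
qed

text \<open>The representing vector is the limit of a minimising sequence of \<open>\<Phi> v = G v v - 2 F v\<close>. The
parallelogram law makes the sequence Cauchy, and the first variation of \<open>\<Phi>\<close> vanishes in the limit.\<close>

theorem riesz_representation:
  assumes F: "\<And>u v t. u \<in> V \<Longrightarrow> v \<in> V \<Longrightarrow> F (comb u t v) = F u + t * (F v :: real)"
    and K: "\<And>v. v \<in> V \<Longrightarrow> \<bar>F v\<bar> \<le> K * sqrt (G v v)"
  obtains r where "r \<in> V" "\<And>v. v \<in> V \<Longrightarrow> F v = G r v"
proof -
  define \<Phi> where "\<Phi> v = G v v - 2 * F v" for v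
  have low: "- K\<^sup>2 \<le> \<Phi> v" if "v \<in> V" for v
  proof -
    have "G v v = (sqrt (G v v))\<^sup>2" using G_nonneg[OF that] by simp
    moreover have "0 \<le> (sqrt (G v v) - K)\<^sup>2" by simp
    ultimately have "- K\<^sup>2 \<le> G v v - 2 * (K * sqrt (G v v))"
      unfolding power2_diff by (simp only: mult_ac)
    then show ?thesis using K[OF that] unfolding \<Phi>_def by linarith
  qed
  define m where "m = Inf (\<Phi> ` V)"
  have bdd: "bdd_below (\<Phi> ` V)" using low by (auto simp: bdd_below_def)
  have m_le: "m \<le> \<Phi> v" if "v \<in> V" for v
    unfolding m_def using bdd that by (intro cInf_lower) auto
  have "\<exists>v\<in>V. \<Phi> v < m + inverse (real (Suc n))" for n
    using cInf_lessD[of "\<Phi> ` V" "m + inverse (real (Suc n))"] nonempty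
    unfolding m_def by auto
  then obtain X where X: "\<And>n. X n \<in> V" "\<And>n. \<Phi> (X n) < m + inverse (real (Suc n))"
    by metis
  \<comment> \<open>The midpoint of \<open>a\<close> and \<open>b\<close> is \<open>a - (a - b) / 2\<close>; comparing \<open>\<Phi>\<close> there with \<open>m\<close> is the
    parallelogram law.\<close>
  have par: "G (comb a (-1) b) (comb a (-1) b) \<le> 2 * (\<Phi> a - m) + 2 * (\<Phi> b - m)"
    if a: "a \<in> V" and b: "b \<in> V" for a b
  proof -
    define \<delta> where "\<delta> = comb a (-1) b"
    have \<delta>: "\<delta> \<in> V" using that by (simp add: \<delta>_def comb_closed)
    define c where "c = comb a (-1/2) \<delta>"
    have 1: "m \<le> \<Phi> c" using a \<delta> by (simp add: m_le comb_closed c_def)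
    have 2: "G \<delta> \<delta> = G a a - 2 * G a b + G b b" unfolding \<delta>_def G_comb_comb[OF a b] by simp
    have 3: "G a \<delta> = G a a - G a b" unfolding \<delta>_def using a b by (simp add: G_comb_right)
    have 4: "F \<delta> = F a - F b" unfolding \<delta>_def F[OF a b] by simp
    have "\<Phi> c = G a a - G a \<delta> + G \<delta> \<delta> / 4 - 2 * (F a - F \<delta> / 2)"
      unfolding c_def \<Phi>_def G_comb_comb[OF a \<delta>] F[OF a \<delta>] by (simp add: power2_eq_square)
    then show ?thesis using 1 2 3 4 unfolding \<delta>_def[symmetric] \<Phi>_def by (simp add: field_simps)
  qed
  have "\<exists>l\<in>V. (\<lambda>n. G (comb (X n) (-1) l) (comb (X n) (-1) l)) \<longlonglongrightarrow> 0"
  proof (rule complete)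
    fix e :: real assume "0 < e"
    then obtain N where N: "inverse (real (Suc N)) < e / 4" using reals_Archimedean[of "e/4"] by auto
    have "G (comb (X i) (-1) (X j)) (comb (X i) (-1) (X j)) < e" if "N \<le> i" "N \<le> j" for i j
    proof -
      have "inverse (real (Suc k)) < e / 4" if "N \<le> k" for k
        using N that by (auto intro!: le_imp_inverse_le elim!: order.strict_trans1[rotated])
      then have "\<Phi> (X i) < m + e / 4" "\<Phi> (X j) < m + e / 4"
        using X(2)[of i] X(2)[of j] that by (meson add_strict_left_mono less_trans)+
      then show ?thesis using par[OF X(1)[of i] X(1)[of j]] by (simp add: field_simps)
    qed
    then show "\<exists>N. \<forall>m\<ge>N. \<forall>n\<ge>N. G (comb (X m) (-1) (X n)) (comb (X m) (-1) (X n)) < e" by blast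
  qed (rule X)
  then obtain l where l: "l \<in> V" and lim: "(\<lambda>n. G (comb (X n) (-1) l) (comb (X n) (-1) l)) \<longlonglongrightarrow> 0" by blast
  have "F w = G l w" if w: "w \<in> V" for w
  proof -
    have "(\<lambda>n. sqrt (G (comb (X n) (-1) l) (comb (X n) (-1) l)) * sqrt (G w w)) \<longlonglongrightarrow> sqrt 0 * sqrt (G w w)"
      by (intro tendsto_intros lim)
    then have "(\<lambda>n. G (X n) w - G l w) \<longlonglongrightarrow> 0"
    proof (rule Lim_null_comparison[rotated, OF tendsto_eq_rhs])
      show "\<forall>\<^sub>F n in sequentially. norm (G (X n) w - G l w)
         \<le> sqrt (G (comb (X n) (-1) l) (comb (X n) (-1) l)) * sqrt (G w w)"
      proof (rule always_eventually, rule allI)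
        fix n
        show "norm (G (X n) w - G l w) \<le> sqrt (G (comb (X n) (-1) l) (comb (X n) (-1) l)) * sqrt (G w w)"
          using Cauchy_Schwarz_G[OF comb_closed[OF X(1) l] w, of n "-1"] G_comb[OF X(1) l w, of n "-1"]
          by simp
      qed
    qed simp
    then have Gl: "(\<lambda>n. G (X n) w) \<longlonglongrightarrow> G l w" by (simp add: LIM_zero_iff)
    have t: "0 \<le> 2 * t * (G l w - F w) + t\<^sup>2 * G w w" for t
    proof (rule LIMSEQ_le_const)
      have "(\<lambda>n. 2 * t * (G (X n) w - F w) + t\<^sup>2 * G w w + inverse (real (Suc n)))
             \<longlonglongrightarrow> 2 * t * (G l w - F w) + t\<^sup>2 * G w w + 0"
        by (intro tendsto_intros Gl LIMSEQ_inverse_real_of_nat)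
      then show "(\<lambda>n. 2 * t * (G (X n) w - F w) + t\<^sup>2 * G w w + inverse (real (Suc n)))
             \<longlonglongrightarrow> 2 * t * (G l w - F w) + t\<^sup>2 * G w w" by simp
      show "\<exists>N. \<forall>n\<ge>N. 0 \<le> 2 * t * (G (X n) w - F w) + t\<^sup>2 * G w w + inverse (real (Suc n))"
      proof (intro exI allI impI)
        fix n
        have "m \<le> \<Phi> (comb (X n) t w)" using X w by (simp add: m_le comb_closed)
        also have "\<dots> = \<Phi> (X n) + 2 * t * (G (X n) w - F w) + t\<^sup>2 * G w w"
          unfolding \<Phi>_def G_comb_comb[OF X(1) w] F[OF X(1) w] by (simp add: algebra_simps)
        finally show "0 \<le> 2 * t * (G (X n) w - F w) + t\<^sup>2 * G w w + inverse (real (Suc n))"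
          using X(2)[of n] by linarith
      qed
    qed
    \<comment> \<open>A parabola \<open>2 t x + t\<^sup>2 G w w\<close> that is nowhere negative has no linear term; \<open>t = - x s\<close> with a
      small \<open>s\<close> tests this also if \<open>G w w = 0\<close>.\<close>
    define x where "x = G l w - F w"
    define s where "s = 1 / (G w w + 1)"
    have s: "0 < s" "s * G w w \<le> 1" using G_nonneg[OF w] by (auto simp: s_def)
    have "0 \<le> 2 * (- (x * s)) * x + (- (x * s))\<^sup>2 * G w w" using t[of "- (x * s)"] by (simp add: x_def)
    also have "\<dots> = x\<^sup>2 * s * (s * G w w - 2)" by (simp add: power2_eq_square algebra_simps)
    finally have "0 \<le> x\<^sup>2 * s * (s * G w w - 2)" .
    then have "x = 0" using s by (auto simp: zero_le_mult_iff mult_le_0_iff)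
    then show ?thesis by (simp add: x_def)
  qed
  with l show ?thesis using that by blast
qed

text \<open>Riesz' theorem provides \<open>A\<close> with \<open>B u v = G (A u) v\<close> and \<open>f\<close> with \<open>F v = G f v\<close>, and \<open>A u = f\<close> has to
be solved. Since \<open>\<alpha> \<parallel>u\<parallel> \<le> \<parallel>A u\<parallel> \<le> M \<parallel>u\<parallel>\<close>, the form \<open>G (A u) (A v)\<close> is a semi-inner product
equivalent to \<open>G\<close>, and Riesz' theorem for this form solves the normal equation
\<open>G (A u - f) (A v) = 0\<close> for all \<open>v\<close>. Then \<open>z = A u - f\<close> satisfies \<open>B z z = G (A z) z = 0\<close>, so
coercivity gives \<open>z = 0\<close> up to distance zero.\<close>

theorem lax_milgram_real:
  assumes B1: "\<And>u v w t. u \<in> V \<Longrightarrow> v \<in> V \<Longrightarrow> w \<in> V \<Longrightarrow> B (comb u t v) w = B u w + t * (B v w :: real)"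
    and B2: "\<And>u v w t. u \<in> V \<Longrightarrow> v \<in> V \<Longrightarrow> w \<in> V \<Longrightarrow> B w (comb u t v) = B w u + t * B w v"
    and bounded: "\<And>u v. u \<in> V \<Longrightarrow> v \<in> V \<Longrightarrow> \<bar>B u v\<bar> \<le> K * (G u u + G v v)"
    and coercive: "0 < \<alpha>" "\<And>v. v \<in> V \<Longrightarrow> \<alpha> * G v v \<le> B v v"
    and F: "\<And>u v t. u \<in> V \<Longrightarrow> v \<in> V \<Longrightarrow> F (comb u t v) = F u + t * (F v :: real)"
    and F_bounded: "\<And>v. v \<in> V \<Longrightarrow> \<bar>F v\<bar> \<le> KF * (1 + G v v)"
  obtains u where "u \<in> V" "\<And>v. v \<in> V \<Longrightarrow> B u v = F v"
proof -
  define M where "M = 2 * \<bar>K\<bar>"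
  have M0: "0 \<le> M" by (simp add: M_def)
  have unit: "\<bar>B u v\<bar> \<le> M" if "u \<in> V" "v \<in> V" "G u u \<le> 1" "G v v \<le> 1" for u v
  proof -
    have "K * (G u u + G v v) \<le> \<bar>K\<bar> * (1 + 1)"
      using that G_nonneg by (intro mult_mono add_mono) auto
    then show ?thesis using bounded[OF that(1,2)] by (simp add: M_def)
  qed
  have half: "\<bar>B u v\<bar> \<le> M * sqrt (G v v)" if "u \<in> V" "v \<in> V" "G u u \<le> 1" for u v
    using that by (intro functional_bound[of "B u"]) (auto simp: B2 unit M0)
  have BM: "\<bar>B u v\<bar> \<le> (M * sqrt (G v v)) * sqrt (G u u)" if "u \<in> V" "v \<in> V" for u v
    using that by (intro functional_bound[of "\<lambda>u. B u v"]) (auto simp: B1 half M0 G_nonneg)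
  have "\<exists>r\<in>V. \<forall>v\<in>V. B u v = G r v" if "u \<in> V" for u
  proof -
    obtain r where "r \<in> V" "\<And>v. v \<in> V \<Longrightarrow> B u v = G r v"
    proof (rule riesz_representation[of "B u" "M * sqrt (G u u)"])
      show "\<bar>B u v\<bar> \<le> M * sqrt (G u u) * sqrt (G v v)" if "v \<in> V" for v
        using BM[OF \<open>u \<in> V\<close> that] by (simp add: mult_ac)
      show "B u (comb x t y) = B u x + t * B u y" if "x \<in> V" "y \<in> V" for x y t
        using B2 that \<open>u \<in> V\<close> .
    qed blast
    then show ?thesis by blast
  qed
  then obtain A where A: "\<And>u. u \<in> V \<Longrightarrow> A u \<in> V" "\<And>u v. u \<in> V \<Longrightarrow> v \<in> V \<Longrightarrow> B u v = G (A u) v"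
    by metis
  obtain f where f: "f \<in> V" "\<And>v. v \<in> V \<Longrightarrow> F v = G f v"
  proof (rule riesz_representation[of F "2 * \<bar>KF\<bar>"])
    fix v assume v: "v \<in> V"
    show "\<bar>F v\<bar> \<le> 2 * \<bar>KF\<bar> * sqrt (G v v)"
    proof (rule functional_bound[OF F])
      fix v assume v: "v \<in> V" "G v v \<le> 1"
      have "KF * (1 + G v v) \<le> \<bar>KF\<bar> * (1 + 1)"
        using v G_nonneg[of v] by (intro mult_mono add_mono) auto
      then show "\<bar>F v\<bar> \<le> 2 * \<bar>KF\<bar>" using F_bounded[OF v(1)] by simp
    qed (use v in auto)
  qed (auto simp: F)
  have A_upper: "G (A u) (A u) \<le> M\<^sup>2 * G u u" if u: "u \<in> V" for u
  proof -
    define a where "a = sqrt (G (A u) (A u))"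
    have aa: "G (A u) (A u) = a\<^sup>2" "0 \<le> a" using G_nonneg[OF A(1)[OF u]] by (auto simp: a_def)
    have "a\<^sup>2 \<le> M * a * sqrt (G u u)"
      using BM[OF u A(1)[OF u]] A(2)[OF u A(1)[OF u]] aa unfolding a_def[symmetric] by simp
    then have "a \<le> M * sqrt (G u u)" 
      using aa M0 G_nonneg[OF u] by (cases "a = 0") (auto simp: power2_eq_square mult_ac)
    then have "a\<^sup>2 \<le> (M * sqrt (G u u))\<^sup>2" using aa by (intro power_mono)
    then show ?thesis using aa G_nonneg[OF u] by (simp add: power_mult_distrib)
  qed
  have A_lower: "\<alpha>\<^sup>2 * G u u \<le> G (A u) (A u)" if u: "u \<in> V" for u
  proof -
    define a where "a = sqrt (G (A u) (A u))"
    define b where "b = sqrt (G u u)"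
    have aa: "G (A u) (A u) = a\<^sup>2" "0 \<le> a" using G_nonneg[OF A(1)[OF u]] by (auto simp: a_def)
    have bb: "G u u = b\<^sup>2" "0 \<le> b" using G_nonneg[OF u] by (auto simp: b_def)
    have "\<alpha> * b\<^sup>2 \<le> a * b"
      using coercive(2)[OF u] A(2)[OF u u] Cauchy_Schwarz_G[OF A(1)[OF u] u] bb(1)
      unfolding a_def[symmetric] b_def[symmetric] by simp
    then have "\<alpha> * b \<le> a" using aa bb by (cases "b = 0") (auto simp: power2_eq_square)
    then have "(\<alpha> * b)\<^sup>2 \<le> a\<^sup>2" using bb coercive(1) by (intro power_mono) auto
    then show ?thesis using aa bb by (simp add: power_mult_distrib)
  qed
  interpret normal: semi_hilbert V comb "\<lambda>u v. G (A u) (A v)"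
  proof
    fix X :: "nat \<Rightarrow> 'v"
    assume X: "\<And>n. X n \<in> V" and cauchy: "\<And>e. 0 < e \<Longrightarrow>
      \<exists>N. \<forall>m\<ge>N. \<forall>n\<ge>N. G (A (comb (X m) (-1) (X n))) (A (comb (X m) (-1) (X n))) < e"
    have "\<exists>l\<in>V. (\<lambda>n. G (comb (X n) (-1) l) (comb (X n) (-1) l)) \<longlonglongrightarrow> 0"
    proof (rule complete[OF X])
      fix e :: real assume "0 < e"
      then obtain N where N: "\<And>m n. N \<le> m \<Longrightarrow> N \<le> n \<Longrightarrow>
          G (A (comb (X m) (-1) (X n))) (A (comb (X m) (-1) (X n))) < \<alpha>\<^sup>2 * e"
        using cauchy[of "\<alpha>\<^sup>2 * e"] coercive(1) by auto
      have "G (comb (X m) (-1) (X n)) (comb (X m) (-1) (X n)) < e" if "N \<le> m" "N \<le> n" for m n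
        using le_less_trans[OF A_lower[OF comb_closed[OF X X]] N[OF that]] coercive(1) by simp
      then show "\<exists>N. \<forall>m\<ge>N. \<forall>n\<ge>N. G (comb (X m) (-1) (X n)) (comb (X m) (-1) (X n)) < e" by blast
    qed
    then obtain l where l: "l \<in> V" and lim: "(\<lambda>n. G (comb (X n) (-1) l) (comb (X n) (-1) l)) \<longlonglongrightarrow> 0" by blast
    have "(\<lambda>n. G (A (comb (X n) (-1) l)) (A (comb (X n) (-1) l))) \<longlonglongrightarrow> 0"
    proof (rule real_tendsto_sandwich[OF always_eventually always_eventually tendsto_const])
      show "(\<lambda>n. M\<^sup>2 * G (comb (X n) (-1) l) (comb (X n) (-1) l)) \<longlonglongrightarrow> 0"
        using tendsto_mult_left[OF lim, of "M\<^sup>2"] by simp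
    qed (use A_upper[OF comb_closed[OF X l]] G_nonneg[OF A(1)[OF comb_closed[OF X l]]] in auto)
    with l show "\<exists>l\<in>V. (\<lambda>n. G (A (comb (X n) (-1) l)) (A (comb (X n) (-1) l))) \<longlonglongrightarrow> 0" by blast
  next
    fix u v w t assume "u \<in> V" "v \<in> V" "w \<in> V"
    then show "G (A (comb u t v)) (A w) = G (A u) (A w) + t * G (A v) (A w)"
      using A B1 comb_closed by (metis (no_types, opaque_lifting))
  qed (use nonempty comb_closed G_sym G_nonneg A(1) in auto)
  obtain u where u: "u \<in> V" "\<And>v. v \<in> V \<Longrightarrow> G f (A v) = G (A u) (A v)"
  proof (rule normal.riesz_representation[of "\<lambda>v. G f (A v)" "sqrt (G f f)"])
    fix u v t assume uv: "u \<in> V" "v \<in> V"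
    show "G f (A (comb u t v)) = G f (A u) + t * G f (A v)"
      using uv f(1) A B1[OF uv f(1)] G_sym comb_closed by metis
  next
    fix v assume "v \<in> V"
    then show "\<bar>G f (A v)\<bar> \<le> sqrt (G f f) * sqrt (G (A v) (A v))"
      using Cauchy_Schwarz_G f A(1) by blast
  qed blast
  define z where "z = comb (A u) (-1) f"
  have z: "z \<in> V" using A(1) u f comb_closed by (simp add: z_def)
  have "B z z = G z (A z)" using A[OF z] z by (simp add: G_sym)
  also have "\<dots> = 0" using u A(1) z f(1) by (simp add: z_def[symmetric] G_comb[of "A u" f "A z" "-1", folded z_def])
  finally have "G z z \<le> 0" using coercive(2)[OF z] coercive(1) by (simp add: mult_le_0_iff)
  then have zz: "G z z = 0" using G_nonneg[OF z] by simp
  have "B u v = F v" if v: "v \<in> V" for v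
  proof -
    have "G z v = 0" using Cauchy_Schwarz_G[OF z v] zz by simp
    then show ?thesis using A u f v G_comb[of "A u" f v "-1"] by (simp add: z_def)
  qed
  with u(1) show ?thesis using that by blast
qed

end

text \<open>The complex lemma follows from the real one for the real parts of \<open>\<beta> b\<close> and \<open>\<beta> l\<close>. Replacing \<open>v\<close>
by \<open>i v\<close>, which is \<open>comb v (i - 1) v\<close>, turns real parts into imaginary parts.\<close>

theorem lax_milgram:
  fixes V :: "'v set" and comb :: "'v \<Rightarrow> complex \<Rightarrow> 'v \<Rightarrow> 'v" and G :: "'v \<Rightarrow> 'v \<Rightarrow> real"
    and b :: "'v \<Rightarrow> 'v \<Rightarrow> complex" and l :: "'v \<Rightarrow> complex"
  assumes V: "semi_hilbert V (\<lambda>u t. comb u (of_real t)) G"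
    and closed: "\<And>u v t. u \<in> V \<Longrightarrow> v \<in> V \<Longrightarrow> comb u t v \<in> V"
    and b1: "\<And>u v w t. u \<in> V \<Longrightarrow> v \<in> V \<Longrightarrow> w \<in> V \<Longrightarrow> b (comb u t v) w = b u w + t * b v w"
    and b2: "\<And>u v w t. u \<in> V \<Longrightarrow> v \<in> V \<Longrightarrow> w \<in> V \<Longrightarrow> b w (comb u t v) = b w u + cnj t * b w v"
    and bounded: "\<And>u v. u \<in> V \<Longrightarrow> v \<in> V \<Longrightarrow> norm (b u v) \<le> K * (G u u + G v v)"
    and coercive: "0 < \<alpha>" "\<And>v. v \<in> V \<Longrightarrow> \<alpha> * G v v \<le> Re (\<beta> * b v v)"
    and l: "\<And>u v t. u \<in> V \<Longrightarrow> v \<in> V \<Longrightarrow> l (comb u t v) = l u + cnj t * l v"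
    and l_bounded: "\<And>v. v \<in> V \<Longrightarrow> norm (l v) \<le> Kl * (1 + G v v)"
    and \<beta>: "\<beta> \<noteq> 0"
  obtains u where "u \<in> V" "\<And>v. v \<in> V \<Longrightarrow> b u v = l v"
proof -
  interpret semi_hilbert V "\<lambda>u t. comb u (of_real t)" G by (rule V)
  obtain u where u: "u \<in> V" "\<And>v. v \<in> V \<Longrightarrow> Re (\<beta> * b u v) = Re (\<beta> * l v)"
  proof (rule lax_milgram_real[of "\<lambda>u v. Re (\<beta> * b u v)" "norm \<beta> * K" \<alpha> "\<lambda>v. Re (\<beta> * l v)" "norm \<beta> * Kl"])
    fix u v assume "u \<in> V" "v \<in> V"
    then have "norm (\<beta> * b u v) \<le> norm \<beta> * (K * (G u u + G v v))"
      unfolding norm_mult using bounded by (intro mult_left_mono) auto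
    then show "\<bar>Re (\<beta> * b u v)\<bar> \<le> norm \<beta> * K * (G u u + G v v)"
      using abs_Re_le_cmod[of "\<beta> * b u v"] by (simp add: mult.assoc)
  next
    fix v assume "v \<in> V"
    then have "norm (\<beta> * l v) \<le> norm \<beta> * (Kl * (1 + G v v))"
      unfolding norm_mult using l_bounded by (intro mult_left_mono) auto
    then show "\<bar>Re (\<beta> * l v)\<bar> \<le> norm \<beta> * Kl * (1 + G v v)"
      using abs_Re_le_cmod[of "\<beta> * l v"] by (simp add: mult.assoc)
  qed (use coercive in \<open>auto simp: b1 b2 l algebra_simps\<close>)
  have "b u v = l v" if v: "v \<in> V" for v
  proof -
    define w where "w = comb v (\<i> - 1) v"
    have w: "w \<in> V" using v by (simp add: w_def closed)
    have "b u w = - \<i> * b u v" "l w = - \<i> * l v"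
      unfolding w_def using u v by (simp_all add: b2 l algebra_simps)
    then have "Im (\<beta> * b u v) = Im (\<beta> * l v)"
      using u(2)[OF w] by (simp add: algebra_simps)
    then have "\<beta> * b u v = \<beta> * l v" using u(2)[OF v] by (intro complex_eqI)
    then show ?thesis using \<beta> by simp
  qed
  with u(1) show ?thesis using that by blast
qed

section \<open>Smooth test functions\<close>

text \<open>The calculus of \<open>Ck_on\<close> is developed on the whole space, where the recursion passes from a
function to its partial derivatives as an equality of functions.\<close>

lemma Ck_on_Suc_imp: "Ck_on (Suc k) f UNIV \<Longrightarrow> Ck_on k f UNIV"
proof (induction k arbitrary: f)
  case 0
  then show ?case
    by (auto simp: continuous_on_eq_continuous_at intro: differentiable_imp_continuous_within)
next
  case (Suc k)
  then show ?case by simp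
qed

lemma Ck_on_const: "Ck_on k (\<lambda>x. c) UNIV"
  by (induction k arbitrary: c) (auto simp: frechet_derivative_const)

lemma Ck_on_add: "Ck_on k f UNIV \<Longrightarrow> Ck_on k g UNIV \<Longrightarrow> Ck_on k (\<lambda>x. f x + g x) UNIV"
proof (induction k arbitrary: f g)
  case 0
  then show ?case by (auto intro: continuous_intros)
next
  case (Suc k)
  then have fg: "f differentiable (at x)" "g differentiable (at x)" for x by auto
  have d: "((\<lambda>x. f x + g x) has_derivative (\<lambda>h. frechet_derivative f (at x) h + frechet_derivative g (at x) h)) (at x)" for x
    using fg by (intro has_derivative_add) (simp_all add: frechet_derivative_works[symmetric])
  have "frechet_derivative (\<lambda>x. f x + g x) (at x) b = frechet_derivative f (at x) b + frechet_derivative g (at x) b" for x b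
    by (simp add: frechet_derivative_at[OF d, symmetric])
  then show ?case using Suc fg by (auto intro!: differentiable_add)
qed

lemma Ck_on_bounded_linear:
  assumes A: "bounded_linear A"
  shows "Ck_on k f UNIV \<Longrightarrow> Ck_on k (\<lambda>x. A (f x)) UNIV"
proof (induction k arbitrary: f)
  case 0
  then show ?case by (auto intro!: bounded_linear.continuous_on[OF A])
next
  case (Suc k)
  then have f: "(f has_derivative frechet_derivative f (at x)) (at x)" for x
    by (simp add: frechet_derivative_works[symmetric])
  note d = bounded_linear.has_derivative[OF A f]
  have "frechet_derivative (\<lambda>x. A (f x)) (at x) b = A (frechet_derivative f (at x) b)" for x b
    by (simp add: frechet_derivative_at[OF d, symmetric])
  moreover have "(\<lambda>x. A (f x)) differentiable (at x)" for x using d[of x] by (auto simp: differentiable_def)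
  ultimately show ?case using Suc by simp
qed

lemma Ck_on_scaleR:
  fixes f :: "'a::euclidean_space \<Rightarrow> real" and g :: "'a \<Rightarrow> 'b::real_normed_vector"
  shows "Ck_on k f UNIV \<Longrightarrow> Ck_on k g UNIV \<Longrightarrow> Ck_on k (\<lambda>x. f x *\<^sub>R g x) UNIV"
proof (induction k arbitrary: f g)
  case 0
  then show ?case by (auto intro: continuous_intros)
next
  case (Suc k)
  have fg: "(f has_derivative frechet_derivative f (at x)) (at x)"
      "(g has_derivative frechet_derivative g (at x)) (at x)" for x
    using Suc.prems by (auto simp: frechet_derivative_works[symmetric])
  note d = has_derivative_scaleR[OF fg]
  have "frechet_derivative (\<lambda>x. f x *\<^sub>R g x) (at x) b
      = f x *\<^sub>R frechet_derivative g (at x) b + frechet_derivative f (at x) b *\<^sub>R g x" for x b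
    by (simp add: frechet_derivative_at[OF d, symmetric])
  moreover have "(\<lambda>x. f x *\<^sub>R g x) differentiable (at x)" for x using d[of x] by (auto simp: differentiable_def)
  ultimately show ?case 
    using Suc Ck_on_Suc_imp[OF Suc.prems(1)] Ck_on_Suc_imp[OF Suc.prems(2)]
    by (auto intro!: Ck_on_add)
qed

lemma Ck_on_prod:
  fixes f :: "'i \<Rightarrow> 'a::euclidean_space \<Rightarrow> real"
  assumes "finite I" "\<And>i. i \<in> I \<Longrightarrow> Ck_on k (f i) UNIV"
  shows "Ck_on k (\<lambda>x. \<Prod>i\<in>I. f i x) UNIV"
  using assms
proof (induction I)
  case (insert i I)
  then show ?case using Ck_on_scaleR[of k "f i" "\<lambda>x. \<Prod>i\<in>I. f i x"] by simp
qed (simp add: Ck_on_const)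

text \<open>The functions \<open>t \<mapsto> t\<^sup>-\<^sup>m exp (- 1 / t)\<close>, extended by zero to \<open>t \<le> 0\<close>. The parameter \<open>m\<close> makes the
family closed, up to linear combinations, under differentiation, which proves \<open>flat 0\<close> smooth.\<close>

definition flat :: "nat \<Rightarrow> real \<Rightarrow> real" where
  "flat m t = (if 0 < t then inverse t ^ m * exp (- inverse t) else 0)"

lemma flat_tendsto_0: "(flat m \<longlongrightarrow> 0) (at 0)"
proof (rule filterlim_split_at)
  show "(flat m \<longlongrightarrow> 0) (at_left 0)"
  proof (rule tendsto_eventually)
    show "\<forall>\<^sub>F t in at_left 0. flat m t = 0"
      by (auto simp: flat_def eventually_at_filter)
  qed
  have "((\<lambda>t. inverse t ^ m / exp (inverse t)) \<longlongrightarrow> 0) (at_right (0::real))"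
    by (rule filterlim_compose[OF tendsto_power_div_exp_0 filterlim_inverse_at_top_right])
  then show "(flat m \<longlongrightarrow> 0) (at_right 0)"
    by (rule Lim_transform_eventually) (auto simp: flat_def eventually_at_filter exp_minus divide_inverse)
qed

lemma flat_has_derivative:
  "(flat m has_field_derivative flat (m + 2) t - of_nat m * flat (m + 1) t) (at t)"
proof (cases "t = 0")
  case True
  have "(\<lambda>h. (flat m (0 + h) - flat m 0) / h) \<midarrow>0\<rightarrow> 0"
  proof (rule Lim_transform_eventually[OF flat_tendsto_0[of "Suc m"]])
    show "\<forall>\<^sub>F h in at 0. flat (Suc m) h = (flat m (0 + h) - flat m 0) / h"
      by (auto simp: flat_def eventually_at_filter divide_inverse)
  qed
  then show ?thesis using True by (simp add: DERIV_def flat_def)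
next
  case False
  show ?thesis
  proof (cases "0 < t")
    case True
    have "((\<lambda>t. inverse t ^ m * exp (- inverse t)) has_field_derivative
        flat (m + 2) t - of_nat m * flat (m + 1) t) (at t)"
      using True
      by (auto intro!: derivative_eq_intros simp: flat_def power2_eq_square field_simps power_eq_if[of t m])
    then show ?thesis
      by (rule has_field_derivative_transform_within_open[where S="{0<..}"]) (use True in \<open>auto simp: flat_def\<close>)
  next
    case neg: False
    have "((\<lambda>t. 0) has_field_derivative flat (m + 2) t - of_nat m * flat (m + 1) t) (at t)"
      using neg by (simp add: flat_def)
    then show ?thesis
      by (rule has_field_derivative_transform_within_open[where S="{..<0}"])
         (use neg False in \<open>auto simp: flat_def\<close>)
  qed
qed

lemma Ck_on_flat_affine: "Ck_on k (\<lambda>x. flat m (p * (x \<bullet> e) + q)) UNIV"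
proof (induction k arbitrary: m)
  case 0
  have "continuous_on UNIV (flat m)"
    by (rule DERIV_continuous_on[OF has_field_derivative_at_within[OF flat_has_derivative]])
  then show ?case
    unfolding Ck_on.simps by (rule continuous_on_compose2) (auto intro!: continuous_intros)
next
  case (Suc k)
  have d: "((\<lambda>x. flat m (p * (x \<bullet> e) + q)) has_derivative
      (\<lambda>h. (p * (h \<bullet> e)) * (flat (m + 2) (p * (x \<bullet> e) + q) - of_nat m * flat (m + 1) (p * (x \<bullet> e) + q)))) (at x)" for x
  proof (rule DERIV_compose_FDERIV[OF flat_has_derivative])
    show "((\<lambda>x. p * (x \<bullet> e) + q) has_derivative (\<lambda>h. p * (h \<bullet> e))) (at x)"
      by (auto intro!: derivative_eq_intros)
  qed
  have eq: "frechet_derivative (\<lambda>x. flat m (p * (x \<bullet> e) + q)) (at x) b =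
     (p * (b \<bullet> e)) *\<^sub>R flat (m + 2) (p * (x \<bullet> e) + q)
      + (- (p * (b \<bullet> e) * of_nat m)) *\<^sub>R flat (m + 1) (p * (x \<bullet> e) + q)" for x b
    using fun_cong[OF frechet_derivative_at[OF d[of x]], of b] by (simp add: algebra_simps)
  have "(\<lambda>x. flat m (p * (x \<bullet> e) + q)) differentiable (at x)" for x using d[of x] by (auto simp: differentiable_def)
  then show ?case
    unfolding Ck_on.simps eq
    by (intro conjI ballI Ck_on_add Ck_on_bounded_linear[OF bounded_linear_scaleR_right] Suc.IH)
qed

text \<open>For every \<open>n\<close> the function is positive exactly on \<open>box a b\<close>. Since \<open>flat 0\<close> tends to one at
infinity, the scaling by \<open>Suc n\<close> makes the functions converge to the indicator of the box.\<close>

definition bump :: "'a::euclidean_space \<Rightarrow> 'a \<Rightarrow> nat \<Rightarrow> 'a \<Rightarrow> real" where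
  "bump a b n x = (\<Prod>e\<in>Basis. flat 0 (of_nat (Suc n) * (x \<bullet> e - a \<bullet> e)) * flat 0 (of_nat (Suc n) * (b \<bullet> e - x \<bullet> e)))"

lemma smooth_bump: "smooth_on (bump a b n) UNIV"
  unfolding smooth_on_def
proof
  fix k
  show "Ck_on k (bump a b n) UNIV"
    unfolding bump_def
  proof (rule Ck_on_prod)
    fix e :: 'a
    let ?n = "real (Suc n)"
    have "Ck_on k (\<lambda>x. flat 0 (?n * (x \<bullet> e) + - ?n * (a \<bullet> e)) *\<^sub>R flat 0 (- ?n * (x \<bullet> e) + ?n * (b \<bullet> e))) UNIV"
      by (intro Ck_on_scaleR Ck_on_flat_affine)
    then show "Ck_on k (\<lambda>x. flat 0 (?n * (x \<bullet> e - a \<bullet> e)) * flat 0 (?n * (b \<bullet> e - x \<bullet> e))) UNIV"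
      by (simp add: algebra_simps)
  qed simp
qed

lemma flat_0_bounds: "0 \<le> flat 0 t" "flat 0 t \<le> 1" "flat 0 t = 0 \<longleftrightarrow> t \<le> 0"
  by (auto simp: flat_def)

lemma bump_bounds: "0 \<le> bump a b n x" "bump a b n x \<le> 1"
  unfolding bump_def by (auto intro!: prod_nonneg prod_le_1 mult_le_one simp: flat_0_bounds)

lemma bump_nonzero_iff: "bump a b n x \<noteq> 0 \<longleftrightarrow> x \<in> box a b"
  by (auto simp: bump_def flat_0_bounds mem_box not_le zero_less_mult_iff mult_le_0_iff)

lemma bump_tendsto_indicator: "(\<lambda>n. bump a b n x) \<longlonglongrightarrow> indicator (box a b) x"
proof (cases "x \<in> box a b")
  case True
  have "(\<lambda>n. flat 0 (real (Suc n) * s)) \<longlonglongrightarrow> 1" if "0 < s" for s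
  proof -
    have "(\<lambda>n. exp (- (inverse (real (Suc n)) * inverse s))) \<longlonglongrightarrow> exp (- (0 * inverse s))"
      by (intro tendsto_intros LIMSEQ_inverse_real_of_nat)
    then show ?thesis using that by (simp add: flat_def)
  qed
  then have "(\<lambda>n. bump a b n x) \<longlonglongrightarrow> (\<Prod>e\<in>(Basis::'a set). 1 * 1)"
    unfolding bump_def using True by (intro tendsto_prod tendsto_mult) (auto simp: mem_box)
  then show ?thesis using True by simp
next
  case False
  then have "bump a b n x = 0" for n using bump_nonzero_iff by blast
  then show ?thesis using False by simp
qed

definition bump_functions :: "'a::euclidean_space set \<Rightarrow> ('a \<Rightarrow> real) set" where
  "bump_functions W = {\<psi>. smooth_on \<psi> UNIV \<and> compact (closure {x. \<psi> x \<noteq> 0}) \<and> closure {x. \<psi> x \<noteq> 0} \<subseteq> W}"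

lemma bump_in_bump_functions: "cbox a b \<subseteq> W \<Longrightarrow> bump a b n \<in> bump_functions W"
proof -
  assume W: "cbox a b \<subseteq> W"
  have c: "closure {x. bump a b n x \<noteq> 0} \<subseteq> cbox a b"
    by (rule closure_minimal) (auto simp: bump_nonzero_iff intro: subsetD[OF box_subset_cbox])
  have "compact (cbox a b \<inter> closure {x. bump a b n x \<noteq> 0})" by (intro compact_Int_closed) auto
  then show ?thesis using c W by (auto simp: bump_functions_def smooth_bump Int_absorb1)
qed

lemma bump_functions_mult:
  assumes "\<psi> \<in> bump_functions W" "\<eta> \<in> bump_functions UNIV"
  shows "(\<lambda>x. \<psi> x * \<eta> x) \<in> bump_functions W"
proof -
  have c: "closure {x. \<psi> x * \<eta> x \<noteq> 0} \<subseteq> closure {x. \<psi> x \<noteq> 0}" by (rule closure_mono) auto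
  have "compact (closure {x. \<psi> x \<noteq> 0} \<inter> closure {x. \<psi> x * \<eta> x \<noteq> 0})"
    using assms by (intro compact_Int_closed) (auto simp: bump_functions_def)
  then show ?thesis
    using assms c Ck_on_scaleR[of _ \<psi> \<eta>] by (auto simp: bump_functions_def smooth_on_def Int_absorb1)
qed

lemma bump_functions_continuous: "\<psi> \<in> bump_functions W \<Longrightarrow> continuous_on UNIV \<psi>"
  unfolding bump_functions_def smooth_on_def using Ck_on.simps(1) by blast

lemma bump_functions_measurable: "\<psi> \<in> bump_functions W \<Longrightarrow> \<psi> \<in> borel_measurable borel"
  using bump_functions_continuous borel_measurable_continuous_onI by blast

lemma bump_functions_bounded:
  assumes "\<psi> \<in> bump_functions W"
  obtains K where "\<And>x. \<bar>\<psi> x\<bar> \<le> K"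
proof -
  have "compact (\<psi> ` closure {x. \<psi> x \<noteq> 0})"
    by (rule compact_continuous_image[OF continuous_on_subset[OF bump_functions_continuous[OF assms]]])
      (use assms in \<open>auto simp: bump_functions_def\<close>)
  then have "bounded (\<psi> ` closure {x. \<psi> x \<noteq> 0})" by (rule compact_imp_bounded)
  then obtain K where K: "\<forall>y \<in> \<psi> ` closure {x. \<psi> x \<noteq> 0}. norm y \<le> K" unfolding bounded_iff by blast
  have "\<bar>\<psi> x\<bar> \<le> \<bar>K\<bar>" for x
  proof (cases "\<psi> x = 0")
    case False
    then have "x \<in> closure {x. \<psi> x \<noteq> 0}" by (intro subsetD[OF closure_subset]) simp
    then have "norm (\<psi> x) \<le> K" using K by blast
    then show ?thesis by simp
  qed simp
  then show ?thesis using that by blast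
qed

section \<open>The fundamental lemma of the calculus of variations\<close>

lemma integrable_mult_bounded:
  fixes f :: "'a \<Rightarrow> real"
  assumes "integrable M f" "g \<in> borel_measurable M" "\<And>x. \<bar>g x\<bar> \<le> K"
  shows "integrable M (\<lambda>x. f x * g x)"
proof (rule Bochner_Integration.integrable_bound[of M "\<lambda>x. K * norm (f x)"])
  show "AE x in M. norm (f x * g x) \<le> norm (K * norm (f x))"
  proof (rule AE_I2)
    fix x
    have "\<bar>f x\<bar> * \<bar>g x\<bar> \<le> \<bar>f x\<bar> * \<bar>K\<bar>" using assms(3)[of x] by (intro mult_left_mono) auto
    then show "norm (f x * g x) \<le> norm (K * norm (f x))" by (simp add: abs_mult mult.commute)
  qed
qed (use assms in auto)

text \<open>Integrals of \<open>f\<close> over boxes are limits of integrals against bump functions, hence zero. Boxes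
are closed under intersection and generate the Borel sets, so the integral of \<open>f\<close> over every Borel
set is zero.\<close>

lemma AE_zero_if_orthogonal_bumps_UNIV:
  fixes f :: "'a::euclidean_space \<Rightarrow> real"
  assumes sets: "sets M = sets borel" and f: "integrable M f"
    and orth: "\<And>\<psi>. \<psi> \<in> bump_functions UNIV \<Longrightarrow> (LINT x|M. f x * \<psi> x) = 0"
  shows "AE x in M. f x = 0"
proof (rule density_unique_real)
  note [measurable_cong] = sets
  have fm [measurable]: "f \<in> borel_measurable M" using f by auto
  have box: "(LINT x|M. f x * indicator (box a b) x) = 0" for a b
  proof -
    have "(\<lambda>n. LINT x|M. f x * bump a b n x) \<longlonglongrightarrow> (LINT x|M. f x * indicator (box a b) x)"
    proof (rule integral_dominated_convergence[where w="\<lambda>x. norm (f x)"])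
      fix n
      have [measurable]: "bump a b n \<in> borel_measurable borel"
        using bump_in_bump_functions[of a b UNIV n] by (intro bump_functions_measurable) auto
      show "(\<lambda>x. f x * bump a b n x) \<in> borel_measurable M" by measurable
      show "AE x in M. norm (f x * bump a b n x) \<le> norm (f x)"
        by (intro AE_I2) (simp add: abs_mult bump_bounds mult_left_le)
    qed (use f in \<open>auto intro!: tendsto_mult bump_tendsto_indicator AE_I2\<close>)
    moreover have "(LINT x|M. f x * bump a b n x) = 0" for n
      by (intro orth bump_in_bump_functions) auto
    ultimately show ?thesis using LIMSEQ_unique[OF _ tendsto_const] by force
  qed
  have total: "(LINT x|M. f x) = 0"
  proof -
    let ?B = "\<lambda>n::nat. box (- (real n *\<^sub>R One)) (real n *\<^sub>R One) :: 'a set"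
    have "(\<lambda>n. LINT x|M. f x * indicator (?B n) x) \<longlonglongrightarrow> (LINT x|M. f x)"
    proof (rule integral_dominated_convergence[where w="\<lambda>x. norm (f x)"])
      show "AE x in M. (\<lambda>n. f x * indicator (?B n) x) \<longlonglongrightarrow> f x"
      proof (rule AE_I2)
        fix x :: 'a
        obtain N :: nat where N: "norm x < real N" using reals_Archimedean2 by blast
        have "x \<in> ?B n" if "N \<le> n" for n
        proof -
          have "\<bar>x \<bullet> e\<bar> < real n" if "e \<in> Basis" for e
            using Basis_le_norm[OF that, of x] N \<open>N \<le> n\<close> by simp
          then show ?thesis by (force simp: mem_box abs_less_iff)
        qed
        then have "\<forall>\<^sub>F n in sequentially. f x * indicator (?B n) x = f x"
          by (auto simp: eventually_sequentially intro!: exI[of _ N])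
        then show "(\<lambda>n. f x * indicator (?B n) x) \<longlonglongrightarrow> f x" by (rule tendsto_eventually)
      qed
    qed (use f in \<open>auto split: split_indicator\<close>)
    then show ?thesis using box LIMSEQ_unique[OF _ tendsto_const] by force
  qed
  have ind: "integrable M (\<lambda>x. f x * indicator A x)" if "A \<in> sets borel" for A
    using that by (intro integrable_mult_bounded[OF f, where K=1]) (auto split: split_indicator)
  fix A assume "A \<in> sets M"
  then have A: "A \<in> sigma_sets UNIV (range (\<lambda>(a, b). box a b))"
    using sets by (simp add: borel_eq_box)
  have stable: "Int_stable (range (\<lambda>(a, b). box a b :: 'a set))" by (auto simp: Int_stable_def box_Int_box)
  have "range (\<lambda>(a, b). box a b :: 'a set) \<subseteq> Pow UNIV" by auto
  from stable this A have "(LINT x|M. f x * indicator A x) = 0"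
  proof (induction rule: sigma_sets_induct_disjoint)
    case (basic A)
    then show ?case using box by auto
  next
    case empty
    then show ?case by simp
  next
    case (compl A)
    then have A: "A \<in> sets borel" by (simp add: borel_eq_box)
    have "(LINT x|M. f x * indicator (UNIV - A) x) = (LINT x|M. f x - f x * indicator A x)"
      by (rule Bochner_Integration.integral_cong) (auto split: split_indicator)
    also have "\<dots> = 0" using f ind[OF A] compl total by simp
    finally show ?case .
  next
    case (union F)
    then have [measurable]: "\<And>i. F i \<in> sets borel" by (simp add: borel_eq_box subset_eq)
    have "(\<lambda>n. LINT x|M. (\<Sum>i<n. f x * indicator (F i) x)) \<longlonglongrightarrow> (LINT x|M. f x * indicator (\<Union>i. F i) x)"
    proof (rule integral_dominated_convergence[where w="\<lambda>x. norm (f x)"])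
      have s: "(\<Sum>i<n. indicator (F i) x) = (indicator (\<Union>i<n. F i) x :: real)" for n x
        using union(1) by (intro indicator_UN_disjoint[symmetric]) (auto simp: disjoint_family_on_def)
      show "AE x in M. norm (\<Sum>i<n. f x * indicator (F i) x) \<le> norm (f x)" for n
        unfolding sum_distrib_left[symmetric] s by (auto split: split_indicator)
      show "AE x in M. (\<lambda>n. \<Sum>i<n. f x * indicator (F i) x) \<longlonglongrightarrow> f x * indicator (\<Union>i. F i) x"
        unfolding sum_distrib_left[symmetric] s
        by (intro AE_I2 tendsto_mult tendsto_const LIMSEQ_indicator_UN)
    qed (use f in auto)
    moreover have "(LINT x|M. (\<Sum>i<n. f x * indicator (F i) x)) = 0" for n
      by (subst Bochner_Integration.integral_sum) (simp_all add: union ind)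
    ultimately show ?case using LIMSEQ_unique[OF _ tendsto_const] by force
  qed
  then show "(LINT x:A|M. f x) = (LINT x:A|M. 0)"
    by (simp add: set_lebesgue_integral_def mult.commute)
qed (use f in auto)

text \<open>The local version, for the completion of a Borel measure: it serves Lebesgue measure and surface
measure alike. For every bump function \<open>\<psi>\<close> supported in \<open>W\<close> the global version applies to \<open>f \<psi>\<close>,
and countably many boxes on which such functions are positive cover \<open>W\<close>.\<close>

lemma AE_zero_if_orthogonal_bumps:
  fixes f :: "'a::euclidean_space \<Rightarrow> real"
  assumes sets: "sets M = sets borel" and A: "A \<in> sets borel" "A \<subseteq> W" and W: "open W"
    and f: "integrable (restrict_space (completion M) A) f"
    and orth: "\<And>\<psi>. \<psi> \<in> bump_functions W \<Longrightarrow> (LINT x|restrict_space (completion M) A. f x * \<psi> x) = 0"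
  shows "AE x in restrict_space (completion M) A. f x = 0"
proof -
  have sp: "space M = UNIV" using sets_eq_imp_space_eq[OF sets] by simp
  have AM: "A \<in> sets (completion M)" using A sets by auto
  define F where "F x = indicator A x * f x" for x
  have F: "integrable (completion M) F"
    using f integrable_restrict_space[of A "completion M" f] AM sp unfolding F_def by simp
  have orthF: "(LINT x|completion M. F x * \<psi> x) = 0" if "\<psi> \<in> bump_functions W" for \<psi>
    using orth[OF that] integral_restrict_space[of A "completion M" "\<lambda>x. f x * \<psi> x"] AM sp
    by (simp add: F_def mult.assoc)
  obtain F' where F' [measurable]: "F' \<in> borel_measurable M" and FF': "AE x in M. F x = F' x"
    using completion_ex_borel_measurable_real[OF borel_measurable_integrable[OF F]] by blast
  have FF'c: "AE x in completion M. F x = F' x" using FF' by (rule AE_completion)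
  have F'c: "F' \<in> borel_measurable (completion M)" using F' by (rule measurable_completion)
  have F'int: "integrable M F'"
    using integrable_cong_AE[OF borel_measurable_integrable[OF F] F'c FF'c] F integrable_completion[OF F'] by simp
  have orthF': "(LINT x|M. F' x * \<psi> x) = 0" if \<psi>: "\<psi> \<in> bump_functions W" for \<psi>
  proof -
    have m: "\<psi> \<in> borel_measurable M" using bump_functions_measurable[OF \<psi>] sets measurable_cong_sets by blast
    have "(LINT x|M. F' x * \<psi> x) = (LINT x|completion M. F' x * \<psi> x)"
      using m by (intro integral_completion[symmetric]) auto
    also have "\<dots> = (LINT x|completion M. F x * \<psi> x)"
      using F'c F measurable_completion[OF m] FF'c by (intro integral_cong_AE) (auto elim: AE_mp)
    finally show ?thesis using orthF[OF \<psi>] by simp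
  qed
  have local: "AE x in M. F' x * \<psi> x = 0" if \<psi>: "\<psi> \<in> bump_functions W" for \<psi>
  proof (rule AE_zero_if_orthogonal_bumps_UNIV[OF sets])
    obtain K where "\<And>x. \<bar>\<psi> x\<bar> \<le> K" using bump_functions_bounded[OF \<psi>] by blast
    moreover have "\<psi> \<in> borel_measurable M" using bump_functions_measurable[OF \<psi>] sets measurable_cong_sets by blast
    ultimately show "integrable M (\<lambda>x. F' x * \<psi> x)" by (intro integrable_mult_bounded F'int) auto
    fix \<eta> :: "'a \<Rightarrow> real" assume "\<eta> \<in> bump_functions UNIV"
    then show "(LINT x|M. F' x * \<psi> x * \<eta> x) = 0"
      using orthF'[OF bump_functions_mult[OF \<psi>]] by (simp add: mult.assoc)
  qed
  define \<F> where "\<F> = {box a b | a b :: 'a. cbox a b \<subseteq> W}"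
  have "open X" if "X \<in> \<F>" for X using that open_box by (auto simp: \<F>_def)
  from Lindelof[OF this] obtain \<D> where \<D>: "\<D> \<subseteq> \<F>" "countable \<D>" "\<Union>\<D> = \<Union>\<F>" by metis
  have cover: "W \<subseteq> \<Union>\<D>"
  proof
    fix x assume "x \<in> W"
    then obtain a b where "x \<in> box a b" "cbox a b \<subseteq> W"
      using open_contains_cbox[of W] W by metis
    then show "x \<in> \<Union>\<D>" unfolding \<D>(3) \<F>_def by blast
  qed
  have "AE x in M. x \<in> X \<longrightarrow> F' x = 0" if X: "X \<in> \<D>" for X
  proof -
    obtain a b where ab: "X = box a b" "cbox a b \<subseteq> W" using X \<D>(1) by (auto simp: \<F>_def)
    show ?thesis
      using local[OF bump_in_bump_functions[OF ab(2), of 0]] bump_nonzero_iff[of a b 0] ab(1)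
      by (auto elim!: eventually_mono)
  qed
  then have "AE x in M. \<forall>X\<in>\<D>. x \<in> X \<longrightarrow> F' x = 0" by (intro AE_ball_countable' \<D>(2))
  then have "AE x in M. x \<in> A \<longrightarrow> F' x = 0"
    by (rule eventually_mono) (use A(2) cover in blast)
  then have "AE x in completion M. x \<in> A \<longrightarrow> F' x = 0" by (rule AE_completion)
  with FF'c have "AE x in completion M. x \<in> A \<longrightarrow> f x = 0"
    by eventually_elim (auto simp: F_def)
  then show ?thesis
    using AM sp by (subst AE_restrict_space_iff) auto
qed

section \<open>Finiteness of surface measure\<close>

text \<open>The set \<open>A\<close> is parametrised with Lipschitz constant \<open>M\<close> by the values of \<open>a\<close> and \<open>b\<close> in a square.
A grid of \<open>N\<^sup>2\<close> cells of the square cuts \<open>A\<close> into pieces of diameter of order \<open>1 / N\<close>, so the sums of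
squared diameters are bounded independently of \<open>N\<close>.\<close>

lemma hausdorff2_outer_finite:
  fixes a b :: "real^3 \<Rightarrow> real"
  assumes R: "\<And>x. x \<in> A \<Longrightarrow> \<bar>a x\<bar> \<le> R" "\<And>x. x \<in> A \<Longrightarrow> \<bar>b x\<bar> \<le> R"
    and M: "\<And>x y. x \<in> A \<Longrightarrow> y \<in> A \<Longrightarrow> dist x y \<le> M * (\<bar>a x - a y\<bar> + \<bar>b x - b y\<bar>)"
  shows "hausdorff2_outer A < \<infinity>"
proof -
  define r where "r = \<bar>R\<bar> + 1"
  define m where "m = \<bar>M\<bar> + 1"
  have r: "0 < r" "\<And>x. x \<in> A \<Longrightarrow> \<bar>a x\<bar> < r" "\<And>x. x \<in> A \<Longrightarrow> \<bar>b x\<bar> < r"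
    using R by (force simp: r_def)+
  have m: "0 < m" "\<And>x y. x \<in> A \<Longrightarrow> y \<in> A \<Longrightarrow> dist x y \<le> m * (\<bar>a x - a y\<bar> + \<bar>b x - b y\<bar>)"
  proof -
    fix x y assume "x \<in> A" "y \<in> A"
    then show "dist x y \<le> m * (\<bar>a x - a y\<bar> + \<bar>b x - b y\<bar>)"
      by (intro order_trans[OF M[of x y]] mult_right_mono) (auto simp: m_def)
  qed (simp add: m_def)
  define K where "K = pi / 4 * (4 * (4 * m * r)\<^sup>2)"
  have "hausdorff2_pre \<delta> A \<le> ennreal K" if \<delta>: "0 < \<delta>" for \<delta>
  proof -
    obtain N0 :: nat where N0: "4 * m * r / \<delta> < real N0" using reals_Archimedean2 by blast
    define N where "N = Suc N0"
    have N: "0 < real N" "4 * m * r / real N \<le> \<delta>"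
    proof -
      show "0 < real N" by (simp add: N_def)
      have "4 * m * r / \<delta> \<le> real N" using N0 by (simp add: N_def)
      then show "4 * m * r / real N \<le> \<delta>" using \<delta> \<open>0 < real N\<close> by (simp add: field_simps)
    qed
    define h where "h = 2 * r / real N"
    have h: "0 < h" using r N by (simp add: h_def)
    define ix where "ix s = nat \<lfloor>(s + r) / h\<rfloor>" for s
    have ix_less: "ix s < N" if "\<bar>s\<bar> < r" for s
    proof -
      have "(s + r) / h < real N" using that h r N by (simp add: h_def field_simps)
      moreover have "0 \<le> (s + r) / h" using that h by auto
      ultimately show ?thesis unfolding ix_def by linarith
    qed
    have ix_close: "\<bar>s - t\<bar> \<le> h" if "\<bar>s\<bar> < r" "\<bar>t\<bar> < r" "ix s = ix t" for s t
    proof -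
      have "0 \<le> (s + r) / h" "0 \<le> (t + r) / h" using that h by auto
      then have "\<bar>(s + r) / h - (t + r) / h\<bar> \<le> 1" using that(3) unfolding ix_def by linarith
      then have "\<bar>(s - t) / h\<bar> \<le> 1" by (simp add: diff_divide_distrib add_divide_distrib)
      then show ?thesis using h by (simp add: abs_div_pos[symmetric])
    qed
    \<comment> \<open>The cells are numbered in one sequence; all pieces from the index \<open>N * N\<close> on are empty.\<close>
    define C where "C k = {x \<in> A. k = ix (a x) * N + ix (b x)}" for k
    have lt: "ix (a x) * N + ix (b x) < N * N" if "x \<in> A" for x
    proof -
      have "ix (a x) < N" "ix (b x) < N" using that r ix_less by auto
      then have "ix (a x) * N + ix (b x) < ix (a x) * N + N" by simp
      also have "\<dots> = Suc (ix (a x)) * N" by simp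
      also have "\<dots> \<le> N * N" using \<open>ix (a x) < N\<close> by (intro mult_le_mono1) simp
      finally show ?thesis .
    qed
    have close: "dist x y \<le> 4 * m * r / real N" if "x \<in> C k" "y \<in> C k" for x y k
    proof -
      have xy: "x \<in> A" "y \<in> A" and e: "ix (a x) * N + ix (b x) = ix (a y) * N + ix (b y)"
        using that by (auto simp: C_def)
      have b: "ix (b x) < N" "ix (b y) < N" using xy r ix_less by auto
      have "ix (a x) = (ix (a x) * N + ix (b x)) div N" using b by simp
      also have "\<dots> = ix (a y)" unfolding e using b by simp
      finally have ea: "ix (a x) = ix (a y)" .
      then have eb: "ix (b x) = ix (b y)" using e by simp
      have "m * (\<bar>a x - a y\<bar> + \<bar>b x - b y\<bar>) \<le> m * (h + h)"
        using xy r ea eb m by (intro mult_left_mono add_mono ix_close) auto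
      then show ?thesis using m(2)[OF xy] by (simp add: h_def field_simps)
    qed
    have diam: "diameter (C k) \<le> 4 * m * r / real N" for k
      using close m r N by (intro diameter_le) (auto simp: dist_norm)
    have bdd: "bounded (C k)" for k
      using close unfolding bounded_def by (cases "C k = {}") blast+
    have empty: "C k = {}" if "N * N \<le> k" for k using lt that by (force simp: C_def)
    have "hausdorff2_pre \<delta> A \<le> (\<Sum>k. ennreal (pi / 4 * (diameter (C k))\<^sup>2))"
      unfolding hausdorff2_pre_def
      using order_trans[OF diam N(2)] bdd by (intro INF_lower) (auto simp: C_def)
    also have "\<dots> = (\<Sum>k<N * N. ennreal (pi / 4 * (diameter (C k))\<^sup>2))"
      using empty by (intro suminf_finite) (auto simp: not_less)
    also have "\<dots> \<le> (\<Sum>k<N * N. ennreal (pi / 4 * (4 * m * r / real N)\<^sup>2))"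
      using diam diameter_ge_0[OF bdd] by (intro sum_mono ennreal_leI mult_left_mono power_mono) auto
    also have "\<dots> = ennreal (real (N * N) * (pi / 4 * (4 * m * r / real N)\<^sup>2))"
      by (subst sum_ennreal) simp_all
    also have "\<dots> \<le> ennreal K"
      using N r m by (intro ennreal_leI) (simp add: K_def power_divide power2_eq_square field_simps)
    finally show ?thesis .
  qed
  then have "hausdorff2_outer A \<le> ennreal K"
    unfolding hausdorff2_outer_def by (intro SUP_least) auto
  then show ?thesis by (simp add: le_less_trans)
qed

definition surface_base :: "(real^3) measure" where
  "surface_base = measure_of UNIV (sets borel) hausdorff2_outer"

lemma sets_surface_base [measurable_cong]: "sets surface_base = sets borel"
  using sets.sigma_sets_eq[of "borel :: (real^3) measure"] by (simp add: surface_base_def)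

lemma surface_measure_eq: "surface_measure = completion surface_base"
  by (simp add: surface_measure_def surface_base_def)

lemma borel_sets_surface_measure: "A \<in> sets borel \<Longrightarrow> A \<in> sets surface_measure"
  by (simp add: surface_measure_eq sets_surface_base sets_completionI_sets)

text \<open>Only an inequality, since \<open>measure_of\<close> returns the zero measure whenever the set function it is given
is not countably additive.\<close>

lemma emeasure_surface_measure_le:
  assumes "A \<in> sets borel"
  shows "emeasure surface_measure A \<le> hausdorff2_outer A"
proof -
  have "emeasure surface_measure A = emeasure surface_base A"
    using assms by (simp add: surface_measure_eq sets_surface_base)
  then show ?thesis by (simp add: surface_base_def emeasure_measure_of_conv)
qed

lemma proj12_components: "proj12 x $ 1 = x $ 1" "proj12 x $ 2 = x $ 2"
  by (simp_all add: proj12_def)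

lemma bounded_linear_proj12: "bounded_linear proj12"
  by (simp add: linear_conv_bounded_linear[symmetric] linear_iff proj12_def vec_eq_iff forall_2)

lemma continuous_on_proj12 [continuous_intros]: "continuous_on A f \<Longrightarrow> continuous_on A (\<lambda>x. proj12 (f x))"
  by (rule bounded_linear.continuous_on[OF bounded_linear_proj12])

lemma borel_measurable_proj12 [measurable]: "proj12 \<in> borel_measurable borel"
  by (intro borel_measurable_continuous_onI continuous_intros)

lemma borel_measurable_vec_nth [measurable]: "(\<lambda>x :: real^3. x $ i) \<in> borel_measurable borel"
  by (intro borel_measurable_continuous_onI continuous_intros)

lemma norm_le_components: "norm (x :: real^3) \<le> \<bar>x$1\<bar> + \<bar>x$2\<bar> + \<bar>x$3\<bar>"
  using norm_le_l1_cart[of x] by (simp add: sum_3)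

text \<open>A horizontal set is parametrised by its first two coordinates.\<close>

lemma finite_surface_layer:
  assumes "bounded S" "A \<in> sets borel" "A \<subseteq> {x. proj12 x \<in> S \<and> x $ 3 = t}"
  shows "emeasure surface_measure A < \<infinity>"
proof -
  obtain R where R: "\<And>y. y \<in> S \<Longrightarrow> norm y \<le> R" using assms(1) by (auto simp: bounded_iff)
  have "hausdorff2_outer A < \<infinity>"
  proof (rule hausdorff2_outer_finite)
    fix x assume "x \<in> A"
    then have "norm (proj12 x) \<le> R" using R assms(3) by blast
    then show "\<bar>x $ 1\<bar> \<le> R" "\<bar>x $ 2\<bar> \<le> R"
      using component_le_norm_cart[of "proj12 x" 1] component_le_norm_cart[of "proj12 x" 2]
      by (simp_all add: proj12_components)
  next
    fix x y assume "x \<in> A" "y \<in> A"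
    then have "x $ 3 = y $ 3" using assms(3) by auto
    then show "dist x y \<le> 1 * (\<bar>x $ 1 - y $ 1\<bar> + \<bar>x $ 2 - y $ 2\<bar>)"
      using norm_le_components[of "x - y"] by (simp add: dist_norm)
  qed
  then show ?thesis using emeasure_surface_measure_le[OF assms(2)] by (simp add: le_less_trans)
qed

lemma layer_borel: "open S \<Longrightarrow> layer S d k \<in> sets borel"
proof -
  assume "open S"
  then have [measurable]: "S \<in> sets borel" by simp
  show ?thesis unfolding layer_def by measurable
qed

lemma finite_layer_index: "0 < d \<Longrightarrow> finite (layer_index L d)"
proof -
  assume d: "0 < d"
  have "layer_index L d \<subseteq> {- \<lceil>L / d\<rceil> .. \<lceil>L / d\<rceil>}"
  proof
    fix k assume "k \<in> layer_index L d"
    then have "of_int k < L / d" "- (L / d) < of_int k" using d by (auto simp: layer_index_def field_simps)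
    then show "k \<in> {- \<lceil>L / d\<rceil> .. \<lceil>L / d\<rceil>}" by (auto simp: le_ceiling_iff) linarith+
  qed
  then show ?thesis by (rule finite_subset) simp
qed

lemma layers_borel: "open S \<Longrightarrow> layers S L d \<in> sets borel"
  unfolding layers_def by (intro sets.countable_UN'' layer_borel) auto

lemma finite_surface_UN:
  assumes "finite I" "\<And>i. i \<in> I \<Longrightarrow> A i \<in> sets borel" "\<And>i. i \<in> I \<Longrightarrow> emeasure surface_measure (A i) < \<infinity>"
  shows "emeasure surface_measure (\<Union>i\<in>I. A i) < \<infinity>"
proof -
  have "emeasure surface_measure (\<Union>i\<in>I. A i) \<le> (\<Sum>i\<in>I. emeasure surface_measure (A i))"
    using assms borel_sets_surface_measure by (intro emeasure_subadditive_finite) auto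
  also have "\<dots> < \<infinity>" using assms by (simp add: ennreal_sum_less_top) 
  finally show ?thesis .
qed

lemma finite_surface_layers:
  assumes "open S" "bounded S" "0 < d"
  shows "emeasure surface_measure (layers S L d) < \<infinity>"
  unfolding layers_def
  using assms by (intro finite_surface_UN finite_layer_index layer_borel finite_surface_layer[of S])
    (auto simp: layer_def)

section \<open>Defining functions and the outer normal\<close>

lemma smooth_on_differentiable: "smooth_on \<rho> U \<Longrightarrow> x \<in> U \<Longrightarrow> \<rho> differentiable (at x)"
  unfolding smooth_on_def by (drule spec[of _ "Suc 0"]) simp

lemma smooth_on_continuous_derivative:
  "smooth_on \<rho> U \<Longrightarrow> b \<in> Basis \<Longrightarrow> continuous_on U (\<lambda>x. frechet_derivative \<rho> (at x) b)"
  unfolding smooth_on_def by (drule spec[of _ "Suc 0"]) simp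

lemma continuous_on_grad: "smooth_on \<rho> U \<Longrightarrow> continuous_on U (grad \<rho>)"
  unfolding grad_def[abs_def] by (intro continuous_intros smooth_on_continuous_derivative)

lemma has_derivative_grad:
  assumes "\<rho> differentiable (at x)"
  shows "(\<rho> has_derivative (\<lambda>v. grad \<rho> x \<bullet> v)) (at x)"
proof -
  interpret linear "frechet_derivative \<rho> (at x)" using linear_frechet_derivative[OF assms] .
  have "frechet_derivative \<rho> (at x) v = grad \<rho> x \<bullet> v" for v
  proof -
    have "frechet_derivative \<rho> (at x) (\<Sum>b\<in>Basis. (v \<bullet> b) *\<^sub>R b) = grad \<rho> x \<bullet> v"
      unfolding sum scale grad_def inner_sum_left by (simp add: inner_commute mult.commute)
    then show ?thesis by (simp add: euclidean_representation)
  qed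
  then have "frechet_derivative \<rho> (at x) = (\<lambda>v. grad \<rho> x \<bullet> v)" by auto
  then show ?thesis using assms frechet_derivative_works by metis
qed

text \<open>Near a point with \<open>\<rho> > 0\<close> there are no points of \<open>D\<close>, and points with \<open>\<rho> < 0\<close> lie in \<open>D\<close>, hence in
its interior.\<close>

lemma defining_function_zero:
  assumes D: "open D" and ldf: "local_defining_function D p U \<rho>" and q: "q \<in> frontier D" "q \<in> U"
  shows "\<rho> q = 0"
proof (rule antisym)
  have U: "open U" "D \<inter> U = {x \<in> U. \<rho> x < 0}" and s: "smooth_on \<rho> U"
    using ldf by (auto simp: local_defining_function_def)
  have "q \<notin> D" using q D by (simp add: frontier_def interior_open)
  then show "0 \<le> \<rho> q" using U q by force
  have "isCont \<rho> q" using smooth_on_differentiable[OF s q(2)] differentiable_imp_continuous_within by blast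
  show "\<rho> q \<le> 0"
  proof (rule ccontr)
    assume "\<not> \<rho> q \<le> 0"
    then have "\<forall>\<^sub>F x in nhds q. 0 < \<rho> x"
      using \<open>isCont \<rho> q\<close> order_tendstoD(1)[of \<rho> "\<rho> q" "nhds q" 0] by (simp add: tendsto_at_iff_tendsto_nhds isCont_def)
    moreover have "\<forall>\<^sub>F x in nhds q. x \<in> U" using U q by (simp add: eventually_nhds_in_open)
    ultimately have "\<forall>\<^sub>F x in nhds q. x \<notin> D" by eventually_elim (use U in force)
    then obtain W where "open W" "q \<in> W" "W \<inter> D = {}" unfolding eventually_nhds by blast
    then have "q \<notin> closure D" by (metis Int_emptyI disjoint_iff open_Int_closure_eq_empty)
    then show False using q by (simp add: frontier_def)
  qed
qed

text \<open>If the unit vectors \<open>e\<close> and \<open>f\<close> in the directions of \<open>a\<close> and \<open>b\<close> were different, \<open>v = f - e\<close> would satisfy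
\<open>a \<bullet> v < 0 < b \<bullet> v\<close>.\<close>

lemma normalized_eq_if_half_space:
  fixes a b :: "'a::real_inner"
  assumes ab: "a \<noteq> 0" "b \<noteq> 0" and half: "\<And>v. a \<bullet> v < 0 \<Longrightarrow> b \<bullet> v \<le> 0"
  shows "a /\<^sub>R norm a = b /\<^sub>R norm b"
proof (rule ccontr)
  assume ne: "a /\<^sub>R norm a \<noteq> b /\<^sub>R norm b"
  define e where "e = a /\<^sub>R norm a"
  define f where "f = b /\<^sub>R norm b"
  have ef: "norm e = 1" "norm f = 1" "a = norm a *\<^sub>R e" "b = norm b *\<^sub>R f" using ab by (auto simp: e_def f_def)
  have "0 < (norm (e - f))\<^sup>2" using ne by (simp add: e_def f_def)
  also have "(norm (e - f))\<^sup>2 = 2 - 2 * (e \<bullet> f)"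
    using ef by (simp add: power2_norm_eq_inner inner_diff_left inner_diff_right inner_commute norm_eq_1)
  finally have lt: "e \<bullet> f < 1" by simp
  have "a \<bullet> (f - e) = norm a * (e \<bullet> f - 1)"
    using ef(1) by (subst ef(3)) (simp add: inner_diff_right norm_eq_1 algebra_simps)
  also have "\<dots> < 0" using lt ab by (simp add: mult_less_0_iff)
  finally have "b \<bullet> (f - e) \<le> 0" by (rule half)
  moreover have "b \<bullet> (f - e) = norm b * (1 - e \<bullet> f)"
    using ef(2) by (subst ef(4)) (simp add: inner_diff_right norm_eq_1 inner_commute algebra_simps)
  ultimately show False using lt ab by (simp add: mult_le_0_iff)
qed

text \<open>A direction along which \<open>\<rho>\<close> decreases points into \<open>D\<close>, so \<open>\<rho>'\<close> cannot increase along it. Thus one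
open half-space determined by the first gradient lies in the closed one determined by the second.\<close>

lemma defining_function_normal_unique:
  assumes D: "open D" and p: "p \<in> frontier D"
    and l1: "local_defining_function D p U \<rho>" and l2: "local_defining_function D p U' \<rho>'"
  shows "grad \<rho> p /\<^sub>R norm (grad \<rho> p) = grad \<rho>' p /\<^sub>R norm (grad \<rho>' p)"
proof (rule normalized_eq_if_half_space)
  show "grad \<rho> p \<noteq> 0" "grad \<rho>' p \<noteq> 0" using l1 l2 by (auto simp: local_defining_function_def)
  fix v assume neg: "grad \<rho> p \<bullet> v < 0"
  have line: "((\<lambda>t. p + t *\<^sub>R v) \<longlongrightarrow> p) (at 0)" by (auto intro!: tendsto_eq_intros)
  have der: "((\<lambda>t. r (p + t *\<^sub>R v)) has_field_derivative grad r p \<bullet> v) (at 0)"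
    if "local_defining_function D p W r" for W r
  proof -
    have d: "(r has_derivative (\<lambda>v. grad r p \<bullet> v)) (at (p + 0 *\<^sub>R v))"
      using that by (auto simp: local_defining_function_def intro!: has_derivative_grad smooth_on_differentiable)
    have "((\<lambda>t. p + t *\<^sub>R v) has_derivative (\<lambda>t. t *\<^sub>R v)) (at 0)"
      by (auto intro!: derivative_eq_intros)
    from has_derivative_compose[OF this d] show ?thesis
      by (simp add: has_field_derivative_def mult_commute_abs)
  qed
  have inU: "\<forall>\<^sub>F t in at 0. p + t *\<^sub>R v \<in> W" if "local_defining_function D p W r" for W r
    using that line by (auto simp: local_defining_function_def intro: topological_tendstoD)
  have zero: "r p = 0" if "local_defining_function D p W r" for W r
    using defining_function_zero[OF D that p] that by (auto simp: local_defining_function_def)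
  have "\<forall>\<^sub>F t in at_right 0. \<rho> (p + t *\<^sub>R v) < 0"
  proof -
    obtain e where "0 < e" "\<And>h. 0 < h \<Longrightarrow> h < e \<Longrightarrow> \<rho> (p + (0 + h) *\<^sub>R v) < \<rho> (p + 0 *\<^sub>R v)"
      using DERIV_neg_dec_right[OF der[OF l1] neg] by auto
    then show ?thesis using zero[OF l1] by (auto simp: eventually_at_right_field)
  qed
  moreover have "\<forall>\<^sub>F t in at_right 0. p + t *\<^sub>R v \<in> U" "\<forall>\<^sub>F t in at_right 0. p + t *\<^sub>R v \<in> U'"
    using inU[OF l1] inU[OF l2] by (auto simp: eventually_at_split)
  ultimately have ev: "\<forall>\<^sub>F t in at_right 0. \<rho>' (p + t *\<^sub>R v) < 0"
    by eventually_elim (use l1 l2 in \<open>auto simp: local_defining_function_def\<close>)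
  show "grad \<rho>' p \<bullet> v \<le> 0"
  proof (rule ccontr)
    assume "\<not> grad \<rho>' p \<bullet> v \<le> 0"
    then obtain e where "0 < e" "\<And>h. 0 < h \<Longrightarrow> h < e \<Longrightarrow> \<rho>' (p + 0 *\<^sub>R v) < \<rho>' (p + (0 + h) *\<^sub>R v)"
      using DERIV_pos_inc_right[OF der[OF l2]] by auto
    then have "\<forall>\<^sub>F t in at_right 0. 0 < \<rho>' (p + t *\<^sub>R v)" using zero[OF l2] by (auto simp: eventually_at_right_field)
    with ev have "\<forall>\<^sub>F t in at_right (0::real). False" by eventually_elim simp
    then show False by (simp add: trivial_limit_at_right_real)
  qed
qed

definition smooth_frontier_points :: "'a::euclidean_space set \<Rightarrow> 'a set" where
  "smooth_frontier_points D = {p \<in> frontier D. \<exists>U \<rho>. local_defining_function D p U \<rho>}"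

lemma outer_normal_eq:
  assumes D: "open D" and p: "p \<in> frontier D" and l: "local_defining_function D p U \<rho>"
  shows "outer_normal D p = grad \<rho> p /\<^sub>R norm (grad \<rho> p)"
proof -
  have "(THE n. \<exists>U \<rho>. local_defining_function D p U \<rho> \<and> n = grad \<rho> p /\<^sub>R norm (grad \<rho> p))
     = grad \<rho> p /\<^sub>R norm (grad \<rho> p)"
    using l defining_function_normal_unique[OF D p _ l] by (intro the_equality) blast+
  then show ?thesis using p l unfolding outer_normal_def by auto
qed

lemma outer_normal_outside: "p \<notin> smooth_frontier_points D \<Longrightarrow> outer_normal D p = 0"
  by (auto simp: outer_normal_def smooth_frontier_points_def)

lemma norm_outer_normal_le_1:
  assumes "open D"
  shows "norm (outer_normal D p) \<le> 1"
proof (cases "p \<in> smooth_frontier_points D")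
  case True
  then obtain U \<rho> where "p \<in> frontier D" "local_defining_function D p U \<rho>"
    by (auto simp: smooth_frontier_points_def)
  then show ?thesis using outer_normal_eq[OF assms] by (simp add: divide_simps)
qed (simp add: outer_normal_outside)

lemma defining_function_nearby:
  "local_defining_function D p U \<rho> \<Longrightarrow> q \<in> U \<Longrightarrow> grad \<rho> q \<noteq> 0 \<Longrightarrow> local_defining_function D q U \<rho>"
  by (simp add: local_defining_function_def)

lemma defining_function_regular_nbhd:
  assumes "local_defining_function D p U \<rho>"
  shows "open {x \<in> U. grad \<rho> x \<noteq> 0}" "p \<in> {x \<in> U. grad \<rho> x \<noteq> 0}"
proof -
  have U: "open U" "smooth_on \<rho> U" using assms by (auto simp: local_defining_function_def)
  have "open (U \<inter> grad \<rho> -` (- {0}))"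
    using continuous_open_preimage[OF continuous_on_grad[OF U(2)] U(1) open_Compl[OF closed_singleton, of 0]] .
  moreover have "U \<inter> grad \<rho> -` (- {0}) = {x \<in> U. grad \<rho> x \<noteq> 0}" by auto
  ultimately show "open {x \<in> U. grad \<rho> x \<noteq> 0}" by simp
  show "p \<in> {x \<in> U. grad \<rho> x \<noteq> 0}" using assms by (simp add: local_defining_function_def)
qed

lemma smooth_frontier_points_borel: "smooth_frontier_points D \<in> sets borel"
proof -
  define W where "W = \<Union>{{x \<in> U. grad \<rho> x \<noteq> 0} | U \<rho>. \<exists>p. local_defining_function D p U \<rho>}"
  have "open W" unfolding W_def
  proof (rule open_Union, safe)
    fix U \<rho> p assume "local_defining_function D p U \<rho>"
    then show "open {x \<in> U. grad \<rho> x \<noteq> 0}" by (rule defining_function_regular_nbhd(1))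
  qed
  moreover have "smooth_frontier_points D = frontier D \<inter> W"
  proof (intro equalityI subsetI)
    fix p assume "p \<in> smooth_frontier_points D"
    then obtain U \<rho> where p: "p \<in> frontier D" "local_defining_function D p U \<rho>"
      by (auto simp: smooth_frontier_points_def)
    have "p \<in> W" unfolding W_def
      by (rule UnionI[OF _ defining_function_regular_nbhd(2)[OF p(2)]]) (use p(2) in blast)
    with p(1) show "p \<in> frontier D \<inter> W" by blast
  next
    fix q assume q: "q \<in> frontier D \<inter> W"
    then obtain U \<rho> p where "local_defining_function D p U \<rho>" "q \<in> U" "grad \<rho> q \<noteq> 0"
      by (auto simp: W_def)
    then have "local_defining_function D q U \<rho>" by (rule defining_function_nearby)
    with q show "q \<in> smooth_frontier_points D" by (auto simp: smooth_frontier_points_def)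
  qed
  ultimately show ?thesis by (simp add: borel_open borel_closed)
qed

text \<open>One defining function serves for all boundary points near \<open>p\<close> at which its gradient does not
vanish, so the normal is locally the normalised gradient of a fixed smooth function.\<close>

lemma continuous_on_outer_normal:
  assumes D: "open D"
  shows "continuous_on (smooth_frontier_points D) (outer_normal D)"
  unfolding continuous_on_eq_continuous_within
proof
  fix p assume p: "p \<in> smooth_frontier_points D"
  then obtain U \<rho> where l: "local_defining_function D p U \<rho>" by (auto simp: smooth_frontier_points_def)
  define W where "W = {x \<in> U. grad \<rho> x \<noteq> 0}"
  have W: "open W" "p \<in> W" using defining_function_regular_nbhd[OF l] by (auto simp: W_def)
  then obtain e where e: "0 < e" "ball p e \<subseteq> W" using open_contains_ball by blast
  have "continuous_on W (grad \<rho>)"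
    using l by (intro continuous_on_subset[OF continuous_on_grad[of \<rho> U]]) (auto simp: W_def local_defining_function_def)
  then have "continuous_on W (\<lambda>x. grad \<rho> x /\<^sub>R norm (grad \<rho> x))"
    by (intro continuous_intros) (auto simp: W_def)
  then have "continuous (at p) (\<lambda>x. grad \<rho> x /\<^sub>R norm (grad \<rho> x))"
    using W continuous_on_eq_continuous_at by blast
  then have "continuous (at p within smooth_frontier_points D) (\<lambda>x. grad \<rho> x /\<^sub>R norm (grad \<rho> x))"
    by (rule continuous_at_imp_continuous_at_within)
  then show "continuous (at p within smooth_frontier_points D) (outer_normal D)"
  proof (rule continuous_transform_within[OF _ e(1) p])
    fix q assume q: "q \<in> smooth_frontier_points D" "dist q p < e"
    then have "q \<in> W" using e(2) by (auto simp: dist_commute)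
    then have "local_defining_function D q U \<rho>" using defining_function_nearby[OF l] by (simp add: W_def)
    then show "grad \<rho> q /\<^sub>R norm (grad \<rho> q) = outer_normal D q"
      using outer_normal_eq[OF D] q(1) by (auto simp: smooth_frontier_points_def)
  qed
qed

lemma borel_measurable_outer_normal:
  assumes "open D"
  shows "outer_normal D \<in> borel_measurable borel"
proof -
  have "(\<lambda>x. indicator (smooth_frontier_points D) x *\<^sub>R outer_normal D x) \<in> borel_measurable borel"
    using smooth_frontier_points_borel continuous_on_outer_normal[OF assms]
    by (rule borel_measurable_continuous_on_indicator)
  moreover have "(\<lambda>x. indicator (smooth_frontier_points D) x *\<^sub>R outer_normal D x) = outer_normal D"
    using outer_normal_outside by (auto simp: fun_eq_iff indicator_def)
  ultimately show ?thesis by simp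
qed

section \<open>The boundary of the cylinder\<close>

lemma open_cylinder: "open S \<Longrightarrow> open (cylinder S L)"
proof -
  assume "open S"
  then have "open (proj12 -` S)" by (intro open_vimage continuous_intros)
  then have "open (proj12 -` S \<inter> {x. - L < x $ 3} \<inter> {x. x $ 3 < L})"
    by (intro open_Int open_halfspace_component_lt_cart open_halfspace_component_gt_cart)
  moreover have "proj12 -` S \<inter> {x. - L < x $ 3} \<inter> {x. x $ 3 < L} = cylinder S L"
    by (auto simp: cylinder_def)
  ultimately show ?thesis by simp
qed

lemma frontier_cylinder_subset:
  assumes "open S"
  shows "frontier (cylinder S L) \<subseteq> {x. proj12 x \<in> closure S \<and> x $ 3 = L} \<union> {x. proj12 x \<in> closure S \<and> x $ 3 = - L}
    \<union> {x. proj12 x \<in> frontier S \<and> - L \<le> x $ 3 \<and> x $ 3 \<le> L}"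
proof
  fix x assume x: "x \<in> frontier (cylinder S L)"
  have "closed (proj12 -` closure S)" by (intro closed_vimage continuous_intros) auto
  then have "closed (proj12 -` closure S \<inter> {x. - L \<le> x $ 3} \<inter> {x. x $ 3 \<le> L})"
    by (intro closed_Int closed_halfspace_component_le_cart closed_halfspace_component_ge_cart)
  moreover have "cylinder S L \<subseteq> proj12 -` closure S \<inter> {x. - L \<le> x $ 3} \<inter> {x. x $ 3 \<le> L}"
    using closure_subset by (auto simp: cylinder_def)
  ultimately have "closure (cylinder S L) \<subseteq> proj12 -` closure S \<inter> {x. - L \<le> x $ 3} \<inter> {x. x $ 3 \<le> L}"
    by (rule closure_minimal[rotated])
  then have "proj12 x \<in> closure S" "- L \<le> x $ 3" "x $ 3 \<le> L" using x by (auto simp: frontier_def)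
  moreover have "x \<notin> cylinder S L"
    using x open_cylinder[OF assms] by (simp add: frontier_def interior_open)
  ultimately show "x \<in> {x. proj12 x \<in> closure S \<and> x $ 3 = L} \<union> {x. proj12 x \<in> closure S \<and> x $ 3 = - L}
    \<union> {x. proj12 x \<in> frontier S \<and> - L \<le> x $ 3 \<and> x $ 3 \<le> L}"
    using assms by (auto simp: cylinder_def frontier_def interior_open)
qed

text \<open>A quantitative substitute for the implicit function theorem. If the \<open>i\<close>-th component of the
gradient is bounded away from zero near \<open>p\<close>, the mean value theorem on the segment between two zeros
of \<open>\<rho>\<close> bounds the difference of their \<open>i\<close>-th coordinates by that of the other coordinates.\<close>

lemma frontier_graph_estimate:
  fixes S :: "(real^2) set"
  assumes S: "open S" and p: "p \<in> frontier S" and l: "local_defining_function S p U \<rho>"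
  obtains e K i j where "0 < e" "{i, j} = (UNIV :: 2 set)" "i \<noteq> j" "0 \<le> K"
    "\<And>x y. x \<in> frontier S \<inter> ball p e \<Longrightarrow> y \<in> frontier S \<inter> ball p e \<Longrightarrow> \<bar>x $ i - y $ i\<bar> \<le> K * \<bar>x $ j - y $ j\<bar>"
proof -
  have U: "open U" "p \<in> U" "smooth_on \<rho> U" "grad \<rho> p \<noteq> 0" using l by (auto simp: local_defining_function_def)
  obtain i where i: "grad \<rho> p $ i \<noteq> 0" using U(4) by (auto simp: vec_eq_iff)
  define j :: 2 where "j = (if i = 1 then 2 else 1)"
  have ij: "{i, j} = UNIV" "i \<noteq> j" using exhaust_2[of i] by (auto simp: j_def UNIV_2)
  define m where "m = \<bar>grad \<rho> p $ i\<bar>"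
  have m: "0 < m" using i by (simp add: m_def)
  have "isCont (grad \<rho>) p" using continuous_on_grad[OF U(3)] U continuous_on_eq_continuous_at by blast
  then have "(grad \<rho> \<longlongrightarrow> grad \<rho> p) (nhds p)" by (simp add: isCont_def tendsto_at_iff_tendsto_nhds)
  then have "\<forall>\<^sub>F x in nhds p. dist (grad \<rho> x) (grad \<rho> p) < m / 2" using m by (intro tendstoD) auto
  moreover have "\<forall>\<^sub>F x in nhds p. x \<in> U" using U by (intro eventually_nhds_in_open)
  ultimately have "\<forall>\<^sub>F x in nhds p. x \<in> U \<and> dist (grad \<rho> x) (grad \<rho> p) < m / 2" by eventually_elim simp
  then obtain e where e: "0 < e" "\<And>x. dist x p < e \<Longrightarrow> x \<in> U \<and> dist (grad \<rho> x) (grad \<rho> p) < m / 2"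
    unfolding eventually_nhds_metric by blast
  define K where "K = (norm (grad \<rho> p) + m) / (m / 2)"
  have K: "0 \<le> K" using m by (simp add: K_def)
  have est: "\<bar>x $ i - y $ i\<bar> \<le> K * \<bar>x $ j - y $ j\<bar>"
    if x: "x \<in> frontier S \<inter> ball p e" and y: "y \<in> frontier S \<inter> ball p e" for x y
  proof -
    have seg: "closed_segment x y \<subseteq> ball p e" using x y by (intro closed_segment_subset) auto
    have zero: "\<rho> x = 0" "\<rho> y = 0"
      using defining_function_zero[OF S l] x y e(2) by (auto simp: dist_commute)
    have mem: "x + t *\<^sub>R (y - x) \<in> closed_segment x y" if "0 \<le> t" "t \<le> 1" for t
      using that by (auto simp: closed_segment_def algebra_simps intro!: exI[of _ t])
    have d: "((\<lambda>t. \<rho> (x + t *\<^sub>R (y - x))) has_field_derivative grad \<rho> (x + t *\<^sub>R (y - x)) \<bullet> (y - x)) (at t)"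
      if "0 \<le> t" "t \<le> 1" for t
    proof -
      have "x + t *\<^sub>R (y - x) \<in> U" using mem[OF that] seg e(2) by (auto simp: dist_commute)
      note has_derivative_grad[OF smooth_on_differentiable[OF U(3) this]]
      moreover have "((\<lambda>t. x + t *\<^sub>R (y - x)) has_derivative (\<lambda>t. t *\<^sub>R (y - x))) (at t)"
        by (auto intro!: derivative_eq_intros)
      ultimately show ?thesis
        using has_derivative_compose[of "\<lambda>t. x + t *\<^sub>R (y - x)"]
        by (force simp: has_field_derivative_def mult_commute_abs)
    qed
    obtain t where t: "0 < t" "t < 1" 
      "\<rho> (x + 1 *\<^sub>R (y - x)) - \<rho> (x + 0 *\<^sub>R (y - x)) = (1 - 0) * (grad \<rho> (x + t *\<^sub>R (y - x)) \<bullet> (y - x))"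
      using MVT2[of 0 1 "\<lambda>t. \<rho> (x + t *\<^sub>R (y - x))", OF _ d] by auto
    define g where "g = grad \<rho> (x + t *\<^sub>R (y - x))"
    have "g \<bullet> (y - x) = 0" using t(3) zero by (simp add: g_def)
    moreover have "g \<bullet> (y - x) = g $ i * (y $ i - x $ i) + g $ j * (y $ j - x $ j)"
      using ij(2) unfolding inner_vec_def ij(1)[symmetric] by simp
    ultimately have "g $ i * (y $ i - x $ i) = - (g $ j * (y $ j - x $ j))" by linarith
    then have eq: "\<bar>g $ i\<bar> * \<bar>x $ i - y $ i\<bar> = \<bar>g $ j\<bar> * \<bar>x $ j - y $ j\<bar>"
      by (metis abs_minus_cancel abs_minus_commute abs_mult)
    have "dist g (grad \<rho> p) < m / 2"
      using e(2) mem[of t] seg t by (force simp: g_def dist_commute)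
    then have close: "norm (g - grad \<rho> p) < m / 2" by (simp add: dist_norm)
    then have "\<bar>g $ i - grad \<rho> p $ i\<bar> < m / 2"
      using component_le_norm_cart[of "g - grad \<rho> p" i] by simp
    then have gi: "m / 2 \<le> \<bar>g $ i\<bar>" unfolding m_def by linarith
    have gj: "\<bar>g $ j\<bar> \<le> norm (grad \<rho> p) + m"
      using component_le_norm_cart[of g j] norm_triangle_sub[of g "grad \<rho> p"] close m by linarith
    have "m / 2 * \<bar>x $ i - y $ i\<bar> \<le> \<bar>g $ i\<bar> * \<bar>x $ i - y $ i\<bar>" using gi by (intro mult_right_mono) auto
    also have "\<dots> \<le> (norm (grad \<rho> p) + m) * \<bar>x $ j - y $ j\<bar>" unfolding eq using gj by (intro mult_right_mono) auto
    finally show ?thesis using m by (simp add: K_def field_simps)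
  qed
  show ?thesis using that[OF e(1) ij K] est by blast
qed

text \<open>Near \<open>p\<close> the wall is parametrised by the coordinate \<open>j\<close> along the curve and by the height.\<close>

lemma finite_surface_wall_local:
  fixes S :: "(real^2) set"
  assumes S: "open S" and p: "p \<in> frontier S" and l: "local_defining_function S p U \<rho>"
  obtains e where "0 < e"
    "emeasure surface_measure {x. proj12 x \<in> frontier S \<inter> ball p e \<and> - L \<le> x $ 3 \<and> x $ 3 \<le> L} < \<infinity>"
proof -
  obtain e K i j where e: "0 < e" "{i, j} = (UNIV :: 2 set)" "i \<noteq> j" "0 \<le> K" and est:
    "\<And>x y. x \<in> frontier S \<inter> ball p e \<Longrightarrow> y \<in> frontier S \<inter> ball p e \<Longrightarrow> \<bar>x $ i - y $ i\<bar> \<le> K * \<bar>x $ j - y $ j\<bar>"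
    using frontier_graph_estimate[OF S p l] by metis
  let ?A = "{x. proj12 x \<in> frontier S \<inter> ball p e \<and> - L \<le> x $ 3 \<and> x $ 3 \<le> L}"
  have borel: "?A \<in> sets borel"
  proof -
    have [measurable]: "frontier S \<inter> ball p e \<in> sets borel" by (simp add: borel_open borel_closed)
    show ?thesis by measurable
  qed
  have "hausdorff2_outer ?A < \<infinity>"
  proof (rule hausdorff2_outer_finite)
    fix x assume x: "x \<in> ?A"
    have "\<bar>proj12 x $ j\<bar> \<le> norm p + e"
      using component_le_norm_cart[of "proj12 x" j] norm_triangle_sub[of "proj12 x" p] x
      by (auto simp: dist_norm norm_minus_commute)
    then show "\<bar>proj12 x $ j\<bar> \<le> norm p + e + \<bar>L\<bar>" "\<bar>x $ 3\<bar> \<le> norm p + e + \<bar>L\<bar>"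
      using x e(1) norm_ge_zero[of p] by auto
  next
    fix x y assume xy: "x \<in> ?A" "y \<in> ?A"
    have "dist x y \<le> \<bar>proj12 x $ 1 - proj12 y $ 1\<bar> + \<bar>proj12 x $ 2 - proj12 y $ 2\<bar> + \<bar>x $ 3 - y $ 3\<bar>"
      using norm_le_components[of "x - y"] by (simp add: dist_norm proj12_components)
    also have "\<bar>proj12 x $ 1 - proj12 y $ 1\<bar> + \<bar>proj12 x $ 2 - proj12 y $ 2\<bar>
        = \<bar>proj12 x $ i - proj12 y $ i\<bar> + \<bar>proj12 x $ j - proj12 y $ j\<bar>"
      using exhaust_2[of i] exhaust_2[of j] e(3) by auto
    also have "\<bar>proj12 x $ i - proj12 y $ i\<bar> \<le> K * \<bar>proj12 x $ j - proj12 y $ j\<bar>" using xy by (intro est) auto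
    finally have "dist x y \<le> (K + 1) * \<bar>proj12 x $ j - proj12 y $ j\<bar> + 1 * \<bar>x $ 3 - y $ 3\<bar>"
      by (simp add: algebra_simps)
    also have "1 * \<bar>x $ 3 - y $ 3\<bar> \<le> (K + 1) * \<bar>x $ 3 - y $ 3\<bar>" using e(4) by (intro mult_right_mono) auto
    finally show "dist x y \<le> (K + 1) * (\<bar>proj12 x $ j - proj12 y $ j\<bar> + \<bar>x $ 3 - y $ 3\<bar>)"
      by (simp add: algebra_simps)
  qed
  then have "emeasure surface_measure ?A < \<infinity>"
    using emeasure_surface_measure_le[OF borel] by (simp add: le_less_trans)
  then show ?thesis using that e(1) by blast
qed

lemma finite_surface_wall:
  fixes S :: "(real^2) set"
  assumes S: "open S" "bounded S" "smooth_boundary S"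
  shows "emeasure surface_measure {x. proj12 x \<in> frontier S \<and> - L \<le> x $ 3 \<and> x $ 3 \<le> L} < \<infinity>"
proof -
  let ?A = "\<lambda>W. {x. proj12 x \<in> frontier S \<inter> W \<and> - L \<le> x $ 3 \<and> x $ 3 \<le> L}"
  have "\<exists>e>0. emeasure surface_measure (?A (ball p e)) < \<infinity>" if p: "p \<in> frontier S" for p
  proof -
    obtain U \<rho> where "local_defining_function S p U \<rho>" using S(3) p by (auto simp: smooth_boundary_def)
    then obtain e where "0 < e" "emeasure surface_measure (?A (ball p e)) < \<infinity>"
      by (rule finite_surface_wall_local[OF S(1) p])
    then show ?thesis by blast
  qed
  then have "\<forall>p\<in>frontier S. \<exists>e. 0 < e \<and> emeasure surface_measure (?A (ball p e)) < \<infinity>" by blast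
  from bchoice[OF this] obtain e where
    e: "\<And>p. p \<in> frontier S \<Longrightarrow> 0 < e p \<and> emeasure surface_measure (?A (ball p (e p))) < \<infinity>" by blast
  have "compact (frontier S)" using S(2) by (rule compact_frontier_bounded)
  then obtain P where P: "P \<subseteq> frontier S" "finite P" "frontier S \<subseteq> (\<Union>p\<in>P. ball p (e p))"
  proof (rule compactE_image)
    show "frontier S \<subseteq> (\<Union>p\<in>frontier S. ball p (e p))" using e by force
  qed auto
  have "{x. proj12 x \<in> frontier S \<and> - L \<le> x $ 3 \<and> x $ 3 \<le> L} = (\<Union>p\<in>P. ?A (ball p (e p)))"
  proof (intro equalityI subsetI)
    fix x assume x: "x \<in> {x. proj12 x \<in> frontier S \<and> - L \<le> x $ 3 \<and> x $ 3 \<le> L}"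
    then have "proj12 x \<in> (\<Union>p\<in>P. ball p (e p))" using P(3) by (intro subsetD[OF P(3)]) simp
    then obtain p where "p \<in> P" "proj12 x \<in> ball p (e p)" by (rule UN_E)
    then show "x \<in> (\<Union>p\<in>P. ?A (ball p (e p)))" using x by (intro UN_I[of p]) simp_all
  next
    fix x assume "x \<in> (\<Union>p\<in>P. ?A (ball p (e p)))"
    then obtain p where "x \<in> ?A (ball p (e p))" by (rule UN_E)
    then show "x \<in> {x. proj12 x \<in> frontier S \<and> - L \<le> x $ 3 \<and> x $ 3 \<le> L}" by simp
  qed
  also have "emeasure surface_measure \<dots> < \<infinity>"
  proof (rule finite_surface_UN[OF P(2)])
    fix p assume "p \<in> P"
    then show "emeasure surface_measure (?A (ball p (e p))) < \<infinity>" using e P(1) by blast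
    have [measurable]: "frontier S \<inter> ball p (e p) \<in> sets borel" by (simp add: borel_open borel_closed)
    show "?A (ball p (e p)) \<in> sets borel" by measurable
  qed
  finally show ?thesis .
qed

lemma finite_surface_frontier_cylinder:
  fixes S :: "(real^2) set"
  assumes S: "open S" "bounded S" "smooth_boundary S"
  shows "emeasure surface_measure (frontier (cylinder S L)) < \<infinity>"
proof -
  have [measurable]: "closure S \<in> sets borel" "frontier S \<in> sets borel" by (auto intro: borel_closed)
  let ?T = "{x. proj12 x \<in> closure S \<and> x $ 3 = L}"
  let ?B = "{x. proj12 x \<in> closure S \<and> x $ 3 = - L}"
  let ?W = "{x. proj12 x \<in> frontier S \<and> - L \<le> x $ 3 \<and> x $ 3 \<le> L}"
  have sets: "?T \<in> sets borel" "?B \<in> sets borel" "?W \<in> sets borel" by measurable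
  have fin: "emeasure surface_measure ?T < \<infinity>" "emeasure surface_measure ?B < \<infinity>"
    using finite_surface_layer[OF bounded_closure[OF S(2)] sets(1), of L]
      finite_surface_layer[OF bounded_closure[OF S(2)] sets(2), of "- L"] by auto
  note s = sets[THEN borel_sets_surface_measure]
  have "emeasure surface_measure (frontier (cylinder S L)) \<le> emeasure surface_measure (?T \<union> ?B \<union> ?W)"
    using frontier_cylinder_subset[OF S(1)] s by (intro emeasure_mono) auto
  also have "\<dots> \<le> emeasure surface_measure (?T \<union> ?B) + emeasure surface_measure ?W"
    using s by (intro emeasure_subadditive) auto
  also have "\<dots> \<le> (emeasure surface_measure ?T + emeasure surface_measure ?B) + emeasure surface_measure ?W"
    using s by (intro add_right_mono emeasure_subadditive) auto
  also have "\<dots> < \<infinity>" using fin finite_surface_wall[OF S] by (simp add: ennreal_add_less_top)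
  finally show ?thesis .
qed

section \<open>Vector algebra in \<open>C\<^sup>3\<close>\<close>

lemma cdot_add_left: "cdot (u + v) w = cdot u w + cdot v w"
  and cdot_add_right: "cdot w (u + v) = cdot w u + cdot w v"
  and cdot_scale_left: "cdot (c *s u) w = c * cdot u w"
  and cdot_scale_right: "cdot u (c *s w) = c * cdot u w"
  and cdot_diff_left: "cdot (u - v) w = cdot u w - cdot v w"
  and cdot_zero: "cdot 0 w = 0" "cdot w 0 = 0"
  and cdot_axis: "cdot u (axis i 1) = u $ i"
  by (simp_all add: cdot_def algebra_simps sum.distrib sum_distrib_left sum_subtractf axis_def
      if_distrib cong: if_cong)

lemma scaleR_nth_complex: "(r *\<^sub>R w) $ i = complex_of_real r * w $ i"
  unfolding vector_scaleR_component by (rule scaleR_conv_of_real)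

lemma cdot_scaleR_right: "cdot u (r *\<^sub>R w) = of_real r * cdot u w"
  unfolding cdot_def scaleR_nth_complex by (simp add: sum_distrib_left algebra_simps)

lemma vcnj_add: "vcnj (u + v) = vcnj u + vcnj v"
  and vcnj_diff: "vcnj (u - v) = vcnj u - vcnj v"
  and vcnj_scale: "vcnj (c *s u) = cnj c *s vcnj u"
  and vcnj_vcnj [simp]: "vcnj (vcnj u) = u"
  and vcnj_zero [simp]: "vcnj 0 = 0"
  and vcnj_cvec: "vcnj (cvec n) = cvec n"
  and vcnj_eq_0_iff [simp]: "vcnj u = 0 \<longleftrightarrow> u = 0"
  by (simp_all add: vcnj_def cvec_def vec_eq_iff)

lemma cnj_cdot: "cnj (cdot u v) = cdot (vcnj u) (vcnj v)"
  by (simp add: cdot_def vcnj_def)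

lemma cdot_commute: "cdot u v = cdot v u"
  by (simp add: cdot_def mult.commute)

lemma norm_vcnj [simp]: "norm (vcnj u) = norm u"
  by (simp add: norm_vec_def vcnj_def)

lemma cdot_vcnj_self: "cdot u (vcnj u) = of_real ((norm u)\<^sup>2)"
  by (simp add: cdot_def vcnj_def complex_norm_square[symmetric] norm_vec_def L2_set_def sum_nonneg)

lemma norm_cdot_le: "norm (cdot u v) \<le> norm u * norm v"
proof -
  have "norm (cdot u v) \<le> (\<Sum>i\<in>UNIV. \<bar>norm (u $ i)\<bar> * \<bar>norm (v $ i)\<bar>)"
    unfolding cdot_def by (rule order_trans[OF norm_sum]) (simp add: norm_mult)
  also have "\<dots> \<le> norm u * norm v" unfolding norm_vec_def by (rule L2_set_mult_ineq)
  finally show ?thesis .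
qed

lemma norm_cdot_le_squares: "norm (cdot u v) \<le> (norm u)\<^sup>2 + (norm v)\<^sup>2"
proof -
  have "0 \<le> (norm u - norm v)\<^sup>2 + (norm u)\<^sup>2 + (norm v)\<^sup>2" by simp
  then have "norm u * norm v \<le> (norm u)\<^sup>2 + (norm v)\<^sup>2" unfolding power2_diff by linarith
  then show ?thesis using norm_cdot_le order_trans by blast
qed

lemma norm_scale: "norm (c *s (u :: complex^3)) = norm c * norm u"
proof -
  have "norm (c *s u) = L2_set (\<lambda>i. norm c * norm (u $ i)) UNIV"
    by (simp add: norm_vec_def norm_mult)
  then show ?thesis by (simp add: norm_vec_def L2_set_right_distrib)
qed

lemma of_real_scale: "complex_of_real r *s u = r *\<^sub>R (u :: complex^3)"
  unfolding vec_eq_iff scaleR_nth_complex by simp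

lemma ccross_components:
  "ccross u v $ 1 = u $ 2 * v $ 3 - u $ 3 * v $ 2"
  "ccross u v $ 2 = u $ 3 * v $ 1 - u $ 1 * v $ 3"
  "ccross u v $ 3 = u $ 1 * v $ 2 - u $ 2 * v $ 1"
  by (simp_all add: ccross_def)

lemma ccross_add_right: "ccross n (u + v) = ccross n u + ccross n v"
  and ccross_scale_right: "ccross n (c *s u) = c *s ccross n u"
  and ccross_add_left: "ccross (u + v) n = ccross u n + ccross v n"
  and ccross_scale_left: "ccross (c *s u) n = c *s ccross u n"
  and ccross_zero: "ccross 0 n = 0" "ccross n 0 = 0"
  and vcnj_ccross: "vcnj (ccross u v) = ccross (vcnj u) (vcnj v)"
  by (simp_all add: vec_eq_iff forall_3 ccross_components vcnj_def algebra_simps)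

text \<open>The triple product moves the normal from the trace to the test field, so that a trace enters
Green's formula only through its integral against a fixed weight.\<close>

lemma cdot_ccross: "cdot (ccross n g) p = cdot g (ccross p n)"
  by (simp add: cdot_def sum_3 ccross_components algebra_simps)

lemma norm_ccross_le: "norm (ccross u v) \<le> 6 * (norm u * norm v)"
proof -
  have c: "norm (u $ i * v $ j) \<le> norm u * norm v" for i j
    unfolding norm_mult by (intro mult_mono Finite_Cartesian_Product.norm_nth_le) auto
  have "norm (u $ i * v $ j - u $ k * v $ l) \<le> 2 * (norm u * norm v)" for i j k l
    using norm_triangle_ineq4[of "u $ i * v $ j" "u $ k * v $ l"] c[of i j] c[of k l] by linarith
  then have "norm (ccross u v $ i) \<le> 2 * (norm u * norm v)" for i
    using exhaust_3[of i] by (auto simp: ccross_components)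
  then have "(\<Sum>i\<in>UNIV. norm (ccross u v $ i)) \<le> (\<Sum>i\<in>(UNIV :: 3 set). 2 * (norm u * norm v))"
    by (intro sum_mono)
  then show ?thesis
    using L2_set_le_sum[of UNIV "\<lambda>i. norm (ccross u v $ i)"] by (simp add: norm_vec_def)
qed

lemma norm_cvec [simp]: "norm (cvec n) = norm n"
  by (simp add: cvec_def norm_vec_def)

lemma norm_ccross_swap: "norm (ccross u v) = norm (ccross v u)"
proof -
  have "ccross u v = - ccross v u" by (simp add: vec_eq_iff forall_3 ccross_components algebra_simps)
  then show ?thesis by simp
qed

lemma norm_ccross_cvec_le: "norm n \<le> 1 \<Longrightarrow> norm (ccross (cvec n) g) \<le> 6 * norm g"
  using norm_ccross_le[of "cvec n" g] mult_right_mono[of "norm n" 1 "norm g"] by simp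

section \<open>Square integrable fields\<close>

lemma borel_measurable_nth [measurable (raw)]:
  fixes f :: "'a \<Rightarrow> ('b::{real_normed_vector, second_countable_topology}) ^ 'n"
  assumes "f \<in> borel_measurable M"
  shows "(\<lambda>x. f x $ i) \<in> borel_measurable M"
  using borel_measurable_continuous_on[OF continuous_on_component[OF continuous_on_id] assms] by simp

lemma borel_measurable_vecI:
  fixes f :: "'a \<Rightarrow> ('b::euclidean_space) ^ 'n"
  assumes "\<And>i. (\<lambda>x. f x $ i) \<in> borel_measurable M"
  shows "f \<in> borel_measurable M"
proof (subst borel_measurable_euclidean_space, intro ballI)
  fix b :: "'b ^ 'n" assume "b \<in> Basis"
  then obtain i c where "b = axis i c" by (auto simp: Basis_vec_def)
  then show "(\<lambda>x. f x \<bullet> b) \<in> borel_measurable M" using assms by (simp add: inner_axis)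
qed

lemma borel_measurable_cdot [measurable (raw)]:
  assumes [measurable]: "f \<in> borel_measurable M" "g \<in> borel_measurable M"
  shows "(\<lambda>x. cdot (f x) (g x)) \<in> borel_measurable M"
  unfolding cdot_def by measurable

lemma borel_measurable_vcnj [measurable (raw)]:
  assumes [measurable]: "f \<in> borel_measurable M"
  shows "(\<lambda>x. vcnj (f x)) \<in> borel_measurable M"
proof (rule borel_measurable_vecI)
  fix i
  have "(\<lambda>x. cnj (f x $ i)) \<in> borel_measurable M"
    by (rule borel_measurable_continuous_on[of cnj]) (auto intro: continuous_intros)
  then show "(\<lambda>x. vcnj (f x) $ i) \<in> borel_measurable M" by (simp add: vcnj_def)
qed

lemma borel_measurable_vscale [measurable (raw)]:
  fixes f :: "'a \<Rightarrow> complex^3"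
  shows "c \<in> borel_measurable M \<Longrightarrow> f \<in> borel_measurable M \<Longrightarrow> (\<lambda>x. c x *s f x) \<in> borel_measurable M"
  by (rule borel_measurable_vecI) simp

lemma borel_measurable_cvec [measurable (raw)]:
  "f \<in> borel_measurable M \<Longrightarrow> (\<lambda>x. cvec (f x)) \<in> borel_measurable M"
  by (rule borel_measurable_vecI) (simp add: cvec_def)

lemma borel_measurable_ccross [measurable (raw)]:
  assumes [measurable]: "f \<in> borel_measurable M" "g \<in> borel_measurable M"
  shows "(\<lambda>x. ccross (f x) (g x)) \<in> borel_measurable M"
proof (rule borel_measurable_vecI)
  fix i :: 3
  show "(\<lambda>x. ccross (f x) (g x) $ i) \<in> borel_measurable M"
    using exhaust_3[of i] by (elim disjE) (simp_all add: ccross_components)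
qed

definition sqnorm :: "(real^3) measure \<Rightarrow> (real^3 \<Rightarrow> complex^3) \<Rightarrow> real" where
  "sqnorm M f = (LINT x|M. (norm (f x))\<^sup>2)"

lemma sqnorm_nonneg: "0 \<le> sqnorm M f"
  by (simp add: sqnorm_def)

lemma L2_measurable [measurable_dest]: "L2 M f \<Longrightarrow> f \<in> borel_measurable M"
  and L2_integrable: "L2 M f \<Longrightarrow> integrable M (\<lambda>x. (norm (f x))\<^sup>2)"
  by (auto simp: L2_def)

lemma norm_square_add_le: "(norm (u + v))\<^sup>2 \<le> 2 * (norm u)\<^sup>2 + 2 * (norm v)\<^sup>2"
proof -
  have "(norm (u + v))\<^sup>2 \<le> (norm u + norm v)\<^sup>2" by (intro power_mono norm_triangle_ineq) simp
  also have "\<dots> \<le> 2 * (norm u)\<^sup>2 + 2 * (norm v)\<^sup>2"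
    using zero_le_power2[of "norm u - norm v"] by (simp add: power2_eq_square algebra_simps)
  finally show ?thesis .
qed

lemma L2_bound:
  assumes "f \<in> borel_measurable M" "L2 M u" "L2 M v"
    and "\<And>x. x \<in> space M \<Longrightarrow> (norm (f x))\<^sup>2 \<le> a * (norm (u x))\<^sup>2 + b * (norm (v x))\<^sup>2"
  shows "L2 M f"
  unfolding L2_def
proof
  show "integrable M (\<lambda>x. (norm (f x))\<^sup>2)"
  proof (rule Bochner_Integration.integrable_bound)
    show "integrable M (\<lambda>x. a * (norm (u x))\<^sup>2 + b * (norm (v x))\<^sup>2)"
      using assms by (auto intro!: L2_integrable)
    show "AE x in M. norm ((norm (f x))\<^sup>2) \<le> norm (a * (norm (u x))\<^sup>2 + b * (norm (v x))\<^sup>2)"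
      using assms(4) by (intro AE_I2) (simp add: order_trans[OF _ abs_ge_self])
  qed (use assms in measurable)
qed (rule assms)

text \<open>The operation of the semi-inner product space of fields; \<open>comb u (-1) v\<close> is the difference.\<close>

definition comb :: "(real^3 \<Rightarrow> complex^3) \<Rightarrow> complex \<Rightarrow> (real^3 \<Rightarrow> complex^3) \<Rightarrow> real^3 \<Rightarrow> complex^3" where
  "comb u t v x = u x + t *s v x"

lemma L2_comb: "L2 M u \<Longrightarrow> L2 M v \<Longrightarrow> L2 M (comb u t v)"
proof (rule L2_bound[of _ _ u v 2 "2 * (norm t)\<^sup>2"])
  fix x
  show "(norm (comb u t v x))\<^sup>2 \<le> 2 * (norm (u x))\<^sup>2 + 2 * (norm t)\<^sup>2 * (norm (v x))\<^sup>2"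
    using norm_square_add_le[of "u x" "t *s v x"] by (simp add: comb_def norm_scale power_mult_distrib)
qed (auto simp: comb_def[abs_def] L2_measurable)

lemma L2_vcnj: "L2 M u \<Longrightarrow> L2 M (\<lambda>x. vcnj (u x))"
  by (auto simp: L2_def)

lemma L2_cong_AE:
  assumes "L2 M u" "v \<in> borel_measurable M" "AE x in M. u x = v x"
  shows "L2 M v"
  unfolding L2_def
proof
  have "integrable M (\<lambda>x. (norm (u x))\<^sup>2) = integrable M (\<lambda>x. (norm (v x))\<^sup>2)"
  proof (rule integrable_cong_AE)
    show "AE x in M. (norm (u x))\<^sup>2 = (norm (v x))\<^sup>2" using assms(3) by eventually_elim simp
  qed (use assms L2_measurable in auto)
  then show "integrable M (\<lambda>x. (norm (v x))\<^sup>2)" using assms(1) by (simp add: L2_def)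
qed (rule assms)

text \<open>Boundedness is required only on the space of the measure; this is what continuity provides on a
bounded domain.\<close>

definition coefficient :: "(real^3) measure \<Rightarrow> (real^3 \<Rightarrow> 'b::real_normed_vector) \<Rightarrow> bool" where
  "coefficient M \<alpha> \<longleftrightarrow> \<alpha> \<in> borel_measurable M \<and> (\<exists>K. \<forall>x\<in>space M. norm (\<alpha> x) \<le> K)"

lemma coefficientI:
  "\<alpha> \<in> borel_measurable M \<Longrightarrow> (\<And>x. x \<in> space M \<Longrightarrow> norm (\<alpha> x) \<le> K) \<Longrightarrow> coefficient M \<alpha>"
  by (auto simp: coefficient_def)

lemma coefficient_const: "coefficient M (\<lambda>x. c)"
  by (rule coefficientI[of _ _ "norm c"]) auto

lemma coefficient_L2:
  assumes "finite_measure M" "coefficient M p"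
  shows "L2 M p"
proof -
  obtain K where K: "p \<in> borel_measurable M" "\<forall>x\<in>space M. norm (p x) \<le> K"
    using assms(2) by (auto simp: coefficient_def)
  have "integrable M (\<lambda>x. (norm (p x))\<^sup>2)"
  proof (rule finite_measure.integrable_const_bound[OF assms(1)])
    show "AE x in M. norm ((norm (p x))\<^sup>2) \<le> K\<^sup>2"
      using K(2) by (intro AE_I2) (simp add: power_mono)
  qed (use K in auto)
  then show ?thesis using K by (simp add: L2_def)
qed

lemma integrable_cdot:
  assumes "L2 M u" "L2 M v"
  shows "integrable M (\<lambda>x. cdot (u x) (v x))"
proof (rule Bochner_Integration.integrable_bound)
  show "integrable M (\<lambda>x. (norm (u x))\<^sup>2 + (norm (v x))\<^sup>2)"
    using assms by (auto intro!: L2_integrable)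
  show "AE x in M. norm (cdot (u x) (v x)) \<le> norm ((norm (u x))\<^sup>2 + (norm (v x))\<^sup>2)"
    using norm_cdot_le_squares by (intro AE_I2) simp
qed (use assms in measurable)

text \<open>All four terms of the sesquilinear form, and also the inner product of \<open>X\<^sup>d\<close>, are of this kind.\<close>

definition w_inner :: "(real^3) measure \<Rightarrow> (real^3 \<Rightarrow> complex) \<Rightarrow> (real^3 \<Rightarrow> complex^3) \<Rightarrow> (real^3 \<Rightarrow> complex^3) \<Rightarrow> complex" where
  "w_inner M \<alpha> u v = (LINT x|M. \<alpha> x * cdot (u x) (vcnj (v x)))"

lemma integrable_w_inner:
  assumes \<alpha>: "coefficient M \<alpha>" and u: "L2 M u" and v: "L2 M v"
  shows "integrable M (\<lambda>x. \<alpha> x * cdot (u x) (vcnj (v x)))"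
proof -
  obtain K where K: "\<alpha> \<in> borel_measurable M" "\<And>x. x \<in> space M \<Longrightarrow> norm (\<alpha> x) \<le> K"
    using \<alpha> by (auto simp: coefficient_def)
  note [measurable] = K(1) L2_measurable[OF u] L2_measurable[OF v]
  have "integrable M (\<lambda>x. of_real K * cdot (u x) (vcnj (v x)))"
    using integrable_cdot[OF u L2_vcnj[OF v]] by (rule integrable_mult_right)
  then show ?thesis
  proof (rule Bochner_Integration.integrable_bound)
    show "AE x in M. norm (\<alpha> x * cdot (u x) (vcnj (v x))) \<le> norm (of_real K * cdot (u x) (vcnj (v x)))"
      by (intro AE_I2) (simp add: norm_mult mult_right_mono order_trans[OF K(2) abs_ge_self])
  qed measurable
qed

lemma w_inner_comb_left:
  assumes "coefficient M \<alpha>" "L2 M u" "L2 M v" "L2 M w"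
  shows "w_inner M \<alpha> (comb u t v) w = w_inner M \<alpha> u w + t * w_inner M \<alpha> v w"
proof -
  have "w_inner M \<alpha> (comb u t v) w
     = (LINT x|M. \<alpha> x * cdot (u x) (vcnj (w x)) + t * (\<alpha> x * cdot (v x) (vcnj (w x))))"
    unfolding w_inner_def comb_def by (simp add: cdot_add_left cdot_scale_left algebra_simps)
  then show ?thesis using assms by (simp add: w_inner_def integrable_w_inner)
qed

lemma w_inner_comb_right:
  assumes "coefficient M \<alpha>" "L2 M u" "L2 M v" "L2 M w"
  shows "w_inner M \<alpha> w (comb u t v) = w_inner M \<alpha> w u + cnj t * w_inner M \<alpha> w v"
proof -
  have "w_inner M \<alpha> w (comb u t v)
     = (LINT x|M. \<alpha> x * cdot (w x) (vcnj (u x)) + cnj t * (\<alpha> x * cdot (w x) (vcnj (v x))))"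
    unfolding w_inner_def comb_def by (simp add: vcnj_add vcnj_scale cdot_add_right cdot_scale_right algebra_simps)
  then show ?thesis using assms by (simp add: w_inner_def integrable_w_inner)
qed

lemma w_inner_cong_AE:
  assumes "coefficient M \<alpha>" "L2 M u" "L2 M v" "L2 M u'" "L2 M v'"
    and "AE x in M. u x = u' x" "AE x in M. v x = v' x"
  shows "w_inner M \<alpha> u v = w_inner M \<alpha> u' v'"
  unfolding w_inner_def
proof (rule integral_cong_AE)
  have [measurable]: "\<alpha> \<in> borel_measurable M" using assms(1) by (simp add: coefficient_def)
  note [measurable] = assms(2-5)[THEN L2_measurable]
  show "(\<lambda>x. \<alpha> x * cdot (u x) (vcnj (v x))) \<in> borel_measurable M"
    "(\<lambda>x. \<alpha> x * cdot (u' x) (vcnj (v' x))) \<in> borel_measurable M" by measurable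
  show "AE x in M. \<alpha> x * cdot (u x) (vcnj (v x)) = \<alpha> x * cdot (u' x) (vcnj (v' x))"
    using assms(6,7) by eventually_elim simp
qed

lemma w_inner_1_swap: "w_inner M (\<lambda>x. 1) u v = cnj (w_inner M (\<lambda>x. 1) v u)"
proof -
  have "cnj (w_inner M (\<lambda>x. 1) v u) = (LINT x|M. cnj (1 * cdot (v x) (vcnj (u x))))"
    unfolding w_inner_def by simp
  also have "\<dots> = w_inner M (\<lambda>x. 1) u v"
    unfolding w_inner_def by (simp add: cnj_cdot cdot_commute[of "u _"])
  finally show ?thesis by simp
qed

lemma w_inner_1_self: "w_inner M (\<lambda>x. 1) u u = of_real (sqnorm M u)"
  unfolding w_inner_def sqnorm_def by (simp add: cdot_vcnj_self flip: integral_complex_of_real)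

lemma norm_w_inner_le:
  assumes \<alpha>: "coefficient M \<alpha>" and K: "\<And>x. x \<in> space M \<Longrightarrow> norm (\<alpha> x) \<le> K" "0 \<le> K" and u: "L2 M u" and v: "L2 M v"
  shows "norm (w_inner M \<alpha> u v) \<le> K * (sqnorm M u + sqnorm M v)"
proof -
  have "norm (w_inner M \<alpha> u v) \<le> (LINT x|M. norm (\<alpha> x * cdot (u x) (vcnj (v x))))"
    unfolding w_inner_def by (rule integral_norm_bound)
  also have "\<dots> \<le> (LINT x|M. K * ((norm (u x))\<^sup>2 + (norm (v x))\<^sup>2))"
  proof (rule integral_mono)
    show "integrable M (\<lambda>x. norm (\<alpha> x * cdot (u x) (vcnj (v x))))"
      using integrable_w_inner[OF \<alpha> u v] by (rule integrable_norm)
    show "integrable M (\<lambda>x. K * ((norm (u x))\<^sup>2 + (norm (v x))\<^sup>2))"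
      using u v by (auto intro!: L2_integrable)
    fix x assume x: "x \<in> space M"
    have "norm (cdot (u x) (vcnj (v x))) \<le> (norm (u x))\<^sup>2 + (norm (v x))\<^sup>2"
      using norm_cdot_le_squares[of "u x" "vcnj (v x)"] by simp
    then show "norm (\<alpha> x * cdot (u x) (vcnj (v x))) \<le> K * ((norm (u x))\<^sup>2 + (norm (v x))\<^sup>2)"
      unfolding norm_mult using K x by (intro mult_mono) auto
  qed
  also have "\<dots> = K * (sqnorm M u + sqnorm M v)"
    using u v by (simp add: sqnorm_def L2_integrable)
  finally show ?thesis .
qed

lemma Re_w_inner_ge:
  assumes \<alpha>: "coefficient M \<alpha>" and u: "L2 M u" and c: "\<And>x. x \<in> space M \<Longrightarrow> c \<le> Re (\<beta> * \<alpha> x)"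
  shows "c * sqnorm M u \<le> Re (\<beta> * w_inner M \<alpha> u u)"
proof -
  have i: "integrable M (\<lambda>x. \<beta> * (\<alpha> x * cdot (u x) (vcnj (u x))))"
    using integrable_w_inner[OF \<alpha> u u] by (rule integrable_mult_right)
  have "c * sqnorm M u = (LINT x|M. c * (norm (u x))\<^sup>2)" by (simp add: sqnorm_def)
  also have "\<dots> \<le> (LINT x|M. Re (\<beta> * (\<alpha> x * cdot (u x) (vcnj (u x)))))"
  proof (rule integral_mono)
    show "integrable M (\<lambda>x. c * (norm (u x))\<^sup>2)" using u by (auto intro!: L2_integrable)
    show "integrable M (\<lambda>x. Re (\<beta> * (\<alpha> x * cdot (u x) (vcnj (u x)))))" using i by (rule integrable_Re)
    fix x assume "x \<in> space M"
    then have "c * (norm (u x))\<^sup>2 \<le> Re (\<beta> * \<alpha> x) * (norm (u x))\<^sup>2" using c by (intro mult_right_mono) auto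
    also have "\<dots> = Re (\<beta> * (\<alpha> x * cdot (u x) (vcnj (u x))))"
      unfolding cdot_vcnj_self mult.assoc[symmetric] by simp
    finally show "c * (norm (u x))\<^sup>2 \<le> Re (\<beta> * (\<alpha> x * cdot (u x) (vcnj (u x))))" .
  qed
  also have "\<dots> = Re (\<beta> * w_inner M \<alpha> u u)"
    unfolding w_inner_def integral_mult_right_zero[symmetric] using i by (rule integral_Re)
  finally show ?thesis .
qed

lemma sqnorm_eq_0_AE:
  assumes "L2 M u" "sqnorm M u = 0"
  shows "AE x in M. u x = 0"
proof -
  have "AE x in M. (norm (u x))\<^sup>2 = 0"
    using integral_nonneg_eq_0_iff_AE[OF L2_integrable[OF assms(1)]] assms(2) by (simp add: sqnorm_def)
  then show ?thesis by simp
qed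

lemma sqnorm_cong_AE:
  assumes "L2 M u" "L2 M v" "AE x in M. u x = v x"
  shows "sqnorm M u = sqnorm M v"
  unfolding sqnorm_def using assms(3) L2_measurable[OF assms(1)] L2_measurable[OF assms(2)]
  by (intro integral_cong_AE) (auto elim: eventually_mono)

lemma sqnorm_mono_bound:
  assumes "L2 M u" "L2 M v" "\<And>x. x \<in> space M \<Longrightarrow> norm (u x) \<le> K * norm (v x)"
  shows "sqnorm M u \<le> K\<^sup>2 * sqnorm M v"
proof -
  have "sqnorm M u \<le> (LINT x|M. K\<^sup>2 * (norm (v x))\<^sup>2)"
    unfolding sqnorm_def
  proof (rule integral_mono)
    fix x assume "x \<in> space M"
    then have "(norm (u x))\<^sup>2 \<le> (K * norm (v x))\<^sup>2" using assms(3) by (intro power_mono) auto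
    then show "(norm (u x))\<^sup>2 \<le> K\<^sup>2 * (norm (v x))\<^sup>2" by (simp add: power_mult_distrib)
  qed (use assms L2_integrable in auto)
  then show ?thesis by (simp add: sqnorm_def)
qed

text \<open>Convergence in \<open>L\<^sup>2\<close> implies weak convergence: the pointwise bound \<open>\<bar>h p\<bar> \<le> t \<bar>h\<bar>\<^sup>2 + \<bar>p\<bar>\<^sup>2 / t\<close> is integrated, with \<open>t\<close> so large that
the second term is small.\<close>

lemma tendsto_integral_cdot:
  assumes f: "\<And>n. L2 M (f n)" and g: "L2 M g" and p: "L2 M p"
    and lim: "(\<lambda>n. sqnorm M (comb (f n) (-1) g)) \<longlonglongrightarrow> 0"
  shows "(\<lambda>n. LINT x|M. cdot (f n x) (p x)) \<longlonglongrightarrow> (LINT x|M. cdot (g x) (p x))"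
proof (rule LIM_zero_cancel, rule tendstoI)
  fix e :: real assume e: "0 < e"
  define b where "b = sqnorm M p"
  have b: "0 \<le> b" by (simp add: b_def sqnorm_nonneg)
  define t where "t = 2 * (b + 1) / e"
  have t: "0 < t" using b e by (simp add: t_def)
  have bound: "norm ((LINT x|M. cdot (f n x) (p x)) - (LINT x|M. cdot (g x) (p x)))
      \<le> t * sqnorm M (comb (f n) (-1) g) + b / t" for n
  proof -
    let ?h = "comb (f n) (-1) g"
    have h: "L2 M ?h" by (intro L2_comb f g)
    have "(LINT x|M. cdot (f n x) (p x)) - (LINT x|M. cdot (g x) (p x)) = (LINT x|M. cdot (?h x) (p x))"
      using integrable_cdot[OF f p, of n] integrable_cdot[OF g p]
      by (simp add: comb_def cdot_diff_left)
    also have "norm \<dots> \<le> (LINT x|M. norm (cdot (?h x) (p x)))" by (rule integral_norm_bound)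
    also have "\<dots> \<le> (LINT x|M. t * (norm (?h x))\<^sup>2 + (norm (p x))\<^sup>2 / t)"
    proof (rule integral_mono)
      show "integrable M (\<lambda>x. norm (cdot (?h x) (p x)))"
        using integrable_cdot[OF h p] by (rule integrable_norm)
      show "integrable M (\<lambda>x. t * (norm (?h x))\<^sup>2 + (norm (p x))\<^sup>2 / t)"
        using L2_integrable[OF h] L2_integrable[OF p] by auto
      fix x
      have "0 \<le> (t * norm (?h x) - norm (p x))\<^sup>2 + (t * norm (?h x))\<^sup>2 + (norm (p x))\<^sup>2" by simp
      then have "t * (norm (?h x) * norm (p x)) \<le> t * (t * (norm (?h x))\<^sup>2 + (norm (p x))\<^sup>2 / t)"
        using t by (simp add: power2_eq_square algebra_simps)
      then have "norm (?h x) * norm (p x) \<le> t * (norm (?h x))\<^sup>2 + (norm (p x))\<^sup>2 / t" using t by simp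
      then show "norm (cdot (?h x) (p x)) \<le> t * (norm (?h x))\<^sup>2 + (norm (p x))\<^sup>2 / t"
        using norm_cdot_le order_trans by blast
    qed
    also have "\<dots> = t * sqnorm M ?h + b / t"
      using L2_integrable[OF h] L2_integrable[OF p] by (simp add: sqnorm_def b_def)
    finally show ?thesis .
  qed
  have "b / t < e / 2" using b e by (simp add: t_def field_simps)
  have "\<forall>\<^sub>F n in sequentially. sqnorm M (comb (f n) (-1) g) < e / (2 * t)"
    using order_tendstoD(2)[OF lim] e t by simp
  then show "\<forall>\<^sub>F n in sequentially.
      dist ((LINT x|M. cdot (f n x) (p x)) - (LINT x|M. cdot (g x) (p x))) 0 < e"
  proof eventually_elim
    case (elim n)
    then have "t * sqnorm M (comb (f n) (-1) g) < e / 2" using t by (simp add: field_simps)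
    then have "norm ((LINT x|M. cdot (f n x) (p x)) - (LINT x|M. cdot (g x) (p x))) < e"
      using bound[of n] \<open>b / t < e / 2\<close> by linarith
    then show ?case by simp
  qed
qed

text \<open>With \<open>n\<close> for the \<open>k\<close>-th increment, \<open>n \<le> 2\<^sup>-\<^sup>k + 2\<^sup>k n\<^sup>2\<close>. The integrals of \<open>2\<^sup>k n\<^sup>2\<close> are bounded by
\<open>2\<^sup>-\<^sup>k\<close>, so these functions are summable almost everywhere, and so are the increments.\<close>

lemma AE_convergent_if_rapidly_Cauchy:
  fixes g :: "nat \<Rightarrow> 'a \<Rightarrow> 'b::{banach, second_countable_topology}"
  assumes g [measurable]: "\<And>k. g k \<in> borel_measurable M"
    and int: "\<And>k. integrable M (\<lambda>x. (norm (g (Suc k) x - g k x))\<^sup>2)"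
    and small: "\<And>k. (LINT x|M. (norm (g (Suc k) x - g k x))\<^sup>2) \<le> (1 / 4) ^ k"
  shows "AE x in M. convergent (\<lambda>k. g k x)"
proof -
  define s where "s k x = 2 ^ k * (norm (g (Suc k) x - g k x))\<^sup>2" for k x
  have [measurable]: "s k \<in> borel_measurable M" for k unfolding s_def by measurable
  have sint: "integrable M (s k)" for k unfolding s_def using int by simp
  have s0: "0 \<le> s k x" for k x by (simp add: s_def)
  have "(\<integral>\<^sup>+x. ennreal (s k x) \<partial>M) \<le> ennreal ((1 / 2) ^ k)" for k
  proof -
    have "(\<integral>\<^sup>+x. ennreal (s k x) \<partial>M) = ennreal (LINT x|M. s k x)"
      using sint s0 by (intro nn_integral_eq_integral) auto
    also have "(LINT x|M. s k x) \<le> 2 ^ k * (1 / 4) ^ k"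
      unfolding s_def using small[of k] by simp
    also have "\<dots> = (1 / 2 :: real) ^ k" by (simp add: power_mult_distrib[symmetric])
    finally show ?thesis by (simp add: ennreal_leI)
  qed
  then have "(\<Sum>k. \<integral>\<^sup>+x. ennreal (s k x) \<partial>M) \<le> (\<Sum>k. ennreal ((1 / 2) ^ k))"
    by (intro suminf_le) auto
  moreover have "(\<Sum>k. ennreal ((1 / 2) ^ k)) \<noteq> top"
    by (rule ennreal_suminf_neq_top) (auto intro: summable_geometric)
  moreover have "(\<integral>\<^sup>+x. (\<Sum>k. ennreal (s k x)) \<partial>M) = (\<Sum>k. \<integral>\<^sup>+x. ennreal (s k x) \<partial>M)"
    by (rule nn_integral_suminf) measurable
  ultimately have "(\<integral>\<^sup>+x. (\<Sum>k. ennreal (s k x)) \<partial>M) \<noteq> \<infinity>"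
    using neq_top_trans by (metis infinity_ennreal_def)
  then have "AE x in M. (\<Sum>k. ennreal (s k x)) \<noteq> \<infinity>"
    by (intro nn_integral_noteq_infinite) auto
  then show ?thesis
  proof eventually_elim
    case (elim x)
    then have sums: "summable (\<lambda>k. s k x)" using s0 by (intro summable_suminf_not_top) auto
    have "summable (\<lambda>k. g (Suc k) x - g k x)"
    proof (rule summable_comparison_test[OF exI, of 0])
      show "summable (\<lambda>k. (1 / 2) ^ k + s k x)" using sums by (intro summable_add) auto
      show "\<forall>k\<ge>0. norm (g (Suc k) x - g k x) \<le> (1 / 2) ^ k + s k x"
      proof (intro allI impI)
        fix k
        define n where "n = norm (g (Suc k) x - g k x)"
        define q where "q = (2 :: real) ^ k"
        have q: "0 < q" "(1 / 2) ^ k = 1 / q" by (auto simp: q_def power_divide)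
        have "0 \<le> (q * n - 1)\<^sup>2 + (q * n)\<^sup>2 + 1" by simp
        then have "q * n \<le> q * (1 / q + q * n\<^sup>2)" using q by (simp add: power2_eq_square algebra_simps)
        then have "n \<le> 1 / q + q * n\<^sup>2" using q by simp
        then show "norm (g (Suc k) x - g k x) \<le> (1 / 2) ^ k + s k x"
          unfolding s_def n_def[symmetric] q_def[symmetric] q(2) .
      qed
    qed
    then obtain l where "(\<lambda>n. \<Sum>k<n. g (Suc k) x - g k x) \<longlonglongrightarrow> l" by (auto simp: summable_def sums_def)
    then have "(\<lambda>n. g n x - g 0 x) \<longlonglongrightarrow> l" 
      using sum_lessThan_telescope[of "\<lambda>k. g k x"] by simp
    from tendsto_add[OF this tendsto_const[of "g 0 x"]] show ?case by (auto simp: convergent_def)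
  qed
qed

text \<open>The limit is the pointwise limit of a rapidly convergent subsequence; Fatou's lemma transfers the
Cauchy estimate to it.\<close>

lemma L2_complete:
  assumes f: "\<And>n. L2 M (f n)"
    and cauchy: "\<And>e. 0 < e \<Longrightarrow> \<exists>N. \<forall>m\<ge>N. \<forall>n\<ge>N. sqnorm M (comb (f m) (-1) (f n)) < e"
  obtains g where "L2 M g" "(\<lambda>n. sqnorm M (comb (f n) (-1) g)) \<longlonglongrightarrow> 0"
proof -
  note [measurable] = f[THEN L2_measurable]
  have "\<exists>N. \<forall>m\<ge>N. \<forall>n\<ge>N. sqnorm M (comb (f m) (-1) (f n)) < (1 / 4) ^ k" for k
    by (rule cauchy) simp
  then obtain N where N: "\<And>k m n. N k \<le> m \<Longrightarrow> N k \<le> n \<Longrightarrow> sqnorm M (comb (f m) (-1) (f n)) < (1 / 4) ^ k"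
    by metis
  define r where "r k = (\<Sum>i\<le>k. N i) + k" for k
  have r: "N k \<le> r k" "r k \<le> r (Suc k)" "k \<le> r k" for k
    by (auto simp: r_def intro: trans_le_add1 member_le_sum)
  have comb_eq: "comb u (-1) v = (\<lambda>x. u x - v x)" for u v by (auto simp: comb_def)
  have conv: "AE x in M. convergent (\<lambda>k. f (r k) x)"
  proof (rule AE_convergent_if_rapidly_Cauchy)
    fix k
    show "integrable M (\<lambda>x. (norm (f (r (Suc k)) x - f (r k) x))\<^sup>2)"
      using L2_integrable[OF L2_comb[OF f f, of "r (Suc k)" "-1" "r k"]] by (simp add: comb_eq)
    show "(LINT x|M. (norm (f (r (Suc k)) x - f (r k) x))\<^sup>2) \<le> (1 / 4) ^ k"
      using N[of k "r (Suc k)" "r k"] r(1)[of k] r(2)[of k] by (simp add: sqnorm_def comb_eq)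
  qed measurable
  define g where "g x = lim (\<lambda>k. f (r k) x)" for x
  have g [measurable]: "g \<in> borel_measurable M" unfolding g_def by measurable
  have fg: "AE x in M. (\<lambda>k. f (r k) x) \<longlonglongrightarrow> g x"
    using conv by eventually_elim (simp add: g_def convergent_LIMSEQ_iff)
  have fatou: "(\<integral>\<^sup>+x. ennreal ((norm (f n x - g x))\<^sup>2) \<partial>M) \<le> ennreal e"
    if n: "\<And>m. n0 \<le> m \<Longrightarrow> sqnorm M (comb (f n) (-1) (f m)) \<le> e" for n n0 e
  proof -
    have "(\<integral>\<^sup>+x. ennreal ((norm (f n x - g x))\<^sup>2) \<partial>M)
        = (\<integral>\<^sup>+x. liminf (\<lambda>k. ennreal ((norm (f n x - f (r k) x))\<^sup>2)) \<partial>M)"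
    proof (rule nn_integral_cong_AE, use fg in eventually_elim)
      case (elim x)
      have "(\<lambda>k. ennreal ((norm (f n x - f (r k) x))\<^sup>2)) \<longlonglongrightarrow> ennreal ((norm (f n x - g x))\<^sup>2)"
        by (intro tendsto_intros elim)
      from lim_imp_Liminf[OF trivial_limit_sequentially this] show ?case by simp
    qed
    also have "\<dots> \<le> liminf (\<lambda>k. \<integral>\<^sup>+x. ennreal ((norm (f n x - f (r k) x))\<^sup>2) \<partial>M)"
      by (rule nn_integral_liminf) measurable
    also have "\<dots> \<le> limsup (\<lambda>k. \<integral>\<^sup>+x. ennreal ((norm (f n x - f (r k) x))\<^sup>2) \<partial>M)"
      by (rule Liminf_le_Limsup) simp
    also have "\<dots> \<le> ennreal e"
    proof (rule Limsup_bounded, rule eventually_sequentiallyI)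
      fix k assume "n0 \<le> k"
      then have "sqnorm M (comb (f n) (-1) (f (r k))) \<le> e" using n r(3) order_trans by blast
      moreover have "(\<integral>\<^sup>+x. ennreal ((norm (f n x - f (r k) x))\<^sup>2) \<partial>M) = ennreal (sqnorm M (comb (f n) (-1) (f (r k))))"
        unfolding sqnorm_def using L2_integrable[OF L2_comb[OF f f, of n "-1" "r k"]]
        by (subst nn_integral_eq_integral[symmetric]) (auto simp: comb_eq)
      ultimately show "(\<integral>\<^sup>+x. ennreal ((norm (f n x - f (r k) x))\<^sup>2) \<partial>M) \<le> ennreal e"
        by (simp add: ennreal_leI)
    qed
    finally show ?thesis .
  qed
  have close: "L2 M (comb (f n) (-1) g) \<and> sqnorm M (comb (f n) (-1) g) \<le> e"
    if n: "\<And>m. n0 \<le> m \<Longrightarrow> sqnorm M (comb (f n) (-1) (f m)) \<le> e" for n n0 e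
  proof -
    have e: "0 \<le> e" using n[of n0] sqnorm_nonneg order_trans by blast
    have i: "integrable M (\<lambda>x. (norm (f n x - g x))\<^sup>2)"
      using le_less_trans[OF fatou[OF n]] by (intro integrableI_nonneg) auto
    have "ennreal (LINT x|M. (norm (f n x - g x))\<^sup>2) \<le> ennreal e"
      using fatou[OF n] i by (subst nn_integral_eq_integral[symmetric]) auto
    then have "sqnorm M (comb (f n) (-1) g) \<le> e" using e by (simp add: sqnorm_def comb_eq)
    with i show ?thesis by (simp add: L2_def comb_eq)
  qed
  have lim: "(\<lambda>n. sqnorm M (comb (f n) (-1) g)) \<longlonglongrightarrow> 0"
  proof (rule tendstoI)
    fix e :: real assume e: "0 < e"
    obtain n0 where n0: "\<And>m n. n0 \<le> m \<Longrightarrow> n0 \<le> n \<Longrightarrow> sqnorm M (comb (f m) (-1) (f n)) < e / 2"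
      using cauchy[of "e / 2"] e by auto
    have "sqnorm M (comb (f n) (-1) g) \<le> e / 2" if "n0 \<le> n" for n
      using close[of n0 n "e / 2"] n0[OF that] by (simp add: less_imp_le)
    then have "dist (sqnorm M (comb (f n) (-1) g)) 0 < e" if "n0 \<le> n" for n
      using that e sqnorm_nonneg[of M "comb (f n) (-1) g"] by (force simp: abs_of_nonneg)
    then show "\<forall>\<^sub>F n in sequentially. dist (sqnorm M (comb (f n) (-1) g)) 0 < e"
      by (rule eventually_sequentiallyI)
  qed
  have h: "L2 M (comb (f (N 0)) (-1) g)" using close[of "N 0" "N 0" 1] N[of 0 "N 0"] by (simp add: less_imp_le)
  have "comb (f (N 0)) (-1) (comb (f (N 0)) (-1) g) = g" unfolding comb_eq by simp
  with L2_comb[OF f h, of "N 0" "-1"] have "L2 M g" by simp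
  from that[OF this lim] show ?thesis .
qed

section \<open>Test fields\<close>

lemma continuous_on_vecI:
  fixes f :: "'a::topological_space \<Rightarrow> ('b::topological_space) ^ 'n"
  assumes "\<And>i. continuous_on A (\<lambda>x. f x $ i)"
  shows "continuous_on A f"
proof -
  have "continuous_on A (\<lambda>x. \<chi> i. f x $ i)" using assms by (intro continuous_on_vec_lambda)
  then show ?thesis by simp
qed

lemma test_field_smooth: "\<phi> \<in> test_fields W \<Longrightarrow> Ck_on k \<phi> UNIV"
  by (simp add: test_fields_def smooth_on_def)

lemma test_field_continuous: "\<phi> \<in> test_fields W \<Longrightarrow> continuous_on UNIV \<phi>"
  using test_field_smooth[of \<phi> W 0] by simp

lemma test_field_differentiable: "\<phi> \<in> test_fields W \<Longrightarrow> \<phi> differentiable (at x)"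
  using test_field_smooth[of \<phi> W "Suc 0"] by simp

lemma test_field_derivative_continuous:
  "\<phi> \<in> test_fields W \<Longrightarrow> b \<in> Basis \<Longrightarrow> continuous_on UNIV (\<lambda>x. frechet_derivative \<phi> (at x) b)"
  using test_field_smooth[of \<phi> W "Suc 0"] by simp

lemma classical_curl_components:
  "classical_curl \<phi> x $ 1 = frechet_derivative \<phi> (at x) (axis 2 1) $ 3 - frechet_derivative \<phi> (at x) (axis 3 1) $ 2"
  "classical_curl \<phi> x $ 2 = frechet_derivative \<phi> (at x) (axis 3 1) $ 1 - frechet_derivative \<phi> (at x) (axis 1 1) $ 3"
  "classical_curl \<phi> x $ 3 = frechet_derivative \<phi> (at x) (axis 1 1) $ 2 - frechet_derivative \<phi> (at x) (axis 2 1) $ 1"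
  by (simp_all add: classical_curl_def Let_def)

lemma classical_curl_continuous:
  assumes \<phi>: "\<phi> \<in> test_fields W"
  shows "continuous_on UNIV (classical_curl \<phi>)"
proof (rule continuous_on_vecI)
  fix i :: 3
  have c: "continuous_on UNIV (\<lambda>x. frechet_derivative \<phi> (at x) (axis j 1) $ k)" for j k
    by (intro continuous_on_component test_field_derivative_continuous[OF \<phi>]) (auto simp: axis_in_Basis_iff)
  show "continuous_on UNIV (\<lambda>x. classical_curl \<phi> x $ i)"
    using exhaust_3[of i] by (elim disjE) (auto simp: classical_curl_components intro!: continuous_on_diff c)
qed

lemma vcnj_nth: "vcnj u $ i = cnj (u $ i)"
  by (simp add: vcnj_def)

lemma bounded_linear_vcnj: "bounded_linear vcnj"
proof (rule bounded_linear_intro[where K=1])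
  show "vcnj (r *\<^sub>R u) = r *\<^sub>R vcnj u" for r u
    using vcnj_scale[of "of_real r" u] by (simp add: of_real_scale)
qed (simp_all add: vcnj_add)

lemma test_fields_vcnj:
  assumes \<phi>: "\<phi> \<in> test_fields W"
  shows "(\<lambda>x. vcnj (\<phi> x)) \<in> test_fields W"
  using \<phi> Ck_on_bounded_linear[OF bounded_linear_vcnj, of _ \<phi>]
  by (simp add: test_fields_def smooth_on_def)

lemma classical_curl_vcnj:
  assumes \<phi>: "\<phi> \<in> test_fields W"
  shows "classical_curl (\<lambda>x. vcnj (\<phi> x)) x = vcnj (classical_curl \<phi> x)"
proof -
  have d: "(\<phi> has_derivative frechet_derivative \<phi> (at x)) (at x)"
    using test_field_differentiable[OF \<phi>] by (simp add: frechet_derivative_works[symmetric])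
  have "frechet_derivative (\<lambda>x. vcnj (\<phi> x)) (at x) = (\<lambda>b. vcnj (frechet_derivative \<phi> (at x) b))"
    using frechet_derivative_at[OF bounded_linear.has_derivative[OF bounded_linear_vcnj d]] by simp
  then show ?thesis
    by (simp add: vec_eq_iff forall_3 classical_curl_components vcnj_nth)
qed

lemma bump_test_field:
  assumes "\<psi> \<in> bump_functions W"
  shows "(\<lambda>x. \<psi> x *\<^sub>R axis i 1) \<in> test_fields W"
proof -
  have "{x. \<psi> x *\<^sub>R (axis i 1 :: complex^3) \<noteq> 0} = {x. \<psi> x \<noteq> 0}" by (simp add: axis_eq_0_iff)
  then show ?thesis
    using assms Ck_on_scaleR[OF _ Ck_on_const, of _ \<psi>]
    by (auto simp: test_fields_def bump_functions_def smooth_on_def)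
qed

lemma measurable_restrict_completion:
  assumes "sets M = sets borel" "p \<in> borel_measurable borel"
  shows "p \<in> borel_measurable (restrict_space (completion M) A)"
proof -
  have "p \<in> borel_measurable M" using assms measurable_cong_sets by blast
  then show ?thesis by (intro measurable_restrict_space1 measurable_completion)
qed

text \<open>Test fields that are bump functions times a unit vector isolate the real and imaginary parts of
each component.\<close>

lemma AE_zero_if_orthogonal_test_fields:
  fixes f :: "real^3 \<Rightarrow> complex^3"
  assumes sets: "sets M = sets borel" and A: "A \<in> sets borel" "A \<subseteq> W" and W: "open W"
    and f: "integrable (restrict_space (completion M) A) f"
    and orth: "\<And>\<phi>. \<phi> \<in> test_fields W \<Longrightarrow> (LINT x|restrict_space (completion M) A. cdot (f x) (\<phi> x)) = 0"
  shows "AE x in restrict_space (completion M) A. f x = 0"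
proof -
  let ?M = "restrict_space (completion M) A"
  have zero: "(AE x in ?M. Re (f x $ i) = 0) \<and> (AE x in ?M. Im (f x $ i) = 0)" for i
  proof -
    have fi: "integrable ?M (\<lambda>x. f x $ i)"
      by (rule integrable_bounded_linear[OF bounded_linear_vec_nth f])
    have o: "(LINT x|?M. Re (f x $ i) * \<psi> x) = 0 \<and> (LINT x|?M. Im (f x $ i) * \<psi> x) = 0"
      if \<psi>: "\<psi> \<in> bump_functions W" for \<psi>
    proof -
      obtain K where K: "\<And>x. \<bar>\<psi> x\<bar> \<le> K" using bump_functions_bounded[OF \<psi>] by blast
      have m: "\<psi> \<in> borel_measurable ?M"
        using measurable_restrict_completion[OF sets bump_functions_measurable[OF \<psi>]] .
      have int: "integrable ?M (\<lambda>x. f x $ i * of_real (\<psi> x))"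
      proof (rule Bochner_Integration.integrable_bound[OF integrable_mult_right[OF fi, of "of_real K"]])
        show "AE x in ?M. norm (f x $ i * of_real (\<psi> x)) \<le> norm (of_real K * f x $ i)"
          by (intro AE_I2) (simp add: norm_mult mult.commute[of "norm (f _ $ i)"] mult_right_mono order_trans[OF K abs_ge_self])
        show "(\<lambda>x. f x $ i * of_real (\<psi> x)) \<in> borel_measurable ?M"
          using borel_measurable_integrable[OF fi] m by measurable
      qed
      have z: "(LINT x|?M. f x $ i * of_real (\<psi> x)) = 0"
        using orth[OF bump_test_field[OF \<psi>, of i]] by (simp add: cdot_scaleR_right cdot_axis mult.commute)
      show ?thesis using integral_Re[OF int] integral_Im[OF int] z by simp
    qed
    show ?thesis
      using AE_zero_if_orthogonal_bumps[OF sets A W integrable_Re[OF fi]]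
        AE_zero_if_orthogonal_bumps[OF sets A W integrable_Im[OF fi]] o by blast
  qed
  have "AE x in ?M. \<forall>i. Re (f x $ i) = 0 \<and> Im (f x $ i) = 0"
    using zero by (subst AE_all_countable) auto
  then show ?thesis by eventually_elim (simp add: vec_eq_iff complex_eq_iff)
qed

lemma integrable_if_L2:
  assumes "finite_measure M" "L2 M f"
  shows "integrable M f"
proof (rule Bochner_Integration.integrable_bound)
  show "integrable M (\<lambda>x. 1 + (norm (f x))\<^sup>2)"
    using finite_measure.integrable_const[OF assms(1), of "1::real"] L2_integrable[OF assms(2)] by auto
  show "AE x in M. norm (f x) \<le> norm (1 + (norm (f x))\<^sup>2)"
  proof (rule AE_I2)
    fix x
    have "0 \<le> (norm (f x) - 1)\<^sup>2 + (norm (f x))\<^sup>2 + 1" by simp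
    then have "norm (f x) \<le> 1 + (norm (f x))\<^sup>2" by (simp add: power2_diff)
    then show "norm (f x) \<le> norm (1 + (norm (f x))\<^sup>2)" by simp
  qed
qed (use assms L2_measurable in auto)

lemma coefficient_continuous:
  assumes p: "continuous_on UNIV p" "p \<in> borel_measurable M" and b: "bounded (space M)"
  shows "coefficient M p"
proof -
  have "compact (p ` closure (space M))"
    using b continuous_on_subset[OF p(1)] by (intro compact_continuous_image) auto
  then have "bounded (p ` closure (space M))" by (rule compact_imp_bounded)
  then obtain K where "\<forall>y\<in>p ` closure (space M). norm y \<le> K" unfolding bounded_iff by blast
  then show ?thesis using p(2) closure_subset by (intro coefficientI[of _ _ K]) auto
qed

lemma coefficient_indicator:
  fixes p :: "real^3 \<Rightarrow> complex^3"
  assumes p: "coefficient M p" and B: "B \<in> sets borel" and M: "(\<lambda>x. x) \<in> M \<rightarrow>\<^sub>M borel"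
  shows "coefficient M (\<lambda>x. indicator B x *\<^sub>R p x)"
proof -
  obtain K where K: "p \<in> borel_measurable M" "\<forall>x\<in>space M. norm (p x) \<le> K"
    using p by (auto simp: coefficient_def)
  have [measurable]: "(indicator B :: _ \<Rightarrow> real) \<in> borel_measurable M"
    using measurable_compose[OF M borel_measurable_indicator[OF B]] by simp
  note [measurable] = K(1)
  show ?thesis
  proof (rule coefficientI[where K="\<bar>K\<bar>"])
    fix x assume "x \<in> space M"
    then show "norm (indicator B x *\<^sub>R p x) \<le> \<bar>K\<bar>" using K(2) by (force split: split_indicator)
  qed measurable
qed

lemma coefficient_ccross:
  assumes p: "coefficient M p" and n: "n \<in> borel_measurable M" "\<And>x. norm (n x) \<le> 1"
  shows "coefficient M (\<lambda>x. ccross (p x) (cvec (n x)))"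
proof -
  obtain K where K: "p \<in> borel_measurable M" "\<forall>x\<in>space M. norm (p x) \<le> K"
    using p by (auto simp: coefficient_def)
  note [measurable] = K(1) n(1)
  show ?thesis
  proof (rule coefficientI[where K="6 * K"])
    fix x assume "x \<in> space M"
    then show "norm (ccross (p x) (cvec (n x))) \<le> 6 * K"
      using norm_ccross_cvec_le[OF n(2), of x "p x"] K(2) by (force simp: norm_ccross_swap)
  qed measurable
qed

lemma integral_restrict_space_Int:
  fixes F :: "'a \<Rightarrow> 'b::{banach, second_countable_topology}"
  assumes "A \<in> sets N" "B \<in> sets N"
  shows "integral\<^sup>L (restrict_space N (A \<inter> B)) F = integral\<^sup>L (restrict_space N A) (\<lambda>x. indicator B x *\<^sub>R F x)"
  using assms sets.sets_into_space[of A N] sets.sets_into_space[of B N]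
  by (simp add: integral_restrict_space indicator_inter_arith)

section \<open>Tangential fields\<close>

text \<open>Tangentiality as the vanishing of a bounded linear operator, so that it passes to \<open>L\<^sup>2\<close> limits.\<close>

definition tangential_defect :: "(real^3 \<Rightarrow> real^3) \<Rightarrow> (real^3 \<Rightarrow> complex^3) \<Rightarrow> real^3 \<Rightarrow> complex^3" where
  "tangential_defect n g x = ccross (ccross (cvec (n x)) (g x)) (cvec (n x)) - g x"

lemma L2_tangential_iff:
  "L2_tangential A n g \<longleftrightarrow> L2 (surface_on A) g \<and> (AE x in surface_on A. tangential_defect n g x = 0)"
  by (simp add: L2_tangential_def tangential_defect_def)

lemma tangential_defect_comb:
  "tangential_defect n (comb f t g) x = tangential_defect n f x + t *s tangential_defect n g x"
  by (simp add: tangential_defect_def comb_def ccross_add_right ccross_scale_right ccross_add_left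
      ccross_scale_left vector_ssub_ldistrib algebra_simps)

lemma norm_tangential_defect_le:
  assumes "norm (n x) \<le> 1"
  shows "norm (tangential_defect n g x) \<le> 37 * norm (g x)"
proof -
  have "norm (ccross (ccross (cvec (n x)) (g x)) (cvec (n x))) \<le> 6 * norm (ccross (cvec (n x)) (g x))"
    using norm_ccross_cvec_le[OF assms, of "ccross (cvec (n x)) (g x)"]
    by (simp add: norm_ccross_swap)
  then have "norm (ccross (ccross (cvec (n x)) (g x)) (cvec (n x))) \<le> 36 * norm (g x)"
    using norm_ccross_cvec_le[OF assms, of "g x"] by linarith
  then show ?thesis
    unfolding tangential_defect_def
    using norm_triangle_ineq4[of "ccross (ccross (cvec (n x)) (g x)) (cvec (n x))" "g x"] by linarith
qed

lemma L2_tangential_comb: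
  "L2_tangential A n f \<Longrightarrow> L2_tangential A n g \<Longrightarrow> L2_tangential A n (comb f t g)"
  unfolding L2_tangential_iff
  by (auto intro: L2_comb elim!: eventually_elim2 simp: tangential_defect_comb)

lemma L2_tangential_vcnj:
  assumes "L2_tangential A n g"
  shows "L2_tangential A n (\<lambda>x. vcnj (g x))"
proof -
  have "tangential_defect n (\<lambda>x. vcnj (g x)) x = vcnj (tangential_defect n g x)" for x
    by (simp add: tangential_defect_def vcnj_diff vcnj_ccross vcnj_cvec)
  then show ?thesis using assms by (simp add: L2_tangential_iff L2_vcnj)
qed

lemma L2_tangential_limit:
  assumes n: "n \<in> borel_measurable (surface_on A)" "\<And>x. norm (n x) \<le> 1"
    and f: "\<And>k. L2_tangential A n (f k)" and g: "L2 (surface_on A) g"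
    and lim: "(\<lambda>k. sqnorm (surface_on A) (comb (f k) (-1) g)) \<longlonglongrightarrow> 0"
  shows "L2_tangential A n g"
proof -
  let ?M = "surface_on A"
  note [measurable] = n(1)
  have L2d: "L2 ?M (tangential_defect n h)" if h: "L2 ?M h" for h
  proof (rule L2_bound[OF _ h h, of _ "37\<^sup>2" 0])
    have [measurable]: "h \<in> borel_measurable ?M" using h by (rule L2_measurable)
    show "tangential_defect n h \<in> borel_measurable ?M"
      unfolding tangential_defect_def[abs_def] by measurable
    show "(norm (tangential_defect n h x))\<^sup>2 \<le> 37\<^sup>2 * (norm (h x))\<^sup>2 + 0 * (norm (h x))\<^sup>2" for x
      using power_mono[OF norm_tangential_defect_le[where n = n and x = x and g = h, OF n(2)], of 2] by (simp add: power_mult_distrib)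
  qed
  have "sqnorm ?M (tangential_defect n g) \<le> 37\<^sup>2 * sqnorm ?M (comb (f k) (-1) g)" for k
  proof -
    let ?h = "comb (f k) (-1) g"
    have h: "L2 ?M ?h" using f[of k] g by (auto simp: L2_tangential_iff intro: L2_comb)
    have "AE x in ?M. tangential_defect n ?h x = (-1) *s tangential_defect n g x"
      using f[of k] unfolding L2_tangential_iff tangential_defect_comb by (auto elim: eventually_mono)
    then have "AE x in ?M. norm (tangential_defect n g x) = norm (tangential_defect n ?h x)"
      by eventually_elim (simp add: norm_scale)
    then have "sqnorm ?M (tangential_defect n g) = sqnorm ?M (tangential_defect n ?h)"
      unfolding sqnorm_def
      using L2_measurable[OF L2d[OF g]] L2_measurable[OF L2d[OF h]]
      by (intro integral_cong_AE) (auto elim: eventually_mono)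
    also have "\<dots> \<le> 37\<^sup>2 * sqnorm ?M ?h"
      using norm_tangential_defect_le[where n = n, OF n(2)] by (intro sqnorm_mono_bound L2d h)
    finally show ?thesis .
  qed
  then have "\<exists>N. \<forall>k\<ge>N. sqnorm ?M (tangential_defect n g) \<le> 37\<^sup>2 * sqnorm ?M (comb (f k) (-1) g)" by blast
  moreover have "(\<lambda>k. 37\<^sup>2 * sqnorm ?M (comb (f k) (-1) g)) \<longlonglongrightarrow> 37\<^sup>2 * 0"
    by (intro tendsto_intros lim)
  ultimately have "sqnorm ?M (tangential_defect n g) \<le> 37\<^sup>2 * 0"
    using LIMSEQ_le_const by blast
  then have "sqnorm ?M (tangential_defect n g) = 0"
    using sqnorm_nonneg[of ?M "tangential_defect n g"] by simp
  from sqnorm_eq_0_AE[OF L2d[OF g] this] g show ?thesis by (simp add: L2_tangential_iff)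
qed

lemma indicator_cdot:
  "indicator B x *\<^sub>R cdot u v = cdot u (indicator B x *\<^sub>R v)"
  unfolding cdot_scaleR_right by (rule scaleR_conv_of_real)

lemma surface_on_eq: "surface_on A = restrict_space (completion surface_base) A"
  by (simp add: surface_on_def surface_measure_eq)

lemma L2_ccross_cvec:
  assumes g: "L2 M g" and n: "n \<in> borel_measurable M" "\<And>x. norm (n x) \<le> 1"
  shows "L2 M (\<lambda>x. ccross (cvec (n x)) (g x))"
proof (rule L2_bound[OF _ g g, of _ "6\<^sup>2" 0])
  note [measurable] = n(1) L2_measurable[OF g]
  show "(\<lambda>x. ccross (cvec (n x)) (g x)) \<in> borel_measurable M" by measurable
  fix x
  have "(norm (ccross (cvec (n x)) (g x)))\<^sup>2 \<le> (6 * norm (g x))\<^sup>2"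
    by (intro power_mono norm_ccross_cvec_le n) auto
  then show "(norm (ccross (cvec (n x)) (g x)))\<^sup>2 \<le> 6\<^sup>2 * (norm (g x))\<^sup>2 + 0 * (norm (g x))\<^sup>2"
    by (simp add: power_mult_distrib)
qed

text \<open>A tangential \<open>g\<close> equals \<open>(n \<times> g) \<times> n\<close>. This covers the points where the normal is set to zero.\<close>

lemma tangential_zero:
  assumes "L2_tangential A n g" "AE x in surface_on A. ccross (cvec (n x)) (g x) = 0"
  shows "AE x in surface_on A. g x = 0"
  using assms unfolding L2_tangential_def by (auto elim!: eventually_elim2 simp: ccross_zero)

section \<open>Admissible quadruples\<close>

type_synonym cfield = "real^3 \<Rightarrow> complex^3"

text \<open>Weights for, in this order, the curl and the field in the cylinder, the trace on the layers and the
trace on the boundary.\<close>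

type_synonym weights = "cfield \<times> cfield \<times> cfield \<times> cfield"

locale layered_cylinder =
  fixes S :: "(real^2) set" and L d :: real
  assumes S: "open S" "bounded S" "smooth_boundary S" and d: "0 < d"
begin

abbreviation "\<Omega> \<equiv> cylinder S L"
abbreviation "Vol \<equiv> lebesgue_on \<Omega>"
abbreviation "Lay \<equiv> surface_on (layers S L d)"
abbreviation "Bdy \<equiv> surface_on (frontier \<Omega>)"
abbreviation "\<nu> \<equiv> outer_normal \<Omega>"

lemma open_\<Omega>: "open \<Omega>"
  using S open_cylinder by blast

lemma bounded_\<Omega>: "bounded \<Omega>"
proof -
  obtain R where R: "\<forall>y\<in>S. norm y \<le> R" using S(2) by (auto simp: bounded_iff)
  have "norm x \<le> R + R + \<bar>L\<bar>" if "x \<in> \<Omega>" for x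
  proof -
    have "norm (proj12 x) \<le> R" "\<bar>x $ 3\<bar> \<le> \<bar>L\<bar>" using R that by (auto simp: cylinder_def)
    then show ?thesis
      using component_le_norm_cart[of "proj12 x" 1] component_le_norm_cart[of "proj12 x" 2] norm_le_components[of x]
      by (simp add: proj12_components)
  qed
  then show ?thesis by (auto simp: bounded_iff)
qed

lemma layers_subset: "layers S L d \<subseteq> \<Omega>"
  using d by (auto simp: layers_def layer_def layer_index_def cylinder_def)

lemma layer_subset_layers: "k \<in> layer_index L d \<Longrightarrow> layer S d k \<subseteq> layers S L d"
  by (auto simp: layers_def)

lemma surfaces_borel: "layers S L d \<in> sets borel" "layer S d k \<in> sets borel" "frontier \<Omega> \<in> sets borel"
  using S layers_borel layer_borel by (auto intro: borel_closed)

lemma finite_measures: "finite_measure Vol" "finite_measure Lay" "finite_measure Bdy"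
proof -
  show "finite_measure Vol"
  proof (rule finite_measureI)
    have "emeasure lebesgue \<Omega> = emeasure lborel \<Omega>" using open_\<Omega> by simp
    also have "\<dots> < \<infinity>" using bounded_\<Omega> by (rule emeasure_bounded_finite)
    finally show "emeasure Vol (space Vol) \<noteq> \<infinity>"
      using open_\<Omega> by (simp add: emeasure_restrict_space space_restrict_space)
  qed
  have sp: "space surface_measure = UNIV"
    by (simp add: surface_measure_eq sets_eq_imp_space_eq[OF sets_surface_base])
  have fin: "finite_measure (surface_on A)" if "A \<in> sets borel" "emeasure surface_measure A < \<infinity>" for A
    using that borel_sets_surface_measure[OF that(1)] sp
    by (intro finite_measureI) (simp add: surface_on_def emeasure_restrict_space space_restrict_space)
  show "finite_measure Lay" using finite_surface_layers[OF S(1,2) d] surfaces_borel by (intro fin)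
  show "finite_measure Bdy" using finite_surface_frontier_cylinder[OF S] surfaces_borel by (intro fin)
qed

lemma bounded_spaces: "bounded (space Vol)" "bounded (space Lay)" "bounded (space Bdy)"
proof -
  have "space (surface_on A) \<subseteq> A" for A by (auto simp: surface_on_def space_restrict_space)
  then show "bounded (space Lay)" "bounded (space Bdy)"
    using bounded_subset[OF bounded_\<Omega> order_trans[OF _ layers_subset]]
      bounded_subset[OF compact_imp_bounded[OF compact_frontier_bounded[OF bounded_\<Omega>]]] by blast+
  show "bounded (space Vol)" using bounded_\<Omega> by (simp add: space_restrict_space)
qed

lemma measurable_spaces:
  fixes p :: "real^3 \<Rightarrow> 'b::topological_space"
  assumes "p \<in> borel_measurable borel"
  shows "p \<in> borel_measurable Vol" "p \<in> borel_measurable (surface_on A)"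
  unfolding surface_on_def surface_measure_eq
  by (rule measurable_restrict_completion[OF sets_lborel assms] measurable_restrict_completion[OF sets_surface_base assms])+

lemma id_measurable: "(\<lambda>x. x) \<in> Vol \<rightarrow>\<^sub>M borel" "(\<lambda>x. x) \<in> surface_on A \<rightarrow>\<^sub>M borel"
  by (rule measurable_spaces; simp)+

lemma test_coefficients:
  assumes \<phi>: "\<phi> \<in> test_fields W"
  shows "coefficient Vol \<phi>" "coefficient Vol (classical_curl \<phi>)" "coefficient Lay \<phi>" "coefficient Bdy \<phi>"
  using test_field_continuous[OF \<phi>] classical_curl_continuous[OF \<phi>] bounded_spaces
  by (auto intro!: coefficient_continuous measurable_spaces borel_measurable_continuous_onI)

lemma normal_bounds:
  "\<nu> \<in> borel_measurable Bdy" "norm (\<nu> x) \<le> 1"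
  "(\<lambda>_. axis 3 1 :: real^3) \<in> borel_measurable Lay" "norm (axis 3 1 :: real^3) \<le> 1"
  using borel_measurable_outer_normal[OF open_\<Omega>] norm_outer_normal_le_1[OF open_\<Omega>]
  by (auto intro: measurable_spaces)

text \<open>Each of the three functions turns a test field into the weights of one defining equation: of the
weak curl, of the boundary trace and of the trace on one layer. Indicator functions rewrite
integrals over the part below a layer, and over that layer, as integrals over the whole cylinder
and over all layers.\<close>

definition curl_test :: "cfield \<Rightarrow> weights" where
  "curl_test \<phi> = (\<phi>, classical_curl \<phi>, \<lambda>x. 0, \<lambda>x. 0)"

definition bdry_test :: "cfield \<Rightarrow> weights" where
  "bdry_test \<phi> = (\<phi>, classical_curl \<phi>, \<lambda>x. 0, \<lambda>x. ccross (\<phi> x) (cvec (\<nu> x)))"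

definition layer_test :: "int \<Rightarrow> cfield \<Rightarrow> weights" where
  "layer_test k \<phi> =
     (\<lambda>x. indicator {x. x $ 3 < of_int k * d} x *\<^sub>R \<phi> x,
      \<lambda>x. indicator {x. x $ 3 < of_int k * d} x *\<^sub>R classical_curl \<phi> x,
      \<lambda>x. indicator (layer S d k) x *\<^sub>R ccross (\<phi> x) (cvec (axis 3 1)), \<lambda>x. 0)"

definition tests :: "weights set" where
  "tests = curl_test ` test_fields \<Omega> \<union> bdry_test ` test_fields UNIV
     \<union> (\<Union>k\<in>layer_index L d. layer_test k ` test_fields \<Omega>)"

lemma tests_cases:
  assumes "\<tau> \<in> tests"
  obtains \<phi> where "\<phi> \<in> test_fields \<Omega>" "\<tau> = curl_test \<phi>"
    | \<phi> where "\<phi> \<in> test_fields UNIV" "\<tau> = bdry_test \<phi>"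
    | k \<phi> where "k \<in> layer_index L d" "\<phi> \<in> test_fields \<Omega>" "\<tau> = layer_test k \<phi>"
  using assms by (auto simp: tests_def)

lemma tests_intros:
  "\<phi> \<in> test_fields \<Omega> \<Longrightarrow> curl_test \<phi> \<in> tests"
  "\<phi> \<in> test_fields UNIV \<Longrightarrow> bdry_test \<phi> \<in> tests"
  "k \<in> layer_index L d \<Longrightarrow> \<phi> \<in> test_fields \<Omega> \<Longrightarrow> layer_test k \<phi> \<in> tests"
  by (auto simp: tests_def)

definition balanced :: "cfield \<Rightarrow> cfield \<Rightarrow> cfield \<Rightarrow> cfield \<Rightarrow> weights \<Rightarrow> bool" where
  "balanced u w g h = (\<lambda>(p, q, r, s).
     (LINT x|Vol. cdot (w x) (p x)) - (LINT x|Vol. cdot (u x) (q x))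
     = (LINT x|Lay. cdot (g x) (r x)) + (LINT x|Bdy. cdot (h x) (s x)))"

text \<open>The intended reading is that \<open>w\<close> is the curl of \<open>u\<close>, \<open>g\<close> its trace on the layers and \<open>h\<close> its trace on
the boundary.\<close>

definition admissible :: "cfield \<Rightarrow> cfield \<Rightarrow> cfield \<Rightarrow> cfield \<Rightarrow> bool" where
  "admissible u w g h \<longleftrightarrow> L2 Vol u \<and> L2 Vol w \<and>
     L2_tangential (layers S L d) (\<lambda>_. axis 3 1) g \<and> L2_tangential (frontier \<Omega>) \<nu> h \<and>
     (\<forall>\<tau>\<in>tests. balanced u w g h \<tau>)"

lemma admissibleD:
  assumes "admissible u w g h"
  shows "L2 Vol u" "L2 Vol w" "L2 Lay g" "L2 Bdy h"
  using assms by (auto simp: admissible_def L2_tangential_def)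

lemma half_space_borel: "{x :: real^3. x $ 3 < t} \<in> sets borel"
  by measurable

lemma tests_coefficient:
  assumes "(p, q, r, s) \<in> tests"
  shows "coefficient Vol p" "coefficient Vol q" "coefficient Lay r" "coefficient Bdy s"
  using assms
  by (auto elim!: tests_cases simp: curl_test_def bdry_test_def layer_test_def
      intro!: coefficient_const coefficient_indicator coefficient_ccross normal_bounds
      half_space_borel surfaces_borel id_measurable dest: test_coefficients)

lemma tests_L2:
  assumes "(p, q, r, s) \<in> tests"
  shows "L2 Vol p" "L2 Vol q" "L2 Lay r" "L2 Bdy s"
  using tests_coefficient[OF assms] finite_measures by (auto intro: coefficient_L2)

lemma tests_vcnj:
  assumes "(p, q, r, s) \<in> tests"
  shows "(\<lambda>x. vcnj (p x), \<lambda>x. vcnj (q x), \<lambda>x. vcnj (r x), \<lambda>x. vcnj (s x)) \<in> tests"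
proof -
  have i: "vcnj (indicator B x *\<^sub>R u) = indicator B x *\<^sub>R vcnj u" for B u and x :: "real^3"
    by (auto split: split_indicator)
  define conj :: "weights \<Rightarrow> weights" where "conj = (\<lambda>(p, q, r, s).
    (\<lambda>x. vcnj (p x), \<lambda>x. vcnj (q x), \<lambda>x. vcnj (r x), \<lambda>x. vcnj (s x)))"
  have eq: "conj (curl_test \<phi>) = curl_test (\<lambda>x. vcnj (\<phi> x))" "conj (bdry_test \<phi>) = bdry_test (\<lambda>x. vcnj (\<phi> x))"
    "conj (layer_test k \<phi>) = layer_test k (\<lambda>x. vcnj (\<phi> x))" if "\<phi> \<in> test_fields W" for \<phi> W k
    using classical_curl_vcnj[OF that]
    by (simp_all add: conj_def curl_test_def bdry_test_def layer_test_def fun_eq_iff i vcnj_ccross vcnj_cvec)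
  from assms have "conj (p, q, r, s) \<in> tests"
    by (cases rule: tests_cases) (simp_all add: eq tests_intros test_fields_vcnj)
  then show ?thesis by (simp add: conj_def)
qed

lemma admissible_comb:
  assumes 1: "admissible u w g h" and 2: "admissible u' w' g' h'"
  shows "admissible (comb u t u') (comb w t w') (comb g t g') (comb h t h')"
proof -
  have i: "(LINT x|M. cdot (comb f t f' x) (p x)) = (LINT x|M. cdot (f x) (p x)) + t * (LINT x|M. cdot (f' x) (p x))"
    if "L2 M f" "L2 M f'" "L2 M p" for M f f' p
    using integrable_cdot[OF that(1,3)] integrable_cdot[OF that(2,3)]
    by (simp add: comb_def cdot_add_left cdot_scale_left)
  have "balanced (comb u t u') (comb w t w') (comb g t g') (comb h t h') \<tau>" if "\<tau> \<in> tests" for \<tau>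
  proof (cases \<tau>)
    case (fields p q r s)
    note \<tau> = that[unfolded fields]
    have "balanced u w g h (p, q, r, s)" "balanced u' w' g' h' (p, q, r, s)"
      using 1 2 \<tau> by (auto simp: admissible_def)
    then show ?thesis
      unfolding fields balanced_def
      by (simp add: i admissibleD[OF 1] admissibleD[OF 2] tests_L2[OF \<tau>] algebra_simps)
  qed
  then show ?thesis using 1 2 by (auto simp: admissible_def L2_comb L2_tangential_comb)
qed

text \<open>Conjugation moves to the weights, and the set of weights is closed under it since normals are real.\<close>

lemma admissible_vcnj:
  assumes 1: "admissible u w g h"
  shows "admissible (\<lambda>x. vcnj (u x)) (\<lambda>x. vcnj (w x)) (\<lambda>x. vcnj (g x)) (\<lambda>x. vcnj (h x))"
proof -
  have i: "(LINT x|M. cdot (vcnj (f x)) (p x)) = cnj (LINT x|M. cdot (f x) (vcnj (p x)))" for M f p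
  proof -
    have "(LINT x|M. cdot (vcnj (f x)) (p x)) = (LINT x|M. cnj (cdot (f x) (vcnj (p x))))" by (simp add: cnj_cdot)
    then show ?thesis by simp
  qed
  have "balanced (\<lambda>x. vcnj (u x)) (\<lambda>x. vcnj (w x)) (\<lambda>x. vcnj (g x)) (\<lambda>x. vcnj (h x)) \<tau>" if "\<tau> \<in> tests" for \<tau>
  proof (cases \<tau>)
    case (fields p q r s)
    have "balanced u w g h (\<lambda>x. vcnj (p x), \<lambda>x. vcnj (q x), \<lambda>x. vcnj (r x), \<lambda>x. vcnj (s x))"
      using 1 tests_vcnj[OF that[unfolded fields]] by (auto simp: admissible_def)
    then show ?thesis
      unfolding fields balanced_def i by (simp flip: complex_cnj_diff complex_cnj_add)
  qed
  then show ?thesis using 1 by (auto simp: admissible_def L2_vcnj L2_tangential_vcnj)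
qed

text \<open>Each equation is a relation between integrals against fixed square integrable weights, and such
integrals are continuous in \<open>L\<^sup>2\<close>.\<close>

lemma admissible_limit:
  assumes n: "\<And>n. admissible (u n) (w n) (g n) (h n)"
    and L2: "L2 Vol u'" "L2 Vol w'" "L2 Lay g'" "L2 Bdy h'"
    and lim: "(\<lambda>n. sqnorm Vol (comb (u n) (-1) u')) \<longlonglongrightarrow> 0" "(\<lambda>n. sqnorm Vol (comb (w n) (-1) w')) \<longlonglongrightarrow> 0"
      "(\<lambda>n. sqnorm Lay (comb (g n) (-1) g')) \<longlonglongrightarrow> 0" "(\<lambda>n. sqnorm Bdy (comb (h n) (-1) h')) \<longlonglongrightarrow> 0"
  shows "admissible u' w' g' h'"
proof -
  have tangential: "L2_tangential (layers S L d) (\<lambda>_. axis 3 1) (g n)" "L2_tangential (frontier \<Omega>) \<nu> (h n)" for n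
    using n[of n] by (simp_all add: admissible_def)
  show ?thesis
    unfolding admissible_def
  proof (intro conjI ballI L2)
  show "L2_tangential (layers S L d) (\<lambda>_. axis 3 1) g'"
    by (rule L2_tangential_limit[OF normal_bounds(3,4) tangential(1) L2(3) lim(3)])
  show "L2_tangential (frontier \<Omega>) \<nu> h'"
    by (rule L2_tangential_limit[OF normal_bounds(1,2) tangential(2) L2(4) lim(4)])
  fix \<tau> assume \<tau>: "\<tau> \<in> tests"
  show "balanced u' w' g' h' \<tau>"
  proof (cases \<tau>)
    case (fields p q r s)
    note \<tau>' = tests_L2[OF \<tau>[unfolded fields]]
    note D = n[THEN admissibleD(1)] n[THEN admissibleD(2)] n[THEN admissibleD(3)] n[THEN admissibleD(4)]
    have "(\<lambda>n. (LINT x|Vol. cdot (w n x) (p x)) - (LINT x|Vol. cdot (u n x) (q x)))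
        \<longlonglongrightarrow> (LINT x|Vol. cdot (w' x) (p x)) - (LINT x|Vol. cdot (u' x) (q x))"
      by (intro tendsto_diff tendsto_integral_cdot D L2 \<tau>' lim)
    moreover have "(LINT x|Vol. cdot (w n x) (p x)) - (LINT x|Vol. cdot (u n x) (q x))
       = (LINT x|Lay. cdot (g n x) (r x)) + (LINT x|Bdy. cdot (h n x) (s x))" for n
      using n[of n] \<tau> fields by (auto simp: admissible_def balanced_def)
    moreover have "(\<lambda>n. (LINT x|Lay. cdot (g n x) (r x)) + (LINT x|Bdy. cdot (h n x) (s x)))
        \<longlonglongrightarrow> (LINT x|Lay. cdot (g' x) (r x)) + (LINT x|Bdy. cdot (h' x) (s x))"
      by (intro tendsto_add tendsto_integral_cdot D L2 \<tau>' lim)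
    ultimately have "(LINT x|Vol. cdot (w' x) (p x)) - (LINT x|Vol. cdot (u' x) (q x))
       = (LINT x|Lay. cdot (g' x) (r x)) + (LINT x|Bdy. cdot (h' x) (s x))"
      by (simp add: LIMSEQ_unique)
    then show ?thesis unfolding fields balanced_def by simp
  qed
qed
qed

lemma admissible_cong_AE:
  assumes 1: "admissible u w g h" and w': "w' \<in> borel_measurable Vol" "AE x in Vol. w x = w' x"
  shows "admissible u w' g h"
proof -
  have L2w': "L2 Vol w'" using L2_cong_AE[OF admissibleD(2)[OF 1] w'] .
  have "balanced u w' g h \<tau>" if "\<tau> \<in> tests" for \<tau>
  proof (cases \<tau>)
    case (fields p q r s)
    have "(LINT x|Vol. cdot (w' x) (p x)) = (LINT x|Vol. cdot (w x) (p x))"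
    proof (rule integral_cong_AE)
      show "AE x in Vol. cdot (w' x) (p x) = cdot (w x) (p x)" using w'(2) by eventually_elim simp
      note [measurable] = tests_L2(1)[OF that[unfolded fields], THEN L2_measurable] w'(1) admissibleD(2)[OF 1, THEN L2_measurable]
      show "(\<lambda>x. cdot (w' x) (p x)) \<in> borel_measurable Vol" "(\<lambda>x. cdot (w x) (p x)) \<in> borel_measurable Vol"
        by measurable
    qed
    moreover have "balanced u w g h (p, q, r, s)" using 1 that fields by (auto simp: admissible_def)
    ultimately show ?thesis unfolding fields balanced_def by simp
  qed
  then show ?thesis using 1 L2w' by (simp add: admissible_def)
qed

section \<open>The space of fields with square integrable curl and traces\<close>

lemma curl_balanced_iff:
  assumes "L2 Vol u" "L2 Vol w"
  shows "(\<forall>\<phi>\<in>test_fields \<Omega>. balanced u w g h (curl_test \<phi>)) \<longleftrightarrow> is_weak_curl \<Omega> u w"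
  using assms by (simp add: curl_test_def balanced_def is_weak_curl_def cdot_zero)

lemma bdry_balanced_iff:
  assumes "L2 Vol u" "L2 Vol w"
  shows "(\<forall>\<phi>\<in>test_fields UNIV. balanced u w g h (bdry_test \<phi>))
    \<longleftrightarrow> trace_identity \<Omega> w (frontier \<Omega>) \<nu> (test_fields UNIV) u h"
proof -
  have "balanced u w g h (bdry_test \<phi>) \<longleftrightarrow>
      (LINT x|Vol. cdot (w x) (\<phi> x) - cdot (u x) (classical_curl \<phi> x))
        = (LINT x|Bdy. cdot (ccross (cvec (\<nu> x)) (h x)) (\<phi> x))"
    if \<phi>: "\<phi> \<in> test_fields UNIV" for \<phi>
    using integrable_cdot[OF assms(2) coefficient_L2[OF finite_measures(1) test_coefficients(1)[OF \<phi>]]]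
      integrable_cdot[OF assms(1) coefficient_L2[OF finite_measures(1) test_coefficients(2)[OF \<phi>]]]
    by (simp add: balanced_def bdry_test_def cdot_zero cdot_ccross)
  then show ?thesis by (simp add: trace_identity_def)
qed

lemma layer_balanced_iff:
  assumes "L2 Vol u" "L2 Vol w" and k: "k \<in> layer_index L d"
  shows "(\<forall>\<phi>\<in>test_fields \<Omega>. balanced u w g h (layer_test k \<phi>))
    \<longleftrightarrow> trace_identity (\<Omega> \<inter> {x. x $ 3 < of_int k * d}) w (layer S d k) (\<lambda>_. axis 3 1) (test_fields \<Omega>) u g"
proof -
  let ?H = "{x :: real^3. x $ 3 < of_int k * d}"
  have H: "\<Omega> \<in> sets lebesgue" "?H \<in> sets lebesgue"
    using open_\<Omega> half_space_borel[of "of_int k * d"] by auto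
  have Lk: "layers S L d \<in> sets surface_measure" "layer S d k \<in> sets surface_measure"
    using surfaces_borel borel_sets_surface_measure by auto
  have lay: "layers S L d \<inter> layer S d k = layer S d k" using layer_subset_layers[OF k] by blast
  have "balanced u w g h (layer_test k \<phi>) \<longleftrightarrow>
      (LINT x|lebesgue_on (\<Omega> \<inter> ?H). cdot (w x) (\<phi> x) - cdot (u x) (classical_curl \<phi> x))
        = (LINT x|surface_on (layer S d k). cdot (ccross (cvec (axis 3 1)) (g x)) (\<phi> x))"
    if \<phi>: "\<phi> \<in> test_fields \<Omega>" for \<phi>
  proof -
    have c: "coefficient Vol (\<lambda>x. indicator ?H x *\<^sub>R \<phi> x)" "coefficient Vol (\<lambda>x. indicator ?H x *\<^sub>R classical_curl \<phi> x)"
      using test_coefficients[OF \<phi>] by (auto intro!: coefficient_indicator half_space_borel id_measurable)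
    have "(LINT x|lebesgue_on (\<Omega> \<inter> ?H). cdot (w x) (\<phi> x) - cdot (u x) (classical_curl \<phi> x))
       = (LINT x|Vol. cdot (w x) (indicator ?H x *\<^sub>R \<phi> x) - cdot (u x) (indicator ?H x *\<^sub>R classical_curl \<phi> x))"
      unfolding integral_restrict_space_Int[OF H] scaleR_diff_right indicator_cdot ..
    also have "\<dots> = (LINT x|Vol. cdot (w x) (indicator ?H x *\<^sub>R \<phi> x)) - (LINT x|Vol. cdot (u x) (indicator ?H x *\<^sub>R classical_curl \<phi> x))"
      by (intro Bochner_Integration.integral_diff integrable_cdot assms coefficient_L2 finite_measures c)
    finally have 1: "(LINT x|lebesgue_on (\<Omega> \<inter> ?H). cdot (w x) (\<phi> x) - cdot (u x) (classical_curl \<phi> x)) = \<dots>" .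
    have "(LINT x|surface_on (layer S d k). cdot (g x) (ccross (\<phi> x) (cvec (axis 3 1))))
       = (LINT x|Lay. cdot (g x) (indicator (layer S d k) x *\<^sub>R ccross (\<phi> x) (cvec (axis 3 1))))"
      using integral_restrict_space_Int[OF Lk, of "\<lambda>x. cdot (g x) (ccross (\<phi> x) (cvec (axis 3 1)))"]
      unfolding lay indicator_cdot surface_on_def .
    then have 2: "(LINT x|surface_on (layer S d k). cdot (ccross (cvec (axis 3 1)) (g x)) (\<phi> x)) = \<dots>"
      by (simp only: cdot_ccross)
    show ?thesis unfolding 1 2 balanced_def layer_test_def by (simp add: cdot_zero)
  qed
  then show ?thesis unfolding trace_identity_def by (simp only: ball_simps cong: ball_cong)
qed

text \<open>The link between the equations with weights and the definitions of weak curl and weak traces.\<close>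

lemma admissible_iff:
  "admissible u w g h \<longleftrightarrow> L2 Vol u \<and> is_weak_curl \<Omega> u w \<and>
     (L2_tangential (layers S L d) (\<lambda>_. axis 3 1) g \<and> (\<forall>k\<in>layer_index L d.
        trace_identity (\<Omega> \<inter> {x. x $ 3 < of_int k * d}) w (layer S d k) (\<lambda>_. axis 3 1) (test_fields \<Omega>) u g)) \<and>
     (L2_tangential (frontier \<Omega>) \<nu> h \<and> trace_identity \<Omega> w (frontier \<Omega>) \<nu> (test_fields UNIV) u h)"
proof (cases "L2 Vol u \<and> L2 Vol w")
  case True
  then have T: "L2 Vol u" "L2 Vol w" by auto
  have "(\<forall>\<tau>\<in>tests. balanced u w g h \<tau>) \<longleftrightarrow> (\<forall>\<phi>\<in>test_fields \<Omega>. balanced u w g h (curl_test \<phi>))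
      \<and> (\<forall>\<phi>\<in>test_fields UNIV. balanced u w g h (bdry_test \<phi>))
      \<and> (\<forall>k\<in>layer_index L d. \<forall>\<phi>\<in>test_fields \<Omega>. balanced u w g h (layer_test k \<phi>))"
    unfolding tests_def by blast
  also have "\<dots> \<longleftrightarrow> is_weak_curl \<Omega> u w \<and> trace_identity \<Omega> w (frontier \<Omega>) \<nu> (test_fields UNIV) u h \<and>
     (\<forall>k\<in>layer_index L d.
        trace_identity (\<Omega> \<inter> {x. x $ 3 < of_int k * d}) w (layer S d k) (\<lambda>_. axis 3 1) (test_fields \<Omega>) u g)"
    using curl_balanced_iff[OF T] bdry_balanced_iff[OF T] layer_balanced_iff[OF T] by simp
  finally show ?thesis using T unfolding admissible_def by blast
next
  case False
  then show ?thesis unfolding admissible_def is_weak_curl_def by blast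
qed

lemma AE_zero_Vol:
  assumes "L2 Vol w" "\<And>\<phi>. \<phi> \<in> test_fields \<Omega> \<Longrightarrow> (LINT x|Vol. cdot (w x) (\<phi> x)) = 0"
  shows "AE x in Vol. w x = 0"
  by (rule AE_zero_if_orthogonal_test_fields[OF sets_lborel _ subset_refl open_\<Omega>])
     (use open_\<Omega> assms finite_measures integrable_if_L2 in auto)

lemma AE_zero_surface:
  assumes A: "A \<in> sets borel" "A \<subseteq> W" and W: "open W" and "finite_measure (surface_on A)" "L2 (surface_on A) w"
    and "\<And>\<phi>. \<phi> \<in> test_fields W \<Longrightarrow> (LINT x|surface_on A. cdot (w x) (\<phi> x)) = 0"
  shows "AE x in surface_on A. w x = 0"
  unfolding surface_on_eq
  by (rule AE_zero_if_orthogonal_test_fields[OF sets_surface_base A W])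
     (use assms(4-) integrable_if_L2 in \<open>auto simp: surface_on_eq\<close>)

text \<open>Test fields supported in the cylinder determine the curl. Once field and curl vanish, Green's formula
says that \<open>\<nu> \<times> h\<close>, and on each layer \<open>e\<^sub>3 \<times> g\<close>, is orthogonal to all test fields.\<close>

lemma admissible_zero:
  assumes adm: "admissible z w g h" and z: "AE x in Vol. z x = 0"
  shows "AE x in Vol. w x = 0" "AE x in Lay. g x = 0" "AE x in Bdy. h x = 0"
proof -
  note D = admissibleD[OF adm]
  have int0: "(LINT x|Vol. cdot (f x) (p x)) = 0"
    if "L2 Vol f" "AE x in Vol. f x = 0" "L2 Vol p" for f p
  proof -
    note [measurable] = that(1,3)[THEN L2_measurable]
    have "(LINT x|Vol. cdot (f x) (p x)) = (LINT x|Vol. 0)"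
    proof (rule integral_cong_AE)
      show "AE x in Vol. cdot (f x) (p x) = 0" using that(2) by eventually_elim (simp add: cdot_zero)
    qed measurable
    then show ?thesis by simp
  qed
  have bal: "(LINT x|Vol. cdot (w x) (p x)) = (LINT x|Lay. cdot (g x) (r x)) + (LINT x|Bdy. cdot (h x) (s x))"
    if "(p, q, r, s) \<in> tests" for p q r s
  proof -
    have "balanced z w g h (p, q, r, s)" using adm that by (auto simp: admissible_def)
    then show ?thesis using int0[OF D(1) z tests_L2(2)[OF that]] by (simp add: balanced_def)
  qed
  show w: "AE x in Vol. w x = 0"
  proof (rule AE_zero_Vol[OF D(2)])
    fix \<phi> assume "\<phi> \<in> test_fields \<Omega>"
    from bal[OF tests_intros(1)[OF this, unfolded curl_test_def]] show "(LINT x|Vol. cdot (w x) (\<phi> x)) = 0" by (simp add: cdot_zero)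
  qed
  have bal0: "(LINT x|Lay. cdot (g x) (r x)) + (LINT x|Bdy. cdot (h x) (s x)) = 0"
    if "(p, q, r, s) \<in> tests" for p q r s
    using bal[OF that] int0[OF D(2) w tests_L2(1)[OF that]] by simp
  show "AE x in Bdy. h x = 0"
  proof (rule tangential_zero)
    show "L2_tangential (frontier \<Omega>) \<nu> h" using adm by (simp add: admissible_def)
    show "AE x in Bdy. ccross (cvec (\<nu> x)) (h x) = 0"
    proof (rule AE_zero_surface[OF surfaces_borel(3) subset_UNIV open_UNIV finite_measures(3)])
      show "L2 Bdy (\<lambda>x. ccross (cvec (\<nu> x)) (h x))"
        using D(4) normal_bounds(1,2) by (rule L2_ccross_cvec)
      fix \<phi> :: cfield assume "\<phi> \<in> test_fields UNIV"
      from bal0[OF tests_intros(2)[OF this, unfolded bdry_test_def]] show "(LINT x|Bdy. cdot (ccross (cvec (\<nu> x)) (h x)) (\<phi> x)) = 0"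
        by (simp add: cdot_zero cdot_ccross)
    qed
  qed
  show "AE x in Lay. g x = 0"
  proof (rule tangential_zero)
    show "L2_tangential (layers S L d) (\<lambda>_. axis 3 1) g" using adm by (simp add: admissible_def)
    let ?c = "\<lambda>x. ccross (cvec (axis 3 1)) (g x)"
    have c: "L2 Lay ?c" using D(3) normal_bounds(3,4) by (rule L2_ccross_cvec)
    have "AE x in Lay. indicator (layer S d k) x *\<^sub>R ?c x = 0" if k: "k \<in> layer_index L d" for k
    proof (rule AE_zero_surface[OF surfaces_borel(1) layers_subset open_\<Omega> finite_measures(2)])
      have [measurable]: "(indicator (layer S d k) :: _ \<Rightarrow> real) \<in> borel_measurable Lay"
        using measurable_spaces(2)[OF borel_measurable_indicator[OF surfaces_borel(2)]] .
      note [measurable] = L2_measurable[OF c]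
      show "L2 Lay (\<lambda>x. indicator (layer S d k) x *\<^sub>R ?c x)"
        by (rule L2_bound[OF _ c c, of _ 1 0]) (measurable, auto split: split_indicator)
      fix \<phi> :: cfield assume "\<phi> \<in> test_fields \<Omega>"
      from bal0[OF tests_intros(3)[OF k this, unfolded layer_test_def]]
      have "(LINT x|Lay. cdot (g x) (indicator (layer S d k) x *\<^sub>R ccross (\<phi> x) (cvec (axis 3 1)))) = 0"
        by (simp add: cdot_zero)
      moreover have "cdot (indicator (layer S d k) x *\<^sub>R ?c x) (\<phi> x)
          = cdot (g x) (indicator (layer S d k) x *\<^sub>R ccross (\<phi> x) (cvec (axis 3 1)))" for x
        by (auto split: split_indicator simp: cdot_zero cdot_ccross)
      ultimately show "(LINT x|Lay. cdot (indicator (layer S d k) x *\<^sub>R ?c x) (\<phi> x)) = 0" by simp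
    qed
    then have "AE x in Lay. \<forall>k\<in>layer_index L d. indicator (layer S d k) x *\<^sub>R ?c x = 0"
      by (intro AE_ball_countable') auto
    moreover have "AE x in Lay. x \<in> layers S L d"
      by (rule AE_I2) (auto simp: surface_on_def space_restrict_space)
    ultimately show "AE x in Lay. ?c x = 0"
      by eventually_elim (fastforce simp: layers_def split: split_indicator)
  qed
qed

lemma admissible_unique:
  assumes 1: "admissible u w g h" and 2: "admissible u' w' g' h'" and u: "AE x in Vol. u x = u' x"
  shows "AE x in Vol. w x = w' x" "AE x in Lay. g x = g' x" "AE x in Bdy. h x = h' x"
proof -
  have "AE x in Vol. comb u (-1) u' x = 0" using u by eventually_elim (simp add: comb_def)
  note z = admissible_zero[OF admissible_comb[OF 1 2] this]
  show "AE x in Vol. w x = w' x" using z(1) by eventually_elim (simp add: comb_def)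
  show "AE x in Lay. g x = g' x" using z(2) by eventually_elim (simp add: comb_def)
  show "AE x in Bdy. h x = h' x" using z(3) by eventually_elim (simp add: comb_def)
qed

lemma weak_curl_unique:
  assumes "is_weak_curl \<Omega> u w" "is_weak_curl \<Omega> u w'"
  shows "AE x in Vol. w x = w' x"
proof -
  have L2: "L2 Vol w" "L2 Vol w'" using assms by (auto simp: is_weak_curl_def)
  have "AE x in Vol. comb w (-1) w' x = 0"
  proof (rule AE_zero_Vol[OF L2_comb[OF L2]])
    fix \<phi> assume \<phi>: "\<phi> \<in> test_fields \<Omega>"
    have p: "L2 Vol \<phi>" by (intro coefficient_L2 finite_measures test_coefficients[OF \<phi>])
    have "(LINT x|Vol. cdot (w x) (\<phi> x)) = (LINT x|Vol. cdot (w' x) (\<phi> x))"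
      using assms \<phi> by (auto simp: is_weak_curl_def)
    then show "(LINT x|Vol. cdot (comb w (-1) w' x) (\<phi> x)) = 0"
      using integrable_cdot[OF L2(1) p] integrable_cdot[OF L2(2) p] by (simp add: comb_def cdot_diff_left)
  qed
  then show ?thesis by eventually_elim (simp add: comb_def)
qed

abbreviation "X \<equiv> Xd S L d"
abbreviation "curl \<equiv> wcurl \<Omega>"
abbreviation "ltr \<equiv> layer_trace S L d"
abbreviation "btr \<equiv> bdry_trace \<Omega>"

lemma wcurl_is_weak_curl: "is_weak_curl \<Omega> u w \<Longrightarrow> is_weak_curl \<Omega> u (curl u)"
  unfolding wcurl_def by (rule someI[of "is_weak_curl \<Omega> u"])

lemma Xd_admissible:
  assumes "u \<in> X"
  shows "admissible u (curl u) (ltr u) (btr u)"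
proof -
  have "L2 Vol u" "is_weak_curl \<Omega> u (curl u)"
    using assms wcurl_is_weak_curl by (auto simp: Xd_def Hcurl_def)
  moreover have "is_layer_trace S L d u (ltr u)"
    using assms someI_ex[of "is_layer_trace S L d u"] unfolding layer_trace_def Xd_def by blast
  moreover have "is_bdry_trace \<Omega> u (btr u)"
    using assms someI_ex[of "is_bdry_trace \<Omega> u"] unfolding bdry_trace_def Xd_def by blast
  ultimately show ?thesis unfolding admissible_iff is_layer_trace_def is_bdry_trace_def by blast
qed

text \<open>The traces in \<open>X\<^sup>d\<close> are defined with the chosen representative of the curl, which differs from \<open>w\<close> on a
null set only.\<close>

lemma admissible_Xd:
  assumes "admissible u w g h"
  shows "u \<in> X"
proof -
  have u: "L2 Vol u" and w: "is_weak_curl \<Omega> u w" using assms by (auto simp: admissible_iff)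
  have c: "is_weak_curl \<Omega> u (curl u)" using wcurl_is_weak_curl[OF w] .
  then have m: "curl u \<in> borel_measurable Vol" by (auto simp: is_weak_curl_def L2_def)
  have "admissible u (curl u) g h" using admissible_cong_AE[OF assms m weak_curl_unique[OF w c]] .
  then have "is_layer_trace S L d u g" "is_bdry_trace \<Omega> u h"
    unfolding admissible_iff is_layer_trace_def is_bdry_trace_def by auto
  then show ?thesis using u c unfolding Xd_def Hcurl_def by blast
qed

lemma Xd_L2: "u \<in> X \<Longrightarrow> L2 Vol u" "u \<in> X \<Longrightarrow> L2 Vol (curl u)" "u \<in> X \<Longrightarrow> L2 Lay (ltr u)" "u \<in> X \<Longrightarrow> L2 Bdy (btr u)"
  using admissibleD Xd_admissible by blast+

lemma Xd_comb: "u \<in> X \<Longrightarrow> v \<in> X \<Longrightarrow> comb u t v \<in> X"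
  using admissible_Xd admissible_comb Xd_admissible by blast

lemma traces_AE:
  assumes "admissible u w g h"
  shows "AE x in Vol. curl u x = w x" "AE x in Lay. ltr u x = g x" "AE x in Bdy. btr u x = h x"
  by (rule admissible_unique[OF Xd_admissible[OF admissible_Xd[OF assms]] assms]; simp)+

lemmas traces_comb = traces_AE[OF admissible_comb[OF Xd_admissible Xd_admissible]]

section \<open>Sesquilinear forms on the function space\<close>

definition form :: "(real^3 \<Rightarrow> complex) \<Rightarrow> (real^3 \<Rightarrow> complex) \<Rightarrow> (real^3 \<Rightarrow> complex) \<Rightarrow> (real^3 \<Rightarrow> complex)
    \<Rightarrow> cfield \<Rightarrow> cfield \<Rightarrow> complex" where
  "form \<alpha> \<beta> \<gamma> \<delta> u v = w_inner Vol \<alpha> (curl u) (curl v) + w_inner Vol \<beta> u v + w_inner Lay \<gamma> (ltr u) (ltr v) + w_inner Bdy \<delta> (btr u) (btr v)"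

definition sqnorm_X :: "cfield \<Rightarrow> real" where
  "sqnorm_X u = sqnorm Vol (curl u) + sqnorm Vol u + sqnorm Lay (ltr u) + sqnorm Bdy (btr u)"

lemma sqnorm_X_nonneg: "0 \<le> sqnorm_X u"
  by (simp add: sqnorm_X_def sqnorm_nonneg)

context
  fixes \<alpha> \<beta> \<gamma> \<delta> :: "real^3 \<Rightarrow> complex"
  assumes coeff: "coefficient Vol \<alpha>" "coefficient Vol \<beta>" "coefficient Lay \<gamma>" "coefficient Bdy \<delta>"
begin

lemma form_comb_left:
  assumes u: "u \<in> X" and v: "v \<in> X" and w: "w \<in> X"
  shows "form \<alpha> \<beta> \<gamma> \<delta> (comb u t v) w = form \<alpha> \<beta> \<gamma> \<delta> u w + t * form \<alpha> \<beta> \<gamma> \<delta> v w"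
proof -
  note L = Xd_L2[OF u] Xd_L2[OF v] Xd_L2[OF w] Xd_L2[OF Xd_comb[OF u v]]
  have 1: "w_inner Vol \<alpha> (curl (comb u t v)) (curl w) = w_inner Vol \<alpha> (comb (curl u) t (curl v)) (curl w)"
    using traces_comb(1)[OF u v] by (intro w_inner_cong_AE coeff L L2_comb) auto
  have 2: "w_inner Lay \<gamma> (ltr (comb u t v)) (ltr w) = w_inner Lay \<gamma> (comb (ltr u) t (ltr v)) (ltr w)"
    using traces_comb(2)[OF u v] by (intro w_inner_cong_AE coeff L L2_comb) auto
  have 3: "w_inner Bdy \<delta> (btr (comb u t v)) (btr w) = w_inner Bdy \<delta> (comb (btr u) t (btr v)) (btr w)"
    using traces_comb(3)[OF u v] by (intro w_inner_cong_AE coeff L L2_comb) auto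
  show ?thesis
    unfolding form_def 1 2 3 by (simp add: w_inner_comb_left coeff L algebra_simps)
qed

lemma form_comb_right:
  assumes u: "u \<in> X" and v: "v \<in> X" and w: "w \<in> X"
  shows "form \<alpha> \<beta> \<gamma> \<delta> w (comb u t v) = form \<alpha> \<beta> \<gamma> \<delta> w u + cnj t * form \<alpha> \<beta> \<gamma> \<delta> w v"
proof -
  note L = Xd_L2[OF u] Xd_L2[OF v] Xd_L2[OF w] Xd_L2[OF Xd_comb[OF u v]]
  have 1: "w_inner Vol \<alpha> (curl w) (curl (comb u t v)) = w_inner Vol \<alpha> (curl w) (comb (curl u) t (curl v))"
    using traces_comb(1)[OF u v] by (intro w_inner_cong_AE coeff L L2_comb) auto
  have 2: "w_inner Lay \<gamma> (ltr w) (ltr (comb u t v)) = w_inner Lay \<gamma> (ltr w) (comb (ltr u) t (ltr v))"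
    using traces_comb(2)[OF u v] by (intro w_inner_cong_AE coeff L L2_comb) auto
  have 3: "w_inner Bdy \<delta> (btr w) (btr (comb u t v)) = w_inner Bdy \<delta> (btr w) (comb (btr u) t (btr v))"
    using traces_comb(3)[OF u v] by (intro w_inner_cong_AE coeff L L2_comb) auto
  show ?thesis
    unfolding form_def 1 2 3 by (simp add: w_inner_comb_right coeff L algebra_simps)
qed

lemma form_bounded:
  obtains K where "\<And>u v. u \<in> X \<Longrightarrow> v \<in> X \<Longrightarrow> norm (form \<alpha> \<beta> \<gamma> \<delta> u v) \<le> K * (sqnorm_X u + sqnorm_X v)"
proof -
  have bd: "\<exists>K. 0 \<le> K \<and> (\<forall>x\<in>space M. norm (a x) \<le> K)" if "coefficient M a" for M and a :: "real^3 \<Rightarrow> complex"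
  proof -
    obtain K where "\<forall>x\<in>space M. norm (a x) \<le> K" using \<open>coefficient M a\<close> by (auto simp: coefficient_def)
    then show ?thesis by (intro exI[of _ "\<bar>K\<bar>"]) force
  qed
  obtain K1 K2 K3 K4 where K:
    "0 \<le> K1" "\<And>x. x \<in> space Vol \<Longrightarrow> norm (\<alpha> x) \<le> K1"
    "0 \<le> K2" "\<And>x. x \<in> space Vol \<Longrightarrow> norm (\<beta> x) \<le> K2"
    "0 \<le> K3" "\<And>x. x \<in> space Lay \<Longrightarrow> norm (\<gamma> x) \<le> K3"
    "0 \<le> K4" "\<And>x. x \<in> space Bdy \<Longrightarrow> norm (\<delta> x) \<le> K4"
    using bd[OF coeff(1)] bd[OF coeff(2)] bd[OF coeff(3)] bd[OF coeff(4)] by blast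
  have "norm (form \<alpha> \<beta> \<gamma> \<delta> u v) \<le> (K1 + K2 + K3 + K4) * (sqnorm_X u + sqnorm_X v)" if u: "u \<in> X" and v: "v \<in> X" for u v
  proof -
    note L = Xd_L2[OF u] Xd_L2[OF v]
    have mono: "k * (s + t) \<le> k * (sqnorm_X u + sqnorm_X v)" if "0 \<le> k" "s \<le> sqnorm_X u" "t \<le> sqnorm_X v" for k s t
      using that by (intro mult_left_mono add_mono)
    have le: "sqnorm Vol (curl f) \<le> sqnorm_X f" "sqnorm Vol f \<le> sqnorm_X f" "sqnorm Lay (ltr f) \<le> sqnorm_X f" "sqnorm Bdy (btr f) \<le> sqnorm_X f" for f
      using sqnorm_nonneg[of Vol "curl f"] sqnorm_nonneg[of Vol f] sqnorm_nonneg[of Lay "ltr f"] sqnorm_nonneg[of Bdy "btr f"]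
      unfolding sqnorm_X_def by linarith+
    have "norm (w_inner Vol \<alpha> (curl u) (curl v)) \<le> K1 * (sqnorm_X u + sqnorm_X v)"
      using order_trans[OF norm_w_inner_le[OF coeff(1) K(2,1) L(2,6)] mono[OF K(1) le(1) le(1)]] .
    moreover have "norm (w_inner Vol \<beta> u v) \<le> K2 * (sqnorm_X u + sqnorm_X v)"
      using order_trans[OF norm_w_inner_le[OF coeff(2) K(4,3) L(1,5)] mono[OF K(3) le(2) le(2)]] .
    moreover have "norm (w_inner Lay \<gamma> (ltr u) (ltr v)) \<le> K3 * (sqnorm_X u + sqnorm_X v)"
      using order_trans[OF norm_w_inner_le[OF coeff(3) K(6,5) L(3,7)] mono[OF K(5) le(3) le(3)]] .
    moreover have "norm (w_inner Bdy \<delta> (btr u) (btr v)) \<le> K4 * (sqnorm_X u + sqnorm_X v)"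
      using order_trans[OF norm_w_inner_le[OF coeff(4) K(8,7) L(4,8)] mono[OF K(7) le(4) le(4)]] .
    ultimately show ?thesis
      unfolding form_def distrib_right
      by (intro order_trans[OF norm_triangle_ineq] add_mono)
  qed
  then show ?thesis using that by blast
qed

lemma form_coercive:
  assumes c: "\<And>x. x \<in> space Vol \<Longrightarrow> c \<le> Re (b * \<alpha> x)" "\<And>x. x \<in> space Vol \<Longrightarrow> c \<le> Re (b * \<beta> x)"
    "\<And>x. x \<in> space Lay \<Longrightarrow> c \<le> Re (b * \<gamma> x)" "\<And>x. x \<in> space Bdy \<Longrightarrow> c \<le> Re (b * \<delta> x)"
    and u: "u \<in> X"
  shows "c * sqnorm_X u \<le> Re (b * form \<alpha> \<beta> \<gamma> \<delta> u u)"
proof -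
  note L = Xd_L2[OF u]
  show ?thesis
    using Re_w_inner_ge[OF coeff(1) L(2) c(1)] Re_w_inner_ge[OF coeff(2) L(1) c(2)]
      Re_w_inner_ge[OF coeff(3) L(3) c(3)] Re_w_inner_ge[OF coeff(4) L(4) c(4)]
    unfolding form_def sqnorm_X_def distrib_left by simp
qed

end

definition inner_X :: "cfield \<Rightarrow> cfield \<Rightarrow> real" where
  "inner_X u v = Re (form (\<lambda>x. 1) (\<lambda>x. 1) (\<lambda>x. 1) (\<lambda>x. 1) u v)"

lemma inner_X_self: "inner_X u u = sqnorm_X u"
  by (simp add: inner_X_def form_def sqnorm_X_def w_inner_1_self)

lemma inner_X_comb:
  assumes "u \<in> X" "v \<in> X" "w \<in> X"
  shows "inner_X (comb u (of_real t) v) w = inner_X u w + t * inner_X v w"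
  by (simp add: inner_X_def form_comb_left assms coefficient_const)

lemma sqnorm_X_comb:
  assumes "admissible u w g h" "admissible u' w' g' h'"
  shows "sqnorm_X (comb u t u') = sqnorm Vol (comb w t w') + sqnorm Vol (comb u t u') + sqnorm Lay (comb g t g') + sqnorm Bdy (comb h t h')"
proof -
  note a = admissible_comb[OF assms, of t]
  note T = traces_AE[OF a] and D = admissibleD[OF a] and L = Xd_L2[OF admissible_Xd[OF a]]
  show ?thesis
    unfolding sqnorm_X_def
    using sqnorm_cong_AE[OF L(2) D(2) T(1)] sqnorm_cong_AE[OF L(3) D(3) T(2)] sqnorm_cong_AE[OF L(4) D(4) T(3)]
    by simp
qed

text \<open>A Cauchy sequence has \<open>L\<^sup>2\<close> limits of its fields, curls and traces, and the quadruple of the four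
limits is admissible.\<close>

lemma Xd_semi_hilbert: "semi_hilbert X (\<lambda>u t. comb u (of_real t)) inner_X"
proof
  have "admissible (\<lambda>x. 0) (\<lambda>x. 0) (\<lambda>x. 0) (\<lambda>x. 0)"
    by (auto simp: admissible_def L2_tangential_def balanced_def cdot_zero L2_def ccross_zero)
  then show "X \<noteq> {}" using admissible_Xd by blast
next
  fix u v w :: cfield and t :: real
  assume uvw: "u \<in> X" "v \<in> X" "w \<in> X"
  then show "inner_X (comb u (complex_of_real t) v) w = inner_X u w + t * inner_X v w" by (rule inner_X_comb)
next
  fix u v :: cfield and t :: real
  assume "u \<in> X" "v \<in> X"
  then show "comb u (complex_of_real t) v \<in> X" by (rule Xd_comb)
  show "inner_X u v = inner_X v u"
    unfolding inner_X_def form_def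
    by (subst w_inner_1_swap[of Vol "curl u"], subst w_inner_1_swap[of Vol u], subst w_inner_1_swap[of Lay], subst w_inner_1_swap[of Bdy]) simp
next
  fix v show "0 \<le> inner_X v v" by (simp add: inner_X_self sqnorm_X_nonneg)
next
  fix Y :: "nat \<Rightarrow> cfield"
  assume Y: "\<And>n. Y n \<in> X"
    and cauchy: "\<And>e. 0 < e \<Longrightarrow> \<exists>N. \<forall>m\<ge>N. \<forall>n\<ge>N.
      inner_X (comb (Y m) (complex_of_real (-1)) (Y n)) (comb (Y m) (complex_of_real (-1)) (Y n)) < e"
  note A = Xd_admissible[OF Y]
  note D = Xd_L2[OF Y]
  have c: "\<exists>N. \<forall>m\<ge>N. \<forall>n\<ge>N.
      sqnorm Vol (comb (curl (Y m)) (-1) (curl (Y n))) + sqnorm Vol (comb (Y m) (-1) (Y n))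
      + sqnorm Lay (comb (ltr (Y m)) (-1) (ltr (Y n))) + sqnorm Bdy (comb (btr (Y m)) (-1) (btr (Y n))) < e"
    if "0 < e" for e
    using cauchy[OF that] by (simp add: inner_X_self sqnorm_X_comb[OF A A])
  have pos: "0 \<le> sqnorm M f" for M f by (rule sqnorm_nonneg)
  have parts: "\<exists>N. \<forall>m\<ge>N. \<forall>n\<ge>N. sqnorm Vol (comb (curl (Y m)) (-1) (curl (Y n))) < e"
    "\<exists>N. \<forall>m\<ge>N. \<forall>n\<ge>N. sqnorm Vol (comb (Y m) (-1) (Y n)) < e"
    "\<exists>N. \<forall>m\<ge>N. \<forall>n\<ge>N. sqnorm Lay (comb (ltr (Y m)) (-1) (ltr (Y n))) < e"
    "\<exists>N. \<forall>m\<ge>N. \<forall>n\<ge>N. sqnorm Bdy (comb (btr (Y m)) (-1) (btr (Y n))) < e" if e: "0 < e" for e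
  proof -
    obtain N where N: "\<And>m n. N \<le> m \<Longrightarrow> N \<le> n \<Longrightarrow>
      sqnorm Vol (comb (curl (Y m)) (-1) (curl (Y n))) + sqnorm Vol (comb (Y m) (-1) (Y n))
      + sqnorm Lay (comb (ltr (Y m)) (-1) (ltr (Y n))) + sqnorm Bdy (comb (btr (Y m)) (-1) (btr (Y n))) < e"
      using c[OF e] by blast
    have "sqnorm Vol (comb (curl (Y m)) (-1) (curl (Y n))) < e \<and> sqnorm Vol (comb (Y m) (-1) (Y n)) < e
      \<and> sqnorm Lay (comb (ltr (Y m)) (-1) (ltr (Y n))) < e \<and> sqnorm Bdy (comb (btr (Y m)) (-1) (btr (Y n))) < e"
      if "N \<le> m" "N \<le> n" for m n
      using N[OF that] pos[of Vol "comb (curl (Y m)) (-1) (curl (Y n))"] pos[of Vol "comb (Y m) (-1) (Y n)"]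
        pos[of Lay "comb (ltr (Y m)) (-1) (ltr (Y n))"] pos[of Bdy "comb (btr (Y m)) (-1) (btr (Y n))"]
      by linarith
    then show "\<exists>N. \<forall>m\<ge>N. \<forall>n\<ge>N. sqnorm Vol (comb (curl (Y m)) (-1) (curl (Y n))) < e"
      "\<exists>N. \<forall>m\<ge>N. \<forall>n\<ge>N. sqnorm Vol (comb (Y m) (-1) (Y n)) < e"
      "\<exists>N. \<forall>m\<ge>N. \<forall>n\<ge>N. sqnorm Lay (comb (ltr (Y m)) (-1) (ltr (Y n))) < e"
      "\<exists>N. \<forall>m\<ge>N. \<forall>n\<ge>N. sqnorm Bdy (comb (btr (Y m)) (-1) (btr (Y n))) < e" by blast+
  qed
  obtain w where w: "L2 Vol w" "(\<lambda>n. sqnorm Vol (comb (curl (Y n)) (-1) w)) \<longlonglongrightarrow> 0"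
    using L2_complete[OF D(2) parts(1)] by blast
  obtain u where u: "L2 Vol u" "(\<lambda>n. sqnorm Vol (comb (Y n) (-1) u)) \<longlonglongrightarrow> 0"
    using L2_complete[OF D(1) parts(2)] by blast
  obtain g where g: "L2 Lay g" "(\<lambda>n. sqnorm Lay (comb (ltr (Y n)) (-1) g)) \<longlonglongrightarrow> 0"
    using L2_complete[OF D(3) parts(3)] by blast
  obtain h where h: "L2 Bdy h" "(\<lambda>n. sqnorm Bdy (comb (btr (Y n)) (-1) h)) \<longlonglongrightarrow> 0"
    using L2_complete[OF D(4) parts(4)] by blast
  have adm: "admissible u w g h"
    by (rule admissible_limit[OF A u(1) w(1) g(1) h(1) u(2) w(2) g(2) h(2)])
  have "(\<lambda>n. sqnorm_X (comb (Y n) (-1) u)) \<longlonglongrightarrow> 0 + 0 + 0 + 0"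
    unfolding sqnorm_X_comb[OF A adm] by (intro tendsto_add w(2) u(2) g(2) h(2))
  then show "\<exists>l\<in>X. (\<lambda>n. inner_X (comb (Y n) (complex_of_real (-1)) l) (comb (Y n) (complex_of_real (-1)) l)) \<longlonglongrightarrow> 0"
    using admissible_Xd[OF adm] by (auto simp: inner_X_self)
qed

text \<open>The curl of the conjugate is the conjugate of the curl only almost everywhere, because both are
chosen representatives.\<close>

lemma ad_eq_form:
  assumes u: "u \<in> X" and v: "v \<in> X"
    and \<epsilon>: "coefficient Vol \<epsilon>" and \<sigma>: "coefficient Lay \<sigma>"
  shows "ad S L d \<omega> \<mu> \<kappa> \<epsilon> \<sigma> u v = form (\<lambda>x. 1 / of_real \<mu>) (\<lambda>x. - ((of_real \<omega>)\<^sup>2 * \<epsilon> x))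
      (\<lambda>x. - (\<i> * of_real \<omega> * \<sigma> x)) (\<lambda>x. - (\<i> * of_real \<omega> * of_real \<kappa>)) u v"
proof -
  note av = admissible_vcnj[OF Xd_admissible[OF v]]
  have "(LINT x|Vol. 1 / of_real \<mu> * cdot (curl u x) (curl (\<lambda>y. vcnj (v y)) x)) = w_inner Vol (\<lambda>x. 1 / of_real \<mu>) (curl u) (curl v)"
    unfolding w_inner_def
  proof (rule integral_cong_AE)
    note [measurable] = Xd_L2(2)[OF u, THEN L2_measurable] Xd_L2(2)[OF v, THEN L2_measurable]
      Xd_L2(2)[OF admissible_Xd[OF av], THEN L2_measurable]
    show "(\<lambda>x. 1 / of_real \<mu> * cdot (curl u x) (curl (\<lambda>y. vcnj (v y)) x)) \<in> borel_measurable Vol"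
      "(\<lambda>x. 1 / of_real \<mu> * cdot (curl u x) (vcnj (curl v x))) \<in> borel_measurable Vol" by measurable
    show "AE x in Vol. 1 / of_real \<mu> * cdot (curl u x) (curl (\<lambda>y. vcnj (v y)) x)
        = 1 / of_real \<mu> * cdot (curl u x) (vcnj (curl v x))"
      using traces_AE(1)[OF av] by eventually_elim simp
  qed
  then show ?thesis
    unfolding ad_def form_def by (simp add: w_inner_def)
qed

lemma functional_bounded:
  assumes J: "L2 Vol J" and v: "L2 Vol v"
  shows "norm (w_inner Vol (\<lambda>x. a) J v) \<le> norm a * (sqnorm Vol J + 1) * (1 + sqnorm Vol v)"
proof -
  have "norm (w_inner Vol (\<lambda>x. a) J v) \<le> norm a * (sqnorm Vol J + sqnorm Vol v)"
    by (rule norm_w_inner_le[OF coefficient_const _ _ J v]) auto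
  also have "sqnorm Vol J + sqnorm Vol v \<le> (sqnorm Vol J + 1) * (1 + sqnorm Vol v)"
    using sqnorm_nonneg[of Vol J] sqnorm_nonneg[of Vol v] by (simp add: algebra_simps)
  finally show ?thesis by (simp add: mult_left_mono mult.assoc)
qed

end

section \<open>Existence and uniqueness of the solution\<close>

theorem theorem2p3:
  fixes S :: "(real^2) set" and L d \<omega> \<mu> \<kappa> c C :: real
    and \<epsilon> \<sigma> :: "real^3 \<Rightarrow> complex" and J :: "real^3 \<Rightarrow> complex^3"
  assumes "open S" and "bounded S" and "smooth_boundary S"
    and "0 < L" and "0 < \<omega>" and "0 < \<mu>" and "0 < \<kappa>" and "0 < d"
    and "\<epsilon> \<in> borel_measurable (lebesgue_on (cylinder S L))"
    and "\<sigma> \<in> borel_measurable (surface_on (layers S L d))"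
    and "0 < c" and "0 < C"
    and "\<forall>x\<in>cylinder S L. c \<le> Im (\<epsilon> x) \<and> Im (\<epsilon> x) \<le> C \<and> \<bar>Re (\<epsilon> x)\<bar> \<le> C"
    and "\<forall>x\<in>layers S L d.
           c \<le> 1 / d * Re (\<sigma> x) \<and> 1 / d * Re (\<sigma> x) \<le> C \<and> \<bar>1 / d * Im (\<sigma> x)\<bar> \<le> C"
    and "L2 (lebesgue_on (cylinder S L)) J"
  shows "\<exists>E\<in>Xd S L d.
           (\<forall>\<Psi>\<in>Xd S L d. ad S L d \<omega> \<mu> \<kappa> \<epsilon> \<sigma> E \<Psi> =
              \<i> * of_real \<omega> * (LINT x|lebesgue_on (cylinder S L). cdot (J x) (vcnj (\<Psi> x)))) \<and>
           (\<forall>E'\<in>Xd S L d.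
              (\<forall>\<Psi>\<in>Xd S L d. ad S L d \<omega> \<mu> \<kappa> \<epsilon> \<sigma> E' \<Psi> =
                 \<i> * of_real \<omega> * (LINT x|lebesgue_on (cylinder S L). cdot (J x) (vcnj (\<Psi> x)))) \<longrightarrow>
              (AE x in lebesgue_on (cylinder S L). E' x = E x))"
proof -
  interpret layered_cylinder S L d by unfold_locales (use assms in auto)
  have space: "space Vol = \<Omega>" "space Lay \<subseteq> layers S L d"
    by (auto simp: space_restrict_space surface_on_def)
  have \<epsilon>: "c \<le> Im (\<epsilon> x)" "Im (\<epsilon> x) \<le> C" "\<bar>Re (\<epsilon> x)\<bar> \<le> C" if "x \<in> space Vol" for x
    using assms(13) that space by auto
  have \<sigma>: "c * d \<le> Re (\<sigma> x)" "Re (\<sigma> x) \<le> C * d" "\<bar>Im (\<sigma> x)\<bar> \<le> C * d" if "x \<in> space Lay" for x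
  proof -
    have "c \<le> 1 / d * Re (\<sigma> x)" "1 / d * Re (\<sigma> x) \<le> C" "\<bar>1 / d * Im (\<sigma> x)\<bar> \<le> C"
      using assms(14) that space by auto
    then show "c * d \<le> Re (\<sigma> x)" "Re (\<sigma> x) \<le> C * d" "\<bar>Im (\<sigma> x)\<bar> \<le> C * d"
      using \<open>0 < d\<close> by (simp_all add: field_simps abs_mult)
  qed
  have co\<epsilon>: "coefficient Vol \<epsilon>"
  proof (rule coefficientI[OF assms(9), of "C + C"])
    fix x assume "x \<in> space Vol"
    then show "norm (\<epsilon> x) \<le> C + C" using cmod_le[of "\<epsilon> x"] \<epsilon>[of x] \<open>0 < c\<close> by linarith
  qed
  have co\<sigma>: "coefficient Lay \<sigma>"
  proof (rule coefficientI[OF assms(10), of "C * d + C * d"])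
    fix x assume "x \<in> space Lay"
    moreover have "0 < c * d" using \<open>0 < c\<close> \<open>0 < d\<close> by simp
    ultimately show "norm (\<sigma> x) \<le> C * d + C * d" using cmod_le[of "\<sigma> x"] \<sigma>[of x] by linarith
  qed
  define \<alpha> :: "real^3 \<Rightarrow> complex" where "\<alpha> = (\<lambda>x. 1 / of_real \<mu>)"
  define \<beta> where "\<beta> = (\<lambda>x. - ((of_real \<omega>)\<^sup>2 * \<epsilon> x))"
  define \<gamma> where "\<gamma> = (\<lambda>x. - (\<i> * of_real \<omega> * \<sigma> x))"
  define \<delta> :: "real^3 \<Rightarrow> complex" where "\<delta> = (\<lambda>x. - (\<i> * of_real \<omega> * of_real \<kappa>))"
  have scale: "coefficient M (\<lambda>x. a * f x)" if "coefficient M f" for M and a :: complex and f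
  proof -
    obtain K where K: "f \<in> borel_measurable M" "\<forall>x\<in>space M. norm (f x) \<le> K"
      using \<open>coefficient M f\<close> by (auto simp: coefficient_def)
    then show ?thesis
      by (intro coefficientI[of _ _ "norm a * K"]) (auto simp: norm_mult intro: mult_left_mono)
  qed
  have co: "coefficient Vol \<alpha>" "coefficient Vol \<beta>" "coefficient Lay \<gamma>" "coefficient Bdy \<delta>"
    unfolding \<alpha>_def \<beta>_def \<gamma>_def \<delta>_def
    using scale[OF co\<epsilon>, of "- ((of_real \<omega>)\<^sup>2)"] scale[OF co\<sigma>, of "- (\<i> * of_real \<omega>)"]
    by (simp_all add: coefficient_const)
  let ?a = "form \<alpha> \<beta> \<gamma> \<delta>"
  have ad: "ad S L d \<omega> \<mu> \<kappa> \<epsilon> \<sigma> u v = ?a u v" if "u \<in> X" "v \<in> X" for u v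
    unfolding \<alpha>_def \<beta>_def \<gamma>_def \<delta>_def using that co\<epsilon> co\<sigma> by (rule ad_eq_form)
  let ?l = "\<lambda>v. w_inner Vol (\<lambda>x. \<i> * of_real \<omega>) J v"
  have l: "\<i> * of_real \<omega> * (LINT x|Vol. cdot (J x) (vcnj (v x))) = ?l v" for v
    by (simp add: w_inner_def)
  \<comment> \<open>The factor \<open>1 + i m\<close>: the lower bound \<open>m c\<close> of the terms from the imaginary part exceeds by \<open>c\<close> the
    bound \<open>C\<close> on the terms without a sign.\<close>
  define m where "m = C / c + 1"
  have m: "0 < m" "m * c = C + c" using \<open>0 < c\<close> \<open>0 < C\<close> by (auto simp: m_def field_simps)
  define b where "b = Complex 1 m"
  define \<eta> where "\<eta> = min (min (1 / \<mu>) (\<omega>\<^sup>2 * c)) (min (\<omega> * (c * d)) (\<omega> * \<kappa> * m))"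
  have \<eta>: "0 < \<eta>" using assms m by (simp add: \<eta>_def)
  have coercive: "\<eta> * sqnorm_X u \<le> Re (b * ?a u u)" if "u \<in> X" for u
  proof (rule form_coercive[OF co _ _ _ _ that])
    show "\<eta> \<le> Re (b * \<alpha> x)" for x
    proof -
      have "Re (b * \<alpha> x) = 1 / \<mu>" by (simp add: \<alpha>_def b_def)
      then show ?thesis by (simp add: \<eta>_def min_le_iff_disj)
    qed
    show "\<eta> \<le> Re (b * \<delta> x)" for x by (simp add: \<delta>_def b_def \<eta>_def min_le_iff_disj mult_ac)
    show "\<eta> \<le> Re (b * \<beta> x)" if "x \<in> space Vol" for x
    proof -
      have "m * c \<le> m * Im (\<epsilon> x)" using \<epsilon>(1)[OF that] m(1) by (intro mult_left_mono) auto
      then have "c \<le> m * Im (\<epsilon> x) - Re (\<epsilon> x)" using \<epsilon>(3)[OF that] m(2) by linarith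
      then have "\<omega>\<^sup>2 * c \<le> \<omega>\<^sup>2 * (m * Im (\<epsilon> x) - Re (\<epsilon> x))" by (intro mult_left_mono) auto
      also have "\<dots> = Re (b * \<beta> x)" by (simp add: \<beta>_def b_def power2_eq_square algebra_simps)
      finally show ?thesis by (simp add: \<eta>_def min_le_iff_disj)
    qed
    show "\<eta> \<le> Re (b * \<gamma> x)" if "x \<in> space Lay" for x
    proof -
      have "m * (c * d) \<le> m * Re (\<sigma> x)" using \<sigma>(1)[OF that] m(1) by (intro mult_left_mono) auto
      moreover have "m * (c * d) = C * d + c * d" using m(2) by (metis distrib_right mult.assoc)
      ultimately have "c * d \<le> m * Re (\<sigma> x) + Im (\<sigma> x)" using \<sigma>(3)[OF that] by linarith
      then have "\<omega> * (c * d) \<le> \<omega> * (m * Re (\<sigma> x) + Im (\<sigma> x))" using \<open>0 < \<omega>\<close> by (intro mult_left_mono) auto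
      also have "\<dots> = Re (b * \<gamma> x)" by (simp add: \<gamma>_def b_def algebra_simps)
      finally show ?thesis by (simp add: \<eta>_def min_le_iff_disj)
    qed
  qed
  obtain K where K: "\<And>u v. u \<in> X \<Longrightarrow> v \<in> X \<Longrightarrow> norm (?a u v) \<le> K * (sqnorm_X u + sqnorm_X v)"
    using form_bounded[OF co] by blast
  obtain E where E: "E \<in> X" "\<And>v. v \<in> X \<Longrightarrow> ?a E v = ?l v"
  proof (rule lax_milgram[OF Xd_semi_hilbert Xd_comb, of ?a K \<eta> b ?l "norm (\<i> * of_real \<omega>) * (sqnorm Vol J + 1)"])
    show "norm (?a u v) \<le> K * (inner_X u u + inner_X v v)" if "u \<in> X" "v \<in> X" for u v
      using K[OF that] by (simp add: inner_X_self)
    show "\<eta> * inner_X v v \<le> Re (b * ?a v v)" if "v \<in> X" for v using coercive[OF that] by (simp add: inner_X_self)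
    show "norm (?l v) \<le> norm (\<i> * of_real \<omega>) * (sqnorm Vol J + 1) * (1 + inner_X v v)" if "v \<in> X" for v
    proof (rule order_trans[OF functional_bounded[OF assms(15) Xd_L2(1)[OF that]]])
      have "sqnorm Vol v \<le> sqnorm_X v" unfolding sqnorm_X_def
        using sqnorm_nonneg[of Vol "curl v"] sqnorm_nonneg[of Lay "ltr v"] sqnorm_nonneg[of Bdy "btr v"] by linarith
      then show "norm (\<i> * of_real \<omega>) * (sqnorm Vol J + 1) * (1 + sqnorm Vol v)
          \<le> norm (\<i> * of_real \<omega>) * (sqnorm Vol J + 1) * (1 + inner_X v v)"
        using sqnorm_nonneg[of Vol J] by (intro mult_left_mono mult_nonneg_nonneg) (auto simp: inner_X_self)
    qed
    show "?l (comb u t v) = ?l u + cnj t * ?l v" if "u \<in> X" "v \<in> X" for u v t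
      by (intro w_inner_comb_right coefficient_const assms Xd_L2 that)
    show "b \<noteq> 0" by (simp add: b_def complex_eq_iff)
  qed (use \<eta> in \<open>auto simp: form_comb_left[OF co] form_comb_right[OF co]\<close>)
  have unique: "AE x in Vol. E' x = E x" if E': "E' \<in> X" "\<And>v. v \<in> X \<Longrightarrow> ?a E' v = ?l v" for E'
  proof -
    define z where "z = comb E' (-1) E"
    have z: "z \<in> X" unfolding z_def by (intro Xd_comb E E')
    have "?a z z = 0"
      using form_comb_left[OF co E'(1) E(1) z, of "-1"] E(2)[OF z] E'(2)[OF z] by (simp add: z_def[symmetric])
    then have "\<eta> * sqnorm_X z \<le> 0" using coercive[OF z] by simp
    then have "sqnorm_X z \<le> 0" using \<eta> by (simp add: mult_le_0_iff)
    then have "sqnorm Vol z = 0"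
      using sqnorm_nonneg[of Vol "curl z"] sqnorm_nonneg[of Vol z] sqnorm_nonneg[of Lay "ltr z"] sqnorm_nonneg[of Bdy "btr z"]
      unfolding sqnorm_X_def by linarith
    from sqnorm_eq_0_AE[OF Xd_L2(1)[OF z] this] show ?thesis
      by eventually_elim (simp add: z_def comb_def)
  qed
  show ?thesis
  proof (intro bexI[OF _ E(1)] conjI ballI impI)
    show "ad S L d \<omega> \<mu> \<kappa> \<epsilon> \<sigma> E \<Psi> = \<i> * of_real \<omega> * (LINT x|Vol. cdot (J x) (vcnj (\<Psi> x)))" if "\<Psi> \<in> X" for \<Psi>
      using E that by (simp add: ad l)
    fix E' assume E': "E' \<in> X"
      "\<forall>\<Psi>\<in>X. ad S L d \<omega> \<mu> \<kappa> \<epsilon> \<sigma> E' \<Psi> = \<i> * of_real \<omega> * (LINT x|Vol. cdot (J x) (vcnj (\<Psi> x)))"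
    show "AE x in Vol. E' x = E x"
    proof (rule unique[OF E'(1)])
      fix v assume "v \<in> X"
      then show "?a E' v = ?l v" using E' ad[OF E'(1)] l by simp
    qed
  qed
qed

end
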